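(* Let $\Omega\subset\mathbb{R}^d$ ($d\ge2$) be a bounded open set with Lipschitz boundary. (i) Let $\widetilde U:\partial\Omega\times\mathcal{L}(\mathbb{R}^d;\mathbb{R}^d)\to\mathbb{R}$. The map $\mathcal{L}(\mathbb{R}^d;\mathbb{R}^d)\ni A\mapsto\widetilde U(x,A_{|T_x\partial\Omega})$ is polyconvex for $\mathcal{H}^{d-1}$-a.e. $x\in\partial\Omega$ if and only if the map $U:T^d\partial\Omega\to\mathbb{R}$ defined as $U:=\widetilde U_{|T^d\partial\Omega}$ is tangentially polyconvex. (ii) Let $U:\partial\Omega\times\mathcal{L}(\mathbb{R}^d;\mathbb{R}^d)\to\mathbb{R}$ be such that $U(x,\cdot)$ is polyconvex for $\mathcal{H}^{d-1}$-a.e. $x\in\partial\Omega$. Then $U_{|T^d\partial\Omega}$ is tangentially polyconvex.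
   Context: $T_x\partial\Omega$ is the tangent space of $\partial\Omega$ at $x$ (it exists for $\mathcal{H}^{d-1}$-a.e. $x$), $n(x)$ is the unit outward normal, and $T^d\partial\Omega:=\{(x,F):x\in\partial\Omega,\ F\in(T_x\partial\Omega)^d\}$. A $d$-tuple $(w_1,\dots,w_d)\in(T_x\partial\Omega)^d$ is identified with the linear map $F\in\mathcal{L}(T_x\partial\Omega;\mathbb{R}^d)$, $Fv=(w_1\cdot v,\dots,w_d\cdot v)$ (so the $w_i$ are the rows of $F$). A map $F\in\mathcal{L}(T_x\partial\Omega;\mathbb{R}^d)$ is regarded as an element of $\mathcal{L}(\mathbb{R}^d;\mathbb{R}^d)$ through its linear extension $F_x$ with $F_xn(x)=0$; this gives meaning to $\widetilde U(x,A_{|T_x\partial\Omega})$ and to the restriction of a function on $\partial\Omega\times\mathcal{L}(\mathbb{R}^d;\mathbb{R}^d)$ to $T^d\partial\Omega$. For a $d\times m$ matrix $F$, $m\le d$, $M(F)\in\mathbb{R}^{\nu_m}$ is the sequence (in a fixed order) of all minors of $F$ of all orders $1\le k\le m$, with $\nu_m=\sum_{k=1}^m\binom mk\binom dk$. Polyconvexity: if $V\subset\mathbb{R}^d$ is an $m$-dimensional subspace, a function $W_0:\mathcal{L}(V;\mathbb{R}^d)\to\mathbb{R}$ is polyconvex if there exist a basis of $V$ and a convex function $\Phi:\mathbb{R}^{\nu_m}\to\mathbb{R}$ with $W_0(F)=\Phi(M(F))$ for all $F\in\mathcal{L}(V;\mathbb{R}^d)$, where $M(F)$ refers to the minors of the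 matrix of $F$ with respect to the basis of $V$ and the canonical basis of $\mathbb{R}^d$. A measurable basis of $T\partial\Omega$ is a family of measurable maps $v_1,\dots,v_{d-1}:\partial\Omega\to\mathbb{R}^d$ such that $\{v_1(x),\dots,v_{d-1}(x)\}$ is a basis of $T_x\partial\Omega$ for $\mathcal{H}^{d-1}$-a.e. $x\in\partial\Omega$. Tangential polyconvexity: $U:T^d\partial\Omega\to\mathbb{R}$ is tangentially polyconvex if there exist a measurable basis of $T\partial\Omega$ and a function $\Phi:\partial\Omega\times\mathbb{R}^{\nu_{d-1}}\to\mathbb{R}$ such that for $\mathcal{H}^{d-1}$-a.e. $x\in\partial\Omega$, $\Phi(x,\cdot)$ is convex and $U(x,F)=\Phi(x,M(F))$ for every $F\in\mathcal{L}(T_x\partial\Omega;\mathbb{R}^d)$, where $M(F)$ is computed with respect to that basis and the canonical basis of $\mathbb{R}^d$. *)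

theory Defs
  imports "Jordan_Normal_Form.Determinant" "HOL-Analysis.Analysis"
begin

no_notation Matrix.vec_index (infixl "$" 100)

text \<open>The case distinction gives the empty set weight 0 also for \<open>k = 0\<close>. Boundedness has to be
  required explicitly because \<^const>\<open>diameter\<close> has no meaningful value on unbounded sets.\<close>

definition hausdorff_pre :: "nat \<Rightarrow> real \<Rightarrow> 'a::metric_space set \<Rightarrow> ennreal" where
  "hausdorff_pre k \<delta> A =
    (INF C \<in> {C :: nat \<Rightarrow> 'a set. A \<subseteq> (\<Union>i. C i) \<and> (\<forall>i. bounded (C i) \<and> diameter (C i) \<le> \<delta>)}.
      \<Sum>i. if C i = {} then 0 else ennreal (unit_ball_vol (real k) * (diameter (C i) / 2) ^ k))"

definition hausdorff_outer :: "nat \<Rightarrow> 'a::metric_space set \<Rightarrow> ennreal" where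
  "hausdorff_outer k A = (SUP \<delta> \<in> {0<..}. hausdorff_pre k \<delta> A)"

definition hausdorff_measure :: "nat \<Rightarrow> 'a::metric_space measure" where
  "hausdorff_measure k =
    measure_of UNIV (lambda_system UNIV UNIV (hausdorff_outer k)) (hausdorff_outer k)"

lemma hausdorff_pre_mono: "A \<subseteq> B \<Longrightarrow> hausdorff_pre k \<delta> A \<le> hausdorff_pre k \<delta> B"
  unfolding hausdorff_pre_def by (rule INF_superset_mono) auto

lemma hausdorff_pre_empty: "0 \<le> \<delta> \<Longrightarrow> hausdorff_pre k \<delta> ({} :: 'a::metric_space set) = 0"
proof -
  assume "0 \<le> \<delta>"
  then have "hausdorff_pre k \<delta> ({} :: 'a set) \<le> (\<Sum>i::nat. 0)"
    unfolding hausdorff_pre_def by (intro INF_lower2[of "\<lambda>_. {}"]) auto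
  then show ?thesis by simp
qed

lemma hausdorff_pre_UN:
  fixes A :: "nat \<Rightarrow> 'a::metric_space set"
  shows "hausdorff_pre k \<delta> (\<Union>n. A n) \<le> (\<Sum>n. hausdorff_pre k \<delta> (A n))"
proof (rule ennreal_le_epsilon)
  let ?w = "\<lambda>C::'a set. if C = {} then 0 else ennreal (unit_ball_vol (real k) * (diameter C / 2) ^ k)"
  fix e :: real
  assume fin: "(\<Sum>n. hausdorff_pre k \<delta> (A n)) < top_class.top" and e: "0 < e"
  define Q where "Q n C \<longleftrightarrow> A n \<subseteq> (\<Union>i. C i) \<and> (\<forall>i. bounded (C i) \<and> diameter (C i) \<le> \<delta>) \<and>
      (\<Sum>i::nat. ?w (C i)) \<le> hausdorff_pre k \<delta> (A n) + ennreal (e * (1/2) ^ Suc n)" for n C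
  have "\<exists>C. Q n C" for n
  proof -
    have "hausdorff_pre k \<delta> (A n) \<le> (\<Sum>n. hausdorff_pre k \<delta> (A n))"
      using sum_le_suminf[OF summableI, of "{n}" "\<lambda>n. hausdorff_pre k \<delta> (A n)"] by simp
    then have "hausdorff_pre k \<delta> (A n) \<noteq> top_class.top"
      using fin by (auto simp: top_unique)
    then have "hausdorff_pre k \<delta> (A n) < hausdorff_pre k \<delta> (A n) + ennreal (e * (1/2) ^ Suc n)"
      using e by (cases "hausdorff_pre k \<delta> (A n)")
        (auto simp flip: ennreal_plus simp: ennreal_less_iff)
    then show ?thesis
      unfolding hausdorff_pre_def[of k \<delta> "A n"] INF_less_iff Q_def by (auto intro: less_imp_le)
  qed
  then obtain C where "\<And>n. Q n (C n)" by metis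
  then have C: "\<And>n. A n \<subseteq> (\<Union>i. C n i)"
      "\<And>n i. bounded (C n i)" "\<And>n i. diameter (C n i) \<le> \<delta>"
      "\<And>n. (\<Sum>i::nat. ?w (C n i)) \<le> hausdorff_pre k \<delta> (A n) + ennreal (e * (1/2) ^ Suc n)"
    unfolding Q_def by blast+
  let ?D = "\<lambda>m. C (fst (prod_decode m)) (snd (prod_decode m))"
  have "(\<Union>n. A n) \<subseteq> (\<Union>m. ?D m)"
  proof
    fix x assume "x \<in> (\<Union>n. A n)"
    then obtain n i where "x \<in> C n i" using C(1) by blast
    then show "x \<in> (\<Union>m. ?D m)" by (intro UN_I[of "prod_encode (n, i)"]) auto
  qed
  then have "hausdorff_pre k \<delta> (\<Union>n. A n) \<le> (\<Sum>m. ?w (?D m))"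
    unfolding hausdorff_pre_def by (intro INF_lower) (auto simp: C)
  also have "\<dots> = (\<Sum>n. \<Sum>i. ?w (C n i))"
    using suminf_ennreal_2dimen[of "\<lambda>n. \<Sum>i. ?w (C n i)" "\<lambda>p. ?w (C (fst p) (snd p))"]
    by (simp only: fst_conv snd_conv)
  also have "\<dots> \<le> (\<Sum>n. hausdorff_pre k \<delta> (A n) + ennreal (e * (1/2) ^ Suc n))"
    by (intro suminf_le C summableI)
  also have "\<dots> = (\<Sum>n. hausdorff_pre k \<delta> (A n)) + (\<Sum>n. ennreal (e * (1/2) ^ Suc n))"
    by (intro suminf_add[symmetric] summableI)
  also have "\<dots> = (\<Sum>n. hausdorff_pre k \<delta> (A n)) + ennreal e"
  proof -
    have "(\<Sum>n. ennreal (e * (1/2) ^ Suc n)) = ennreal e"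
      using sums_mult[OF power_half_series, of e] e by (intro suminf_ennreal_eq) auto
    then show ?thesis by (simp only:)
  qed
  finally show "hausdorff_pre k \<delta> (\<Union>n. A n) \<le> (\<Sum>n. hausdorff_pre k \<delta> (A n)) + ennreal e" .
qed

lemma outer_measure_space_hausdorff:
  "outer_measure_space UNIV (hausdorff_outer k :: 'a::metric_space set \<Rightarrow> ennreal)"
  unfolding outer_measure_space_def
proof (intro conjI)
  have "hausdorff_outer k ({} :: 'a set) = (SUP \<delta> \<in> {0::real<..}. 0)"
    unfolding hausdorff_outer_def by (rule SUP_cong) (auto simp: hausdorff_pre_empty)
  then show "positive UNIV (hausdorff_outer k :: 'a set \<Rightarrow> ennreal)"
    by (simp add: positive_def)
  show "increasing UNIV (hausdorff_outer k :: 'a set \<Rightarrow> ennreal)"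
    unfolding increasing_def hausdorff_outer_def by (auto intro!: SUP_mono' hausdorff_pre_mono)
  show "countably_subadditive UNIV (hausdorff_outer k :: 'a set \<Rightarrow> ennreal)"
    unfolding countably_subadditive_def
  proof (intro allI impI)
    fix A :: "nat \<Rightarrow> 'a set"
    have "hausdorff_pre k \<delta> (\<Union>n. A n) \<le> (\<Sum>n. hausdorff_outer k (A n))" if "\<delta> \<in> {0<..}" for \<delta>
    proof -
      have "(\<Sum>n. hausdorff_pre k \<delta> (A n)) \<le> (\<Sum>n. hausdorff_outer k (A n))"
        unfolding hausdorff_outer_def by (intro suminf_le SUP_upper that summableI)
      with hausdorff_pre_UN show ?thesis by (rule order_trans)
    qed
    then show "hausdorff_outer k (\<Union>n. A n) \<le> (\<Sum>n. hausdorff_outer k (A n))"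
      unfolding hausdorff_outer_def[of k "\<Union>n. A n"] by (rule SUP_least)
  qed
qed

lemma measure_space_hausdorff:
  "measure_space UNIV (lambda_system UNIV UNIV (hausdorff_outer k)) (hausdorff_outer k)"
  using sigma_algebra.caratheodory_lemma[OF sigma_algebra_Pow[of UNIV], of "hausdorff_outer k"]
    outer_measure_space_hausdorff[of k] by simp

lemma space_hausdorff_measure: "space (hausdorff_measure k) = UNIV"
  unfolding hausdorff_measure_def by (rule space_measure_of) auto

lemma sets_hausdorff_measure:
  "sets (hausdorff_measure k :: 'a::metric_space measure) =
    lambda_system UNIV UNIV (hausdorff_outer k)"
proof -
  have "sigma_algebra UNIV (lambda_system UNIV UNIV (hausdorff_outer k :: 'a set \<Rightarrow> ennreal))"
    using measure_space_hausdorff unfolding measure_space_def by blast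
  then show ?thesis
    by (simp add: hausdorff_measure_def sigma_algebra.sigma_sets_eq)
qed

lemma emeasure_hausdorff_measure:
  "A \<in> sets (hausdorff_measure k) \<Longrightarrow> emeasure (hausdorff_measure k) A = hausdorff_outer k A"
  using measure_space_hausdorff[of k] unfolding sets_hausdorff_measure
  by (auto simp: hausdorff_measure_def measure_space_def intro!: emeasure_measure_of_sigma)

text \<open>Near each boundary point, \<open>\<Omega>\<close> is the strict epigraph, in some unit direction \<open>e\<close>, of a
  Lipschitz function on the hyperplane orthogonal to \<open>e\<close>.\<close>

definition lipschitz_boundary :: "'a::euclidean_space set \<Rightarrow> bool" where
  "lipschitz_boundary \<Omega> \<longleftrightarrow>
    (\<forall>x \<in> frontier \<Omega>. \<exists>r e L (\<gamma> :: 'a \<Rightarrow> real).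
       0 < r \<and> norm e = 1 \<and> L-lipschitz_on {z. e \<bullet> z = 0} \<gamma> \<and>
       \<Omega> \<inter> ball x r = {y \<in> ball x r. \<gamma> (y - (e \<bullet> y) *\<^sub>R e) < e \<bullet> y})"

definition tangent_cone :: "'a::real_normed_vector set \<Rightarrow> 'a \<Rightarrow> 'a set" where
  "tangent_cone S x =
    {v. \<exists>(y :: nat \<Rightarrow> 'a) (t :: nat \<Rightarrow> real).
       (\<forall>n. y n \<in> S \<and> 0 < t n) \<and> t \<longlonglongrightarrow> 0 \<and> (\<lambda>n. (y n - x) /\<^sub>R t n) \<longlonglongrightarrow> v}"

text \<open>The tangent space of \<open>\<partial>\<Omega>\<close> at \<open>x\<close> exists if the tangent cone is a linear subspace; at other
  points \<open>tangent_space \<Omega> x\<close> is just a cone. If \<open>\<partial>\<Omega>\<close> is near \<open>x\<close> the graph of a Lipschitz function,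
  this amounts to differentiability of that function at the point below \<open>x\<close>, and the
  subspace is then a hyperplane.\<close>

definition tangent_space :: "'a::real_normed_vector set \<Rightarrow> 'a \<Rightarrow> 'a set" where
  "tangent_space \<Omega> x = tangent_cone (frontier \<Omega>) x"

definition has_tangent_space :: "'a::real_normed_vector set \<Rightarrow> 'a \<Rightarrow> bool" where
  "has_tangent_space \<Omega> x \<longleftrightarrow> subspace (tangent_space \<Omega> x)"

text \<open>A linear map on the subspace \<open>V\<close> is identified with its linear extension to the whole space
  that vanishes on the orthogonal complement of \<open>V\<close>. For \<open>V = T\<^sub>x\<partial>\<Omega>\<close> this complement is the line
  spanned by the normal \<open>n(x)\<close>; equivalently, the rows of the matrix of the extension lie in \<open>V\<close>.\<close>

definition lin_maps :: "'a::euclidean_space set \<Rightarrow> ('a \<Rightarrow>\<^sub>L 'b::real_normed_vector) set" where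
  "lin_maps V = {F. \<forall>w \<in> orthogonal_comp V. blinfun_apply F w = 0}"

definition restr_lin :: "'a::euclidean_space set \<Rightarrow> ('a \<Rightarrow>\<^sub>L 'b) \<Rightarrow> ('a \<Rightarrow>\<^sub>L 'b::real_normed_vector)"
  where
  "restr_lin V A =
    (THE F. F \<in> lin_maps V \<and> (\<forall>v \<in> V. blinfun_apply F v = blinfun_apply A v))"

lemma ex1_restr_lin:
  fixes A :: "'a::euclidean_space \<Rightarrow>\<^sub>L 'b::real_normed_vector"
  assumes V: "subspace V"
  shows "\<exists>!F. F \<in> lin_maps V \<and> (\<forall>v \<in> V. blinfun_apply F v = blinfun_apply A v)"
proof -
  have dec: "\<exists>!u. u \<in> V \<and> x - u \<in> orthogonal_comp V" for x
  proof -
    have sV: "span V = V" using V by (rule real_vector.span_eq_iff[THEN iffD2])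
    obtain y z where "y \<in> V" "\<And>w. w \<in> V \<Longrightarrow> orthogonal z w" "x = y + z"
      using orthogonal_subspace_decomp_exists[of V x, unfolded sV] by metis
    then have yz: "y \<in> V" "x - y \<in> orthogonal_comp V"
      by (simp_all add: orthogonal_comp_def orthogonal_commute)
    have uniq: "u = y" if u: "u \<in> V" "x - u \<in> orthogonal_comp V" for u
    proof -
      have "u - y \<in> V" using V u yz by (simp add: subspace_diff)
      moreover have "(x - y) - (x - u) \<in> orthogonal_comp V"
        by (intro subspace_diff subspace_orthogonal_comp u yz)
      then have "u - y \<in> orthogonal_comp V" by simp
      ultimately have "(u - y) \<bullet> (u - y) = 0"
        unfolding orthogonal_comp_def orthogonal_def by blast
      then show ?thesis by simp
    qed
    show ?thesis
    proof (rule ex1I[of _ y])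
      show "y \<in> V \<and> x - y \<in> orthogonal_comp V" using yz by simp
      show "u = y" if "u \<in> V \<and> x - u \<in> orthogonal_comp V" for u
        using that by (intro uniq) simp_all
    qed
  qed
  define P where "P x = (THE u. u \<in> V \<and> x - u \<in> orthogonal_comp V)" for x
  have P: "P x \<in> V" "x - P x \<in> orthogonal_comp V" for x
    using theI'[OF dec[of x]] by (simp_all add: P_def)
  have P_eq: "P x = u" if "u \<in> V" "x - u \<in> orthogonal_comp V" for x u
    unfolding P_def by (rule the1_equality[OF dec]) (simp add: that)
  have PV: "P v = v" if "v \<in> V" for v
    using that subspace_0[OF subspace_orthogonal_comp] by (intro P_eq) auto
  have P0: "P w = 0" if "w \<in> orthogonal_comp V" for w
    using that V by (intro P_eq) (auto simp: subspace_0)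
  have "linear P"
  proof (rule linearI)
    fix x y and c :: real
    have "(x - P x) + (y - P y) \<in> orthogonal_comp V"
      by (intro subspace_add subspace_orthogonal_comp P)
    then show "P (x + y) = P x + P y"
      using V P by (intro P_eq subspace_add) (auto simp: algebra_simps)
    have "c *\<^sub>R (x - P x) \<in> orthogonal_comp V"
      by (intro subspace_mul subspace_orthogonal_comp P)
    then show "P (c *\<^sub>R x) = c *\<^sub>R P x"
      using V P by (intro P_eq subspace_mul) (auto simp: algebra_simps)
  qed
  then have bl: "bounded_linear (\<lambda>x. blinfun_apply A (P x))"
    by (intro bounded_linear_compose[OF blinfun.bounded_linear_right]) (simp add: linear_linear)
  show ?thesis
  proof (rule ex1I[of _ "Blinfun (\<lambda>x. blinfun_apply A (P x))"])
    show "Blinfun (\<lambda>x. blinfun_apply A (P x)) \<in> lin_maps V \<and>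
        (\<forall>v\<in>V. blinfun_apply (Blinfun (\<lambda>x. blinfun_apply A (P x))) v = blinfun_apply A v)"
      by (auto simp: lin_maps_def bounded_linear_Blinfun_apply[OF bl] PV P0 blinfun.zero_right)
  next
    fix F assume F: "F \<in> lin_maps V \<and> (\<forall>v \<in> V. blinfun_apply F v = blinfun_apply A v)"
    have "blinfun_apply F x = blinfun_apply A (P x)" for x
    proof -
      have "blinfun_apply F (x - P x) = 0" "blinfun_apply F (P x) = blinfun_apply A (P x)"
        using F P[of x] by (simp_all add: lin_maps_def)
      then show ?thesis by (simp add: blinfun.diff_right)
    qed
    then show "F = Blinfun (\<lambda>x. blinfun_apply A (P x))"
      by (intro blinfun_eqI) (simp add: bounded_linear_Blinfun_apply[OF bl])
  qed
qed

text \<open>A minor is determined by the set \<open>I\<close> of its rows and the set \<open>J\<close> of its columns; the type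
  below has \<open>\<nu> = \<Sum>k. (d choose k) * (m choose k)\<close>, \<open>k \<ge> 1\<close>, elements, see \<open>CARD_minor_index\<close>.\<close>

typedef ('r, 'c) minor_index =
  "{(I :: 'r set, J :: 'c set). finite I \<and> finite J \<and> I \<noteq> {} \<and> card I = card J}"
  by (rule exI[of _ "({undefined}, {undefined})"]) auto

instance minor_index :: (finite, finite) finite
proof
  have "inj (Rep_minor_index :: ('a, 'b) minor_index \<Rightarrow> _)"
    by (meson Rep_minor_index_inject injI)
  then show "finite (UNIV :: ('a, 'b) minor_index set)"
    by (rule finite_imageD[rotated]) simp
qed

lemma CARD_minor_index:
  assumes "CARD('c::finite) \<le> CARD('r::finite)"
  shows "CARD(('r, 'c) minor_index) =
    (\<Sum>k = 1..CARD('c). (CARD('c) choose k) * (CARD('r) choose k))"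
proof -
  let ?S = "\<lambda>k. {I :: 'r set. card I = k} \<times> {J :: 'c set. card J = k}"
  have "card (UNIV :: ('r, 'c) minor_index set) =
      card {(I :: 'r set, J :: 'c set). finite I \<and> finite J \<and> I \<noteq> {} \<and> card I = card J}"
    using type_definition.card[OF type_definition_minor_index] by blast
  also have "{(I :: 'r set, J :: 'c set). finite I \<and> finite J \<and> I \<noteq> {} \<and> card I = card J}
      = (\<Union>k \<in> {1..CARD('c)}. ?S k)"
    by (auto simp: card_mono Suc_le_eq card_gt_0_iff)
  also have "card \<dots> = (\<Sum>k = 1..CARD('c). card (?S k))"
    by (rule card_UN_disjoint) auto
  also have "\<dots> = (\<Sum>k = 1..CARD('c). (CARD('c) choose k) * (CARD('r) choose k))"
    using n_subsets[of "UNIV :: 'r set"] n_subsets[of "UNIV :: 'c set"]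
    by (simp add: card_cartesian_product mult.commute)
  finally show ?thesis .
qed

definition minor :: "real^'c::{finite,linorder}^'r::{finite,linorder} \<Rightarrow> 'r set \<Rightarrow> 'c set \<Rightarrow> real"
  where
  "minor F I J = Determinant.det (Matrix.mat (card I) (card J)
     (\<lambda>(i, j). F $ (sorted_list_of_set I ! i) $ (sorted_list_of_set J ! j)))"

definition minors ::
  "real^'c::{finite,linorder}^'r::{finite,linorder} \<Rightarrow> real^('r, 'c) minor_index" where
  "minors F = (\<chi> p. case Rep_minor_index p of (I, J) \<Rightarrow> minor F I J)"

text \<open>Bases are indexed by a finite ordered type \<open>'m\<close>; the index type is passed explicitly since
  it does not occur in the types of the other arguments. Being a basis forces \<open>CARD('m) = dim V\<close>.\<close>

definition is_basis :: "('m \<Rightarrow> 'a::real_vector) \<Rightarrow> 'a set \<Rightarrow> bool" where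
  "is_basis v V \<longleftrightarrow> inj v \<and> independent (range v) \<and> span (range v) = V"

definition matrix_wrt :: "('m \<Rightarrow> 'a::real_normed_vector) \<Rightarrow> ('a \<Rightarrow>\<^sub>L (real^'d)) \<Rightarrow> real^'m^'d" where
  "matrix_wrt v F = (\<chi> i j. blinfun_apply F (v j) $ i)"

type_synonym 'd endo =
  "(real, 'd) Finite_Cartesian_Product.vec \<Rightarrow>\<^sub>L (real, 'd) Finite_Cartesian_Product.vec"

definition polyconvex ::
  "'m::{finite,linorder} itself \<Rightarrow> (real^'d::{finite,linorder}) set \<Rightarrow> ('d endo \<Rightarrow> real) \<Rightarrow> bool" where
  "polyconvex _ V W \<longleftrightarrow>
    (\<exists>(v :: 'm \<Rightarrow> _) (\<Phi> :: real^('d, 'm) minor_index \<Rightarrow> real).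
       is_basis v V \<and> convex_on UNIV \<Phi> \<and> (\<forall>F \<in> lin_maps V. W F = \<Phi> (minors (matrix_wrt v F))))"

abbreviation surface_measure :: "(real^'d) measure" where
  "surface_measure \<equiv> hausdorff_measure (CARD('d) - 1)"

definition tangent_bundle_pow :: "(real^'d) set \<Rightarrow> ((real^'d) \<times> 'd endo) set" where
  "tangent_bundle_pow \<Omega> =
    {(x, F). x \<in> frontier \<Omega> \<and> has_tangent_space \<Omega> x \<and> F \<in> lin_maps (tangent_space \<Omega> x)}"

definition measurable_tangent_basis :: "(real^'d) set \<Rightarrow> ('m \<Rightarrow> real^'d \<Rightarrow> real^'d) \<Rightarrow> bool" where
  "measurable_tangent_basis \<Omega> v \<longleftrightarrow>
    (\<forall>j. v j \<in> borel_measurable (restrict_space surface_measure (frontier \<Omega>))) \<and>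
    (AE x\<in>frontier \<Omega> in surface_measure. is_basis (\<lambda>j. v j x) (tangent_space \<Omega> x))"

text \<open>Only the values of \<open>U\<close> on \<open>tangent_bundle_pow \<Omega>\<close> matter.\<close>

definition tangentially_polyconvex ::
  "'m::{finite,linorder} itself \<Rightarrow> (real^'d::{finite,linorder}) set \<Rightarrow>
   ((real^'d::{finite,linorder}) \<times> 'd endo \<Rightarrow> real) \<Rightarrow> bool" where
  "tangentially_polyconvex _ \<Omega> U \<longleftrightarrow>
    (\<exists>(v :: 'm \<Rightarrow> _) (\<Phi> :: _ \<Rightarrow> real^('d, 'm) minor_index \<Rightarrow> real).
       measurable_tangent_basis \<Omega> v \<and>
       (AE x\<in>frontier \<Omega> in surface_measure.
          convex_on UNIV (\<Phi> x) \<and>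
          (\<forall>F \<in> lin_maps (tangent_space \<Omega> x).
             U (x, F) = \<Phi> x (minors (matrix_wrt (\<lambda>j. v j x) F)))))"

end

theory Submission
  imports Defs
begin

text \<open>
  Fix a boundary point \<open>x\<close> whose tangent space \<open>V\<close> is a hyperplane with basis \<open>v\<close>. If the vectors of
  another family \<open>b\<close> are linear combinations of those of \<open>v\<close> with coefficients \<open>C\<close>, then the matrix
  of a linear map with respect to \<open>b\<close> is its matrix with respect to \<open>v\<close> times \<open>C\<close>. By the
  Cauchy-Binet formula the minors of a product \<open>A ** C\<close> are linear functions of the minors of
  \<open>A\<close>, and a convex function composed with a linear one stays convex. With \<open>b\<close> a basis of the
  whole space, projected orthogonally to \<open>V\<close>, this turns polyconvexity on the whole space into a
  representation in terms of the minors with respect to \<open>v\<close>. In the other direction the vectors of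
  \<open>v\<close> are combinations of the standard basis, so the same formula extends a polyconvex function on
  \<open>V\<close> to the whole space. Both parts of the theorem are this pointwise statement, because the
  convex functions at different points are unrelated.

  What the pointwise argument does not give is a measurable basis of the tangent spaces, and
  hence that tangent spaces exist almost everywhere. Near a boundary point, \<open>\<partial>\<Omega>\<close> is the graph of a
  Lipschitz function \<open>h\<close> over a hyperplane, which is identified with \<open>\<real>\<^sup>m\<close>, \<open>m = d - 1\<close>. Wherever all
  one-sided directional derivatives of \<open>h\<close> exist and depend linearly on the direction, the tangent
  cone is the graph of this linear function (\<open>tangent_cone_graph\<close>), and the images of the standard
  basis vectors form a basis that is a Borel function of the point. The exceptional points lie
  in the image of a Lebesgue null set under a Lipschitz map, which is a null set for the
  \<open>m\<close>-dimensional Hausdorff measure (\<open>hausdorff_outer_lipschitz_image_null\<close>). Finitely many charts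
  cover the compact boundary, and Borel functions are measurable for the Hausdorff measure by the
  Caratheodory criterion (\<open>sets_borel_subset_hausdorff\<close>).

  The analytic core is thus Rademacher's theorem in the form
  \<open>AE_directional_derivatives_linear\<close>. On the line, the integral of the upper right derivative of
  a Lipschitz function \<open>f\<close> is at most the increment of \<open>f\<close>; applied to \<open>f\<close> and \<open>- f\<close>, this forces
  the upper and the lower derivative to agree almost everywhere. Fubini's theorem transfers this
  to every fixed direction in \<open>\<real>\<^sup>m\<close>. Additivity in the direction follows by integrating difference
  quotients over boxes: the quotient for \<open>u + v\<close> is the quotient for \<open>u\<close> plus a translate of the
  quotient for \<open>v\<close>, and the translation vanishes in the limit.
\<close>

no_notation Matrix.scalar_prod (infix "\<bullet>" 70)

section \<open>Minors under a change of basis\<close>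

lemma minors_nth:
  assumes "card I = card J" "I \<noteq> {}"
  shows "minors F $ Abs_minor_index (I, J) = minor F I J"
  using assms by (simp add: minors_def Abs_minor_index_inverse)

lemma permutes_nat_less: "p permutes {0..<n} \<Longrightarrow> i < n \<Longrightarrow> p i < (n::nat)"
  using permutes_in_image[of p "{0..<n}" i] by simp

text \<open>If \<open>f\<close> repeats a column the determinant vanishes. Otherwise sorting the selected columns turns it
into a minor, up to the sign of the sorting permutation.\<close>

lemma det_column_selection_linear:
  fixes f :: "nat \<Rightarrow> 'm::{finite,linorder}" and I :: "'d::{finite,linorder} set"
  assumes "I \<noteq> {}"
  shows "\<exists>l. linear l \<and> (\<forall>A :: real^'m::_^'d::_.
    Determinant.det (Matrix.mat (card I) (card I) (\<lambda>(i, j). A $ (sorted_list_of_set I ! j) $ f i)) = l (minors A))"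
proof (cases "inj_on f {0..<card I}")
  case True
  define n where "n = card I"
  define r where "r = sorted_list_of_set I"
  define K where "K = f ` {0..<n}"
  define s where "s = sorted_list_of_set K"
  have cK: "card K = n" using True by (simp add: K_def n_def card_image)
  have bs: "bij_betw (\<lambda>i. s ! i) {0..<n} K"
  proof (rule bij_betw_nth)
    show "distinct s" "{0..<n} = {..<length s}" "K = set s"
      using cK by (simp_all add: s_def K_def lessThan_atLeast0)
  qed
  have bf: "bij_betw f {0..<n} K" using True by (simp add: bij_betw_def K_def n_def)
  define p where "p i = (if i < n then inv_into {0..<n} (\<lambda>i. s ! i) (f i) else i)" for i
  have "bij_betw (inv_into {0..<n} (\<lambda>i. s ! i) \<circ> f) {0..<n} {0..<n}"
    by (rule bij_betw_trans[OF bf bij_betw_inv_into[OF bs]])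
  then have "bij_betw p {0..<n} {0..<n}"
    by (rule bij_betw_cong[THEN iffD1, rotated]) (simp add: p_def)
  then have p: "p permutes {0..<n}"
    by (rule bij_imp_permutes) (simp add: p_def)
  have sp: "s ! p i = f i" if "i < n" for i
    using bij_betw_inv_into_right[OF bs, of "f i"] that by (simp add: p_def K_def)
  have "Determinant.det (Matrix.mat n n (\<lambda>(i, j). A $ (r ! j) $ f i)) =
      signof p * minors A $ Abs_minor_index (I, K)" for A :: "real^'m::_^'d::_"
  proof -
    let ?B = "Matrix.mat n n (\<lambda>(i, j). A $ (r ! j) $ (s ! i))"
    have "Determinant.det (Matrix.mat n n (\<lambda>(i, j). A $ (r ! j) $ f i)) =
        Determinant.det (Matrix.mat n n (\<lambda>(i, j). ?B $$ (p i, j)))"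
      using permutes_in_image[OF p] by (intro arg_cong[of _ _ Determinant.det] eq_matI) (auto simp: sp)
    also have "\<dots> = signof p * Determinant.det ?B"
      by (rule Determinant.det_permute_rows[OF _ p]) simp
    also have "Determinant.det ?B = Determinant.det (transpose_mat ?B)"
      by (rule Determinant.det_transpose[of _ n, symmetric]) simp
    also have "transpose_mat ?B = Matrix.mat n n (\<lambda>(i, j). A $ (r ! i) $ (s ! j))"
      by (rule eq_matI) auto
    also have "Determinant.det \<dots> = minors A $ Abs_minor_index (I, K)"
      using assms cK by (subst minors_nth) (auto simp: minor_def n_def r_def s_def)
    finally show ?thesis .
  qed
  moreover have "linear (\<lambda>x :: real^('d, 'm) minor_index. signof p * x $ Abs_minor_index (I, K))"
    by (rule linearI) (simp_all add: distrib_left)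
  ultimately show ?thesis unfolding n_def r_def by blast
next
  case False
  then obtain i j where ij: "i < card I" "j < card I" "i \<noteq> j" "f i = f j"
    by (auto simp: inj_on_def)
  have "Determinant.det (Matrix.mat (card I) (card I) (\<lambda>(i, j). A $ (sorted_list_of_set I ! j) $ f i)) = 0"
    for A :: "real^'m::_^'d::_"
    by (rule Determinant.det_identical_rows[of _ "card I" i j]) (use ij in \<open>simp_all add: row_def\<close>)
  then show ?thesis
    by (intro exI[of _ "\<lambda>_. 0"] conjI linearI) simp_all
qed

text \<open>The Cauchy-Binet formula with its coefficients, the minors of \<open>C\<close>, left implicit. Every column of \<open>A ** C\<close> is a combination of columns of
\<open>A\<close>, so multilinearity of the determinant expands a minor of the product into a sum over all ways
\<open>f\<close> to select columns of \<open>A\<close>.\<close>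

lemma minors_matrix_mult_linear:
  fixes C :: "real^'k::{finite,linorder}^'m::{finite,linorder}"
  shows "\<exists>\<Lambda>. linear \<Lambda> \<and> (\<forall>A :: real^'m::_^'d::{finite,linorder}. minors (A ** C) = \<Lambda> (minors A))"
proof -
  have "\<exists>l. linear l \<and> (\<forall>A :: real^'m::_^'d::_. minors (A ** C) $ p = l (minors A))"
    for p :: "('d, 'k) minor_index"
  proof (cases p)
    case (Abs_minor_index q)
    obtain I J where q: "q = (I, J)" by (cases q)
    define n where "n = card I"
    define r where "r = sorted_list_of_set I"
    define c where "c = sorted_list_of_set J"
    have IJ: "card I = card J" "I \<noteq> {}" using Abs_minor_index q by auto
    let ?D = "\<lambda>f (A :: real^'m::_^'d::_). Determinant.det (Matrix.mat n n (\<lambda>(i, j). A $ (r ! j) $ f i))"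
    have exp: "minors (A ** C) $ p =
        (\<Sum>f\<in>PiE {0..<n} (\<lambda>_. UNIV). (\<Prod>i = 0..<n. C $ f i $ (c ! i)) * ?D f A)" for A
    proof -
      let ?M = "Matrix.mat n n (\<lambda>(i, j). (A ** C) $ (r ! i) $ (c ! j))"
      let ?P = "{p. p permutes {0..<n}}"
      have "minors (A ** C) $ p = Determinant.det ?M"
        using IJ by (simp add: Abs_minor_index(1) q minors_nth minor_def n_def r_def c_def)
      \<comment> \<open>Transposing makes the columns of the product the index over which the Leibniz formula multiplies.\<close>
      also have "\<dots> = Determinant.det (transpose_mat ?M)"
        by (rule Determinant.det_transpose[of _ n, symmetric]) simp
      also have "\<dots> = (\<Sum>\<pi>\<in>?P. signof \<pi> * (\<Prod>i = 0..<n. (A ** C) $ (r ! \<pi> i) $ (c ! i)))"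
        by (subst det_def'[of _ n]) (auto intro!: sum.cong prod.cong simp: permutes_nat_less)
      also have "\<dots> = (\<Sum>\<pi>\<in>?P. signof \<pi> *
          (\<Sum>f\<in>PiE {0..<n} (\<lambda>_. UNIV). \<Prod>i = 0..<n. A $ (r ! \<pi> i) $ f i * C $ f i $ (c ! i)))"
        by (subst prod_sum_PiE[symmetric]) (auto simp: matrix_matrix_mult_def)
      also have "\<dots> = (\<Sum>f\<in>PiE {0..<n} (\<lambda>_. UNIV). \<Sum>\<pi>\<in>?P. signof \<pi> *
          (\<Prod>i = 0..<n. A $ (r ! \<pi> i) $ f i * C $ f i $ (c ! i)))"
        by (subst sum.swap) (simp add: sum_distrib_left)
      also have "\<dots> = (\<Sum>f\<in>PiE {0..<n} (\<lambda>_. UNIV). (\<Prod>i = 0..<n. C $ f i $ (c ! i)) * ?D f A)"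
      proof (rule sum.cong[OF refl])
        fix f
        have "?D f A = (\<Sum>\<pi>\<in>?P. signof \<pi> * (\<Prod>i = 0..<n. A $ (r ! \<pi> i) $ f i))"
          by (subst det_def'[of _ n]) (auto intro!: sum.cong prod.cong simp: permutes_nat_less)
        then show "(\<Sum>\<pi>\<in>?P. signof \<pi> * (\<Prod>i = 0..<n. A $ (r ! \<pi> i) $ f i * C $ f i $ (c ! i))) =
            (\<Prod>i = 0..<n. C $ f i $ (c ! i)) * ?D f A"
          by (simp add: prod.distrib sum_distrib_left mult_ac)
      qed
      finally show ?thesis .
    qed
    have "\<forall>f. \<exists>l. linear l \<and> (\<forall>A. ?D f A = l (minors A))"
      using det_column_selection_linear[OF IJ(2)] unfolding n_def r_def by blast
    then obtain l where l: "\<And>f. linear (l f)" "\<And>f A. ?D f A = l f (minors A)" by metis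
    let ?l = "\<lambda>x. \<Sum>f\<in>PiE {0..<n} (\<lambda>_. UNIV). (\<Prod>i = 0..<n. C $ f i $ (c ! i)) * l f x"
    have "linear ?l"
      by (rule linearI) (simp_all add: linear_add[OF l(1)] linear_cmul[OF l(1)] distrib_left
          sum.distrib sum_distrib_left mult.left_commute)
    moreover have "minors (A ** C) $ p = ?l (minors A)" for A
      unfolding exp by (simp only: l(2))
    ultimately show ?thesis by blast
  qed
  then obtain l where l: "\<And>p. linear (l p)" "\<And>p A. minors (A ** C) $ p = l p (minors (A :: real^'m::_^'d::_))"
    by metis
  show ?thesis
    by (intro exI[of _ "\<lambda>x. \<chi> p. l p x"] conjI allI)
      (auto simp: linear_iff vec_eq_iff l(2) linear_add[OF l(1)] linear_cmul[OF l(1)])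
qed

lemma convex_on_linear_compose:
  assumes "convex_on UNIV \<Phi>" "linear \<Lambda>"
  shows "convex_on UNIV (\<lambda>x. \<Phi> (\<Lambda> x))"
  using assms by (auto simp: convex_on_def linear_add linear_cmul)

text \<open>The map \<open>P\<close> allows for vectors \<open>b j\<close> outside the span of \<open>v\<close>: it stands for the identity or for the
orthogonal projection to this span, which a map \<open>F\<close> that vanishes on the orthogonal complement does
not notice.\<close>

lemma matrix_wrt_change_of_basis:
  fixes v :: "'m::finite \<Rightarrow> 'a::euclidean_space" and b :: "'k::finite \<Rightarrow> 'a"
  assumes "\<And>j. P (b j) \<in> span (range v)"
  shows "\<exists>C :: real^'k::finite^'m::finite. \<forall>F :: 'a \<Rightarrow>\<^sub>L (real^'d).
    (\<forall>j. blinfun_apply F (b j) = blinfun_apply F (P (b j))) \<longrightarrow> matrix_wrt b F = matrix_wrt v F ** C"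
proof -
  have "\<exists>c. P (b j) = (\<Sum>k\<in>UNIV. c k *\<^sub>R v k)" for j
  proof -
    let ?S = "range (\<lambda>c. \<Sum>k\<in>UNIV. c k *\<^sub>R v k)"
    have "subspace ?S"
      unfolding subspace_def
    proof (intro conjI ballI allI)
      show "0 \<in> ?S" by (rule range_eqI[of _ _ "\<lambda>_. 0"]) simp
    next
      fix x y assume "x \<in> ?S" "y \<in> ?S"
      then obtain c e where "x = (\<Sum>k\<in>UNIV. c k *\<^sub>R v k)" "y = (\<Sum>k\<in>UNIV. e k *\<^sub>R v k)" by blast
      then show "x + y \<in> ?S"
        by (intro range_eqI[of _ _ "\<lambda>k. c k + e k"]) (simp add: scaleR_left_distrib sum.distrib)
    next
      fix a :: real and x assume "x \<in> ?S"
      then obtain c where "x = (\<Sum>k\<in>UNIV. c k *\<^sub>R v k)" by blast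
      then show "a *\<^sub>R x \<in> ?S"
        by (intro range_eqI[of _ _ "\<lambda>k. a * c k"]) (simp add: scaleR_sum_right)
    qed
    moreover have "v i \<in> ?S" for i
    proof (rule range_eqI[of _ _ "\<lambda>k. if k = i then 1 else 0"])
      have "(\<Sum>k\<in>UNIV. (if k = i then 1 else 0) *\<^sub>R v k) = (\<Sum>k\<in>UNIV. if k = i then v k else 0)"
        by (rule sum.cong) auto
      then show "v i = (\<Sum>k\<in>UNIV. (if k = i then 1 else 0) *\<^sub>R v k)" by simp
    qed
    ultimately have "span (range v) \<subseteq> ?S" by (intro span_minimal) auto
    then show ?thesis using assms[of j] by blast
  qed
  then obtain c where c: "\<And>j. P (b j) = (\<Sum>k\<in>UNIV. c j k *\<^sub>R v k)" by metis
  show ?thesis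
    by (rule exI[of _ "\<chi> k j. c j k"])
      (auto simp: matrix_wrt_def matrix_matrix_mult_def vec_eq_iff c blinfun.sum_right
        blinfun.scaleR_right mult.commute)
qed

section \<open>The Caratheodory criterion for Hausdorff measure\<close>

lemma hausdorff_pre_antimono: "\<delta> \<le> \<delta>' \<Longrightarrow> hausdorff_pre k \<delta>' A \<le> hausdorff_pre k \<delta> A"
  unfolding hausdorff_pre_def by (rule INF_superset_mono) (auto intro: order_trans)

lemma hausdorff_outer_mono: "A \<subseteq> B \<Longrightarrow> hausdorff_outer k A \<le> hausdorff_outer k B"
  unfolding hausdorff_outer_def by (auto intro!: SUP_mono' hausdorff_pre_mono)

lemma hausdorff_outer_empty: "hausdorff_outer k ({} :: 'a::metric_space set) = 0"
  using outer_measure_space_hausdorff[where 'a='a, of k] by (simp add: outer_measure_space_def positive_def)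

lemma hausdorff_outer_UN:
  fixes A :: "nat \<Rightarrow> 'a::metric_space set"
  shows "hausdorff_outer k (\<Union>n. A n) \<le> (\<Sum>n. hausdorff_outer k (A n))"
proof -
  have "hausdorff_pre k \<delta> (\<Union>n. A n) \<le> (\<Sum>n. hausdorff_outer k (A n))" if "\<delta> \<in> {0<..}" for \<delta>
  proof -
    have "(\<Sum>n. hausdorff_pre k \<delta> (A n)) \<le> (\<Sum>n. hausdorff_outer k (A n))"
      unfolding hausdorff_outer_def by (intro suminf_le SUP_upper that summableI)
    with hausdorff_pre_UN show ?thesis by (rule order_trans)
  qed
  then show ?thesis
    unfolding hausdorff_outer_def[of k "\<Union>n. A n"] by (rule SUP_least)
qed

lemma hausdorff_outer_Un:
  "hausdorff_outer k (A \<union> B) \<le> hausdorff_outer k A + hausdorff_outer k B"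
  using hausdorff_outer_UN[of k "binaryset A B"] suminf_binaryset_eq[of "hausdorff_outer k" A B]
  by (simp add: UN_binaryset_eq hausdorff_outer_empty)

text \<open>A set of diameter at most \<open>\<delta>\<close> cannot meet both \<open>A\<close> and \<open>B\<close>, so every admissible cover of the union
splits into disjoint subfamilies that cover \<open>A\<close> and \<open>B\<close>.\<close>

lemma hausdorff_pre_separated:
  fixes A B :: "'a::metric_space set"
  assumes sep: "\<And>a b. a \<in> A \<Longrightarrow> b \<in> B \<Longrightarrow> \<delta> < dist a b"
  shows "hausdorff_pre k \<delta> A + hausdorff_pre k \<delta> B \<le> hausdorff_pre k \<delta> (A \<union> B)"
  unfolding hausdorff_pre_def[of k \<delta> "A \<union> B"]
proof (rule INF_greatest)
  let ?w = "\<lambda>C::'a set. if C = {} then 0 else ennreal (unit_ball_vol (real k) * (diameter C / 2) ^ k)"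
  fix C :: "nat \<Rightarrow> 'a set"
  assume "C \<in> {C. A \<union> B \<subseteq> (\<Union>i. C i) \<and> (\<forall>i. bounded (C i) \<and> diameter (C i) \<le> \<delta>)}"
  then have cov: "A \<union> B \<subseteq> (\<Union>i. C i)" and C: "\<And>i. bounded (C i)" "\<And>i. diameter (C i) \<le> \<delta>"
    by auto
  have "0 \<le> \<delta>" using diameter_ge_0[OF C(1), of 0] C(2)[of 0] by simp
  let ?C = "\<lambda>S i. if C i \<inter> S = {} then {} else C i"
  have le: "hausdorff_pre k \<delta> S \<le> (\<Sum>i. ?w (?C S i))" if "S \<subseteq> A \<union> B" for S
    unfolding hausdorff_pre_def
  proof (rule INF_lower2[of "?C S"], intro CollectI conjI allI)
    show "S \<subseteq> (\<Union>i. ?C S i)"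
    proof
      fix x assume x: "x \<in> S"
      have "x \<in> (\<Union>i. C i)" by (rule subsetD[OF cov subsetD[OF that x]])
      then obtain i where "x \<in> C i" by blast
      then have "x \<in> ?C S i" using x by auto
      then show "x \<in> (\<Union>i. ?C S i)" by blast
    qed
    show "bounded (?C S i)" "diameter (?C S i) \<le> \<delta>" for i
      using C \<open>0 \<le> \<delta>\<close> by auto
  qed (rule order_refl)
  have "?w (?C A i) + ?w (?C B i) \<le> ?w (C i)" for i
  proof -
    have "C i \<inter> A = {} \<or> C i \<inter> B = {}"
    proof (rule ccontr)
      assume "\<not> ?thesis"
      then obtain a b where "a \<in> C i" "a \<in> A" "b \<in> C i" "b \<in> B" by blast
      then show False
        using sep[of a b] diameter_bounded_bound[OF C(1), of a i b] C(2)[of i] by simp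
    qed
    then show ?thesis by (elim disjE) simp_all
  qed
  then have "(\<Sum>i. ?w (?C A i) + ?w (?C B i)) \<le> (\<Sum>i. ?w (C i))"
    by (intro suminf_le summableI)
  also have "(\<Sum>i. ?w (?C A i) + ?w (?C B i)) = (\<Sum>i. ?w (?C A i)) + (\<Sum>i. ?w (?C B i))"
    by (intro suminf_add[symmetric] summableI)
  finally show "hausdorff_pre k \<delta> A + hausdorff_pre k \<delta> B \<le> (\<Sum>i. ?w (C i))"
    using add_mono[OF le[of A] le[of B]] by (auto intro: order_trans)
qed

lemma hausdorff_outer_separated:
  assumes "0 < r" and sep: "\<And>a b. a \<in> A \<Longrightarrow> b \<in> B \<Longrightarrow> r \<le> dist a b"
  shows "hausdorff_outer k A + hausdorff_outer k B \<le> hausdorff_outer k (A \<union> B)"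
proof -
  have "(SUP \<delta>\<in>{0<..}. hausdorff_pre k \<delta> A + hausdorff_pre k \<delta> B) =
      hausdorff_outer k A + hausdorff_outer k B"
    unfolding hausdorff_outer_def
  proof (rule SUP_add_directed_ennreal)
    fix d e :: real assume "d \<in> {0<..}" "e \<in> {0<..}"
    then show "\<exists>c\<in>{0<..}. hausdorff_pre k d A + hausdorff_pre k e B
        \<le> hausdorff_pre k c A + hausdorff_pre k c B"
      by (intro bexI[of _ "min d e"] add_mono hausdorff_pre_antimono) auto
  qed
  moreover have "hausdorff_pre k \<delta> A + hausdorff_pre k \<delta> B \<le> hausdorff_outer k (A \<union> B)"
    if "\<delta> \<in> {0<..}" for \<delta>
  proof -
    let ?d = "min \<delta> (r / 2)"
    have "hausdorff_pre k \<delta> A + hausdorff_pre k \<delta> B \<le> hausdorff_pre k ?d A + hausdorff_pre k ?d B"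
      by (intro add_mono hausdorff_pre_antimono) auto
    also have "\<dots> \<le> hausdorff_pre k ?d (A \<union> B)"
    proof (rule hausdorff_pre_separated)
      show "?d < dist a b" if "a \<in> A" "b \<in> B" for a b
        using sep[OF that] \<open>0 < r\<close> by linarith
    qed
    also have "\<dots> \<le> hausdorff_outer k (A \<union> B)"
      unfolding hausdorff_outer_def using that \<open>0 < r\<close> by (intro SUP_upper) auto
    finally show ?thesis .
  qed
  ultimately show ?thesis by (metis (no_types, lifting) SUP_least)
qed

text \<open>The Caratheodory criterion. An arbitrary set \<open>X\<close> must be shown to be cut additively by
\<open>{x. 0 < \<phi> x}\<close>. The part of \<open>X\<close> on which \<open>\<phi>\<close> exceeds \<open>1 / (n + 1)\<close> has positive distance from
\<open>{x. \<phi> x \<le> 0}\<close>, so it is enough that the remaining part of the positive side has small measure.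
That part is a union of rings \<open>R i\<close>, and rings that are not adjacent have positive distance from
each other. Hence the measures of the even rings, and also of the odd rings, add up to at most the
measure of \<open>X\<close>: their sum converges and its tail is small.\<close>

lemma positivity_set_in_sets_hausdorff:
  fixes \<phi> :: "'a::metric_space \<Rightarrow> real"
  assumes lip: "\<And>x y. \<bar>\<phi> x - \<phi> y\<bar> \<le> dist x y"
  shows "{x. 0 < \<phi> x} \<in> sets (hausdorff_measure k)"
  unfolding sets_hausdorff_measure lambda_system_def
proof (intro CollectI conjI ballI)
  let ?H = "hausdorff_outer k :: 'a set \<Rightarrow> ennreal"
  let ?U = "{x. 0 < \<phi> x}"
  fix X :: "'a set"
  have "X = (?U \<inter> X) \<union> ((UNIV - ?U) \<inter> X)" by auto
  then have "?H X \<le> ?H (?U \<inter> X) + ?H ((UNIV - ?U) \<inter> X)"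
    using hausdorff_outer_Un[of k "?U \<inter> X" "(UNIV - ?U) \<inter> X"] by simp
  moreover have "?H (?U \<inter> X) + ?H ((UNIV - ?U) \<inter> X) \<le> ?H X"
  proof (cases "?H X = top_class.top")
    case False
    define s where "s n = 1 / (real n + 1)" for n
    have s: "0 < s n" "m \<le> n \<Longrightarrow> s n \<le> s m" "m < n \<Longrightarrow> s n < s m" for m n
      by (simp_all add: s_def frac_le frac_less2)
    define R where "R n = {x \<in> X. s (Suc n) < \<phi> x \<and> \<phi> x \<le> s n}" for n
    \<comment> \<open>The rings with indices of the same parity as \<open>c\<close> are pairwise separated.\<close>
    have rings: "(\<Sum>i<N. ?H (R (2 * i + c))) \<le> ?H (\<Union>i<N. R (2 * i + c))" for N c
    proof (induction N)
      case (Suc N)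
      have "?H (\<Union>i<N. R (2 * i + c)) + ?H (R (2 * N + c))
          \<le> ?H ((\<Union>i<N. R (2 * i + c)) \<union> R (2 * N + c))"
      proof (cases "N = 0")
        case False
        show ?thesis
        proof (rule hausdorff_outer_separated)
          show "0 < s (2 * N + c - 1) - s (2 * N + c)" using s(3)[of "2 * N + c - 1" "2 * N + c"] False by simp
          fix a b assume "a \<in> (\<Union>i<N. R (2 * i + c))" and b: "b \<in> R (2 * N + c)"
          then obtain i where i: "i < N" "a \<in> R (2 * i + c)" by blast
          then have "s (2 * N + c - 1) \<le> s (Suc (2 * i + c))" by (intro s(2)) simp
          then show "s (2 * N + c - 1) - s (2 * N + c) \<le> dist a b"
            using i b abs_le_D1[OF lip[of a b]] unfolding R_def mem_Collect_eq by linarith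
        qed
      qed (simp add: hausdorff_outer_empty)
      with Suc show ?case
        by (simp add: lessThan_Suc Un_commute add.commute)
          (meson add_left_mono order_trans)
    qed (simp add: hausdorff_outer_empty)
    have "(\<Sum>n<N. ?H (R n)) \<le> 2 * ?H X" for N
    proof -
      have "(\<Sum>n<N. ?H (R n)) \<le> (\<Sum>n<2 * N. ?H (R n))"
        by (rule sum_mono2) auto
      also have "\<dots> = (\<Sum>i<N. ?H (R (2 * i + 0))) + (\<Sum>i<N. ?H (R (2 * i + 1)))"
        by (induction N) (simp_all add: add_ac)
      also have "\<dots> \<le> ?H X + ?H X"
        by (intro add_mono order_trans[OF rings] hausdorff_outer_mono) (auto simp: R_def)
      finally show ?thesis by (simp add: mult_2)
    qed
    then have "(\<Sum>n. ?H (R n)) \<le> 2 * ?H X"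
      using ennreal_suminf_bound_add[of "\<lambda>n. ?H (R n)" 0] by simp
    then have fin: "(\<Sum>n. ?H (R n)) \<noteq> top_class.top"
      using False by (auto simp: top_unique ennreal_mult_eq_top_iff)
    then have "?H (R n) \<noteq> top_class.top" for n
      using sum_le_suminf[OF summableI, of "{n}" "\<lambda>n. ?H (R n)"] by (auto simp: top_unique)
    then have "\<forall>n. \<exists>a\<ge>0. ?H (R n) = ennreal a"
      by (metis ennreal_cases)
    then obtain a where a: "\<And>n. 0 \<le> a n" "\<And>n. ?H (R n) = ennreal (a n)" by metis
    have sa: "summable a"
      using fin a(1) by (intro summable_suminf_not_top) (simp_all add: a(2))
    show ?thesis
    proof (rule ennreal_le_epsilon)
      fix e :: real assume "0 < e"
      then obtain n where "norm (\<Sum>i. a (i + n)) < e"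
        using suminf_exist_split[OF _ sa] by blast
      then have "(\<Sum>i. ?H (R (i + n))) \<le> ennreal e"
        unfolding a(2) using summable_iff_shift[of a n] sa a(1)
        by (subst suminf_ennreal2) (auto intro!: ennreal_leI)
      let ?A = "{x \<in> X. s n < \<phi> x}"
      have "?U \<inter> X \<subseteq> ?A \<union> (\<Union>i. R (i + n))"
      proof
        fix x assume x: "x \<in> ?U \<inter> X"
        show "x \<in> ?A \<union> (\<Union>i. R (i + n))"
        proof (cases "s n < \<phi> x")
          case False
          have "\<exists>m. s m < \<phi> x"
            using x reals_Archimedean[of "\<phi> x"] by (auto simp: s_def inverse_eq_divide add.commute)
          \<comment> \<open>For the first \<open>m\<close> with \<open>s m < \<phi> x\<close>, the point \<open>x\<close> lies in the ring with index \<open>m - 1\<close>.\<close>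
          then obtain m where m: "s m < \<phi> x" "\<And>j. j < m \<Longrightarrow> \<not> s j < \<phi> x"
            using exists_least_iff[of "\<lambda>m. s m < \<phi> x"] by blast
          have "n < m" using m(1) False s(2)[of m n] by (meson not_less order_trans less_le_trans)
          then have "x \<in> R (m - 1)" using m(1) m(2)[of "m - 1"] x by (simp add: R_def)
          moreover have "R (m - 1) = R ((m - 1 - n) + n)" using \<open>n < m\<close> by simp
          ultimately show ?thesis by blast
        qed (use x in auto)
      qed
      then have "?H (?U \<inter> X) \<le> ?H (?A \<union> (\<Union>i. R (i + n)))" by (rule hausdorff_outer_mono)
      also have "\<dots> \<le> ?H ?A + ?H (\<Union>i. R (i + n))" by (rule hausdorff_outer_Un)
      also have "\<dots> \<le> ?H ?A + (\<Sum>i. ?H (R (i + n)))" by (intro add_left_mono hausdorff_outer_UN)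
      also have "\<dots> \<le> ?H ?A + ennreal e" by (intro add_left_mono) fact
      finally have "?H (?U \<inter> X) + ?H ((UNIV - ?U) \<inter> X) \<le> (?H ?A + ennreal e) + ?H ((UNIV - ?U) \<inter> X)"
        by (rule add_right_mono)
      also have "\<dots> = (?H ?A + ?H ((UNIV - ?U) \<inter> X)) + ennreal e"
        by (simp only: ac_simps)
      finally have "?H (?U \<inter> X) + ?H ((UNIV - ?U) \<inter> X) \<le> (?H ?A + ?H ((UNIV - ?U) \<inter> X)) + ennreal e" .
      moreover have "?H ?A + ?H ((UNIV - ?U) \<inter> X) \<le> ?H (?A \<union> ((UNIV - ?U) \<inter> X))"
      proof (rule hausdorff_outer_separated[OF s(1)[of n]])
        fix a b assume "a \<in> ?A" "b \<in> (UNIV - ?U) \<inter> X"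
        then have "s n < \<phi> a" "\<phi> b \<le> 0" by simp_all
        then show "s n \<le> dist a b"
          using abs_le_D1[OF lip[of a b]] by linarith
      qed
      moreover have "?H (?A \<union> ((UNIV - ?U) \<inter> X)) \<le> ?H X" by (rule hausdorff_outer_mono) auto
      ultimately show "?H (?U \<inter> X) + ?H ((UNIV - ?U) \<inter> X) \<le> ?H X + ennreal e"
        by (meson add_right_mono order_trans)
    qed
  qed simp
  ultimately show "?H (?U \<inter> X) + ?H ((UNIV - ?U) \<inter> X) = ?H X" by (rule antisym[rotated])
qed simp

text \<open>An open set other than the whole space is the positivity set of the distance to its complement.\<close>

lemma sets_borel_subset_hausdorff:
  "sets (borel :: 'a::metric_space measure) \<subseteq> sets (hausdorff_measure k)"
proof -
  have "U \<in> sets (hausdorff_measure k)" if "open U" for U :: "'a set"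
  proof (cases "U = UNIV")
    case True
    then show ?thesis using sets.top[of "hausdorff_measure k :: 'a measure"] by (simp add: space_hausdorff_measure)
  next
    case False
    have "{x. 0 < infdist x (- U)} \<in> sets (hausdorff_measure k)"
      by (rule positivity_set_in_sets_hausdorff) (rule infdist_triangle_abs)
    moreover have "{x. 0 < infdist x (- U)} = U"
      using in_closed_iff_infdist_zero[of "- U"] that False infdist_nonneg[of _ "- U"]
      by (auto simp: less_le)
    ultimately show ?thesis by simp
  qed
  then show ?thesis
    using sets.sigma_sets_subset[of "Collect open" "hausdorff_measure k :: 'a measure"]
    by (auto simp: borel_def space_hausdorff_measure)
qed

lemma borel_measurable_hausdorff:
  "f \<in> borel_measurable borel \<Longrightarrow> f \<in> borel_measurable (hausdorff_measure k)"
  using sets_borel_subset_hausdorff[of k] by (auto simp: measurable_def space_hausdorff_measure)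

text \<open>Every set of outer measure zero is measurable in the sense of Caratheodory, so the exceptional
set of an almost-everywhere statement need not be a Borel set.\<close>

lemma hausdorff_null_AE:
  assumes "hausdorff_outer k N = 0" "\<And>x. x \<notin> N \<Longrightarrow> P x"
  shows "AE x in hausdorff_measure k. P x"
proof (rule AE_I)
  have N: "N \<in> sets (hausdorff_measure k)"
    unfolding sets_hausdorff_measure lambda_system_def
  proof (intro CollectI conjI ballI)
    fix X :: "'a set"
    have "hausdorff_outer k (N \<inter> X) = 0"
      using hausdorff_outer_mono[of "N \<inter> X" N k] assms(1) by simp
    moreover have "hausdorff_outer k X \<le> hausdorff_outer k (N \<inter> X) + hausdorff_outer k ((UNIV - N) \<inter> X)"
    proof -
      have "(N \<inter> X) \<union> ((UNIV - N) \<inter> X) = X" by auto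
      then show ?thesis using hausdorff_outer_Un[of k "N \<inter> X" "(UNIV - N) \<inter> X"] by simp
    qed
    moreover have "hausdorff_outer k ((UNIV - N) \<inter> X) \<le> hausdorff_outer k X"
      by (rule hausdorff_outer_mono) auto
    ultimately show "hausdorff_outer k (N \<inter> X) + hausdorff_outer k ((UNIV - N) \<inter> X) = hausdorff_outer k X"
      by simp
  qed simp
  then show "N \<in> sets (hausdorff_measure k)" .
  show "emeasure (hausdorff_measure k) N = 0" using assms(1) by (simp add: emeasure_hausdorff_measure[OF N])
  show "{x \<in> space (hausdorff_measure k). \<not> P x} \<subseteq> N" using assms(2) by auto
qed

section \<open>Lipschitz images of Lebesgue null sets\<close>

lemma hausdorff_pre_cover_le:
  assumes "A \<subseteq> (\<Union>i. C i)" "\<And>i. bounded (C i)" "\<And>i. diameter (C i) \<le> \<delta>"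
  shows "hausdorff_pre k \<delta> A \<le>
    (\<Sum>i. if C i = {} then 0 else ennreal (unit_ball_vol (real k) * (diameter (C i) / 2) ^ k))"
  unfolding hausdorff_pre_def by (rule INF_lower2[of C]) (use assms in auto)

text \<open>A null set is covered by nonoverlapping small cubes of arbitrarily small total volume. The image
of a cube of side \<open>s\<close> has diameter at most \<open>C * m * s\<close>, so its contribution to the Hausdorff sum is at
most a constant \<open>q\<close> times the volume \<open>s ^ m\<close> of the cube.\<close>

lemma hausdorff_pre_lipschitz_image_bounded_null:
  fixes G :: "real^'m \<Rightarrow> 'b::metric_space" and N :: "(real^'m) set"
  assumes lip: "C-lipschitz_on UNIV G" and N: "N \<in> null_sets lborel" "bounded N" and "0 < \<delta>"
  shows "hausdorff_pre CARD('m) \<delta> (G ` N) = 0"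
proof -
  let ?m = "CARD('m)"
  have "0 \<le> C" using lip by (rule lipschitz_on_nonneg)
  have G: "dist (G x) (G y) \<le> C * dist x y" for x y
    using lipschitz_onD[OF lip] by auto
  define q where "q = unit_ball_vol (real ?m) * (C * real ?m / 2) ^ ?m"
  have "0 \<le> q" using \<open>0 \<le> C\<close> by (simp add: q_def unit_ball_vol_nonneg)
  obtain c where c: "0 < c" "\<And>x. x \<in> N \<Longrightarrow> norm x \<le> c"
    using N(2) bounded_pos by blast
  define a b :: "real^'m" where "a = (\<chi> i. - c)" and "b = (\<chi> i. c)"
  have ab: "N \<subseteq> cbox a b" "box a b \<noteq> {}"
  proof -
    have "- c \<le> x $ i \<and> x $ i \<le> c" if "x \<in> N" for x i
      using component_le_norm_cart[of x i] c(2)[OF that] by linarith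
    then show "N \<subseteq> cbox a b" by (auto simp: a_def b_def mem_box_cart)
    have "0 \<in> box a b" using c(1) by (simp add: a_def b_def mem_box_cart)
    then show "box a b \<noteq> {}" by blast
  qed
  \<comment> \<open>Cubes within a ball of radius \<open>\<rho>\<close> have images of diameter at most \<open>\<delta>\<close>.\<close>
  define \<rho> where "\<rho> = \<delta> / (2 * (C + 1))"
  have "0 < \<rho>" using \<open>0 < \<delta>\<close> \<open>0 \<le> C\<close> by (simp add: \<rho>_def)
  have C\<rho>: "C * (2 * \<rho>) \<le> \<delta>" using \<open>0 < \<delta>\<close> \<open>0 \<le> C\<close> by (simp add: \<rho>_def field_simps)
  have bound: "hausdorff_pre ?m \<delta> (G ` N) \<le> ennreal q * ennreal e" if e: "0 < e" for e :: real
  proof -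
    obtain U where U: "open U" "N \<subseteq> U" "emeasure lborel (U - N) < ennreal e"
      using outer_regular_lborel[of N e] N(1) e by (auto simp: null_sets_def)
    have Ue: "emeasure lborel U \<le> ennreal e"
      using emeasure_Diff_null_set[OF N(1), of U] U by (simp add: less_imp_le)
    have "\<exists>r>0. x \<in> N \<longrightarrow> ball x r \<subseteq> U" for x
    proof (cases "x \<in> N")
      case True
      then have "x \<in> U" using U(2) by blast
      then show ?thesis using openE[OF U(1)] by blast
    qed (simp add: exI[of _ 1])
    then obtain r where r: "\<And>x. 0 < r x" "\<And>x. x \<in> N \<Longrightarrow> ball x (r x) \<subseteq> U" by metis
    have "gauge (\<lambda>x. ball x (min (r x) \<rho>))"
      using r(1) \<open>0 < \<rho>\<close> by (auto simp: gauge_def)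
    from covering_lemma[OF ab this] obtain \<D> where \<D>: "countable \<D>"
      "\<And>K. K \<in> \<D> \<Longrightarrow> interior K \<noteq> {} \<and> (\<exists>c d. K = cbox c d)"
      "pairwise (\<lambda>A B. interior A \<inter> interior B = {}) \<D>"
      "\<And>K. K \<in> \<D> \<Longrightarrow> \<exists>x \<in> N \<inter> K. K \<subseteq> ball x (min (r x) \<rho>)"
      "\<And>u v. cbox u v \<in> \<D> \<Longrightarrow> \<exists>n. \<forall>i \<in> Basis. v \<bullet> i - u \<bullet> i = (b \<bullet> i - a \<bullet> i) / 2^n"
      "N \<subseteq> \<Union>\<D>"
      by metis
    define K where "K n = (if n \<in> to_nat_on \<D> ` \<D> then from_nat_into \<D> n else {})" for n
    have K: "K n = {} \<or> K n \<in> \<D>" for n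
      using \<D>(1) by (auto simp: K_def)
    have Kex: "\<exists>n. X = K n" if "X \<in> \<D>" for X
      using that \<D>(1) by (intro exI[of _ "to_nat_on \<D> X"]) (simp add: K_def)
    have Kinj: "K i = {} \<or> K j = {} \<or> K i \<noteq> K j" if "i \<noteq> j" for i j
      using that \<D>(1) by (auto simp: K_def)
    have disj: "disjoint_family (\<lambda>n. interior (K n))"
      unfolding disjoint_family_on_def
    proof (intro ballI impI)
      fix i j :: nat assume "i \<noteq> j"
      then show "interior (K i) \<inter> interior (K j) = {}"
        using K[of i] K[of j] Kinj[of i j] \<D>(3) by (auto simp: pairwise_def)
    qed
    have cover: "G ` N \<subseteq> (\<Union>n. G ` K n)"
    proof
      fix y assume "y \<in> G ` N"
      then obtain x X where "y = G x" "x \<in> X" "X \<in> \<D>" using \<D>(6) by blast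
      moreover then obtain n where "X = K n" using Kex by blast
      ultimately show "y \<in> (\<Union>n. G ` K n)" by blast
    qed
    have diam: "dist y z \<le> \<delta>" if y: "y \<in> G ` K n" and z: "z \<in> G ` K n" for y z n
    proof -
      have "K n \<in> \<D>" using K[of n] y by auto
      then obtain x where "K n \<subseteq> ball x (min (r x) \<rho>)" using \<D>(4) by blast
      moreover obtain p p' where p: "y = G p" "p \<in> K n" "z = G p'" "p' \<in> K n" using y z by blast
      ultimately have "dist x p < \<rho>" "dist x p' < \<rho>" by auto
      then have "dist p p' \<le> 2 * \<rho>" using dist_triangle3[of p p' x] by linarith
      then have "C * dist p p' \<le> C * (2 * \<rho>)" using \<open>0 \<le> C\<close> by (rule mult_left_mono)
      then show ?thesis using G[of p p'] C\<rho> p by simp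
    qed
    have bdd: "bounded (G ` K n)" for n
    proof (cases "K n = {}")
      case False
      then obtain y where "y \<in> G ` K n" by blast
      then show ?thesis unfolding bounded_def using diam by blast
    qed simp
    have diam_le: "diameter (G ` K n) \<le> e'" if "\<And>y z. y \<in> G ` K n \<Longrightarrow> z \<in> G ` K n \<Longrightarrow> dist y z \<le> e'" "0 \<le> e'" for n e'
      using that by (auto simp: diameter_def intro!: cSUP_least)
    have "hausdorff_pre ?m \<delta> (G ` N) \<le>
      (\<Sum>n. if G ` K n = {} then 0 else ennreal (unit_ball_vol (real ?m) * (diameter (G ` K n) / 2) ^ ?m))"
      by (rule hausdorff_pre_cover_le[OF cover bdd]) (use diam \<open>0 < \<delta>\<close> in \<open>auto intro!: diam_le\<close>)
    also have "\<dots> \<le> (\<Sum>n. ennreal q * emeasure lborel (interior (K n)))"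
    proof (intro suminf_le summableI)
      fix n
      show "(if G ` K n = {} then 0 else ennreal (unit_ball_vol (real ?m) * (diameter (G ` K n) / 2) ^ ?m))
          \<le> ennreal q * emeasure lborel (interior (K n))"
      proof (cases "K n = {}")
        case False
        then have KD: "K n \<in> \<D>" using K[of n] by blast
        then obtain u v where uv: "K n = cbox u v" using \<D>(2) by blast
        then obtain i0 where i0: "\<forall>i \<in> Basis. v \<bullet> i - u \<bullet> i = (b \<bullet> i - a \<bullet> i) / 2^i0"
          using \<D>(5) KD by metis
        define s where "s = 2 * c / 2 ^ i0"
        have s: "v $ i - u $ i = s" for i
          using bspec[OF i0, of "axis i 1"] by (simp add: inner_axis a_def b_def s_def axis_in_Basis_iff)
        have "0 \<le> s" using c(1) by (simp add: s_def)
        have em: "emeasure lborel (interior (K n)) = ennreal (s ^ ?m)"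
        proof -
          have "emeasure lborel (box u v) = ennreal (\<Prod>i\<in>Basis. (v - u) \<bullet> i)"
          proof (rule emeasure_lborel_box)
            fix i :: "real^'m" assume "i \<in> Basis"
            then have "v \<bullet> i - u \<bullet> i = (b \<bullet> i - a \<bullet> i) / 2^i0" using i0 by blast
            moreover have "0 \<le> b \<bullet> i - a \<bullet> i"
              using ab(2) \<open>i \<in> Basis\<close> by (simp add: box_ne_empty less_imp_le)
            ultimately show "u \<bullet> i \<le> v \<bullet> i"
              by (metis diff_ge_0_iff_ge divide_nonneg_nonneg zero_le_numeral zero_le_power)
          qed
          also have "(\<Prod>i\<in>Basis. (v - u) \<bullet> i) = (\<Prod>i\<in>(Basis :: (real^'m) set). s)"
          proof (rule prod.cong[OF refl])
            fix i :: "real^'m" assume "i \<in> Basis"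
            then obtain j where "i = axis j 1" by (auto simp: Basis_vec_def)
            then show "(v - u) \<bullet> i = s" using s[of j] by (simp add: inner_axis)
          qed
          finally show ?thesis by (simp add: uv interior_cbox)
        qed
        have "diameter (G ` K n) \<le> C * (real ?m * s)"
        proof (rule diam_le)
          show "0 \<le> C * (real ?m * s)" using \<open>0 \<le> C\<close> \<open>0 \<le> s\<close> by simp
          fix y z assume "y \<in> G ` K n" "z \<in> G ` K n"
          then obtain p p' where p: "y = G p" "p \<in> K n" "z = G p'" "p' \<in> K n" by blast
          have "\<bar>(p - p') $ i\<bar> \<le> s" for i
          proof -
            have "u $ i \<le> p $ i" "p $ i \<le> v $ i" "u $ i \<le> p' $ i" "p' $ i \<le> v $ i"
              using p uv by (simp_all add: mem_box_cart)
            then show ?thesis using s[of i] by (simp add: abs_le_iff)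
          qed
          then have "(\<Sum>i\<in>UNIV. \<bar>(p - p') $ i\<bar>) \<le> (\<Sum>i\<in>(UNIV :: 'm set). s)" by (intro sum_mono)
          then have "dist p p' \<le> real ?m * s"
            using norm_le_l1_cart[of "p - p'"] by (simp add: dist_norm)
          then have "C * dist p p' \<le> C * (real ?m * s)" using \<open>0 \<le> C\<close> by (rule mult_left_mono)
          then show "dist y z \<le> C * (real ?m * s)" using G[of p p'] p by simp
        qed
        then have "(diameter (G ` K n) / 2) ^ ?m \<le> (C * real ?m / 2) ^ ?m * s ^ ?m"
          unfolding power_mult_distrib[symmetric]
          by (intro power_mono) (auto simp: diameter_ge_0[OF bdd] mult_ac)
        then have "unit_ball_vol (real ?m) * (diameter (G ` K n) / 2) ^ ?m \<le> q * s ^ ?m"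
          unfolding q_def mult.assoc by (rule mult_left_mono) (simp add: unit_ball_vol_nonneg)
        then show ?thesis using False \<open>0 \<le> q\<close> \<open>0 \<le> s\<close>
          by (simp add: em ennreal_mult'[symmetric] ennreal_leI)
      qed simp
    qed
    also have "\<dots> = ennreal q * (\<Sum>n. emeasure lborel (interior (K n)))"
      by (rule ennreal_suminf_cmult)
    also have "(\<Sum>n. emeasure lborel (interior (K n))) = emeasure lborel (\<Union>n. interior (K n))"
      by (rule suminf_emeasure[OF _ disj]) auto
    also have "emeasure lborel (\<Union>n. interior (K n)) \<le> emeasure lborel U"
    proof (rule emeasure_mono)
      have "K n \<subseteq> U" for n
      proof (cases "K n = {}")
        case False
        then obtain x where "x \<in> N" "K n \<subseteq> ball x (min (r x) \<rho>)" using K[of n] \<D>(4) by blast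
        then show ?thesis using r(2)[of x] by (meson min.cobounded1 order_trans subset_ball)
      qed simp
      then show "(\<Union>n. interior (K n)) \<subseteq> U" using interior_subset by blast
    qed (use U(1) in simp)
    also note Ue
    finally show ?thesis by (simp add: mult_left_mono)
  qed
  have "hausdorff_pre ?m \<delta> (G ` N) \<le> 0 + ennreal e" if "0 < e" for e
  proof -
    have "hausdorff_pre ?m \<delta> (G ` N) \<le> ennreal q * ennreal (e / (q + 1))"
      using that \<open>0 \<le> q\<close> by (intro bound) simp
    also have "\<dots> \<le> ennreal e"
      using that \<open>0 \<le> q\<close> by (subst ennreal_mult'[symmetric]) (auto intro!: ennreal_leI simp: field_simps)
    finally show ?thesis by simp
  qed
  then have "hausdorff_pre ?m \<delta> (G ` N) \<le> 0" by (rule ennreal_le_epsilon)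
  then show ?thesis by simp
qed

lemma hausdorff_outer_lipschitz_image_null:
  fixes G :: "real^'m \<Rightarrow> 'b::metric_space" and N :: "(real^'m) set"
  assumes lip: "C-lipschitz_on UNIV G" and N: "N \<in> null_sets lborel"
  shows "hausdorff_outer CARD('m) (G ` N) = 0"
proof -
  have "hausdorff_pre CARD('m) \<delta> (G ` N) = 0" if "0 < \<delta>" for \<delta>
  proof -
    have "x \<in> (\<Union>n. cball 0 (real n))" for x :: "real^'m"
      using real_arch_simple[of "norm x"] by auto
    then have "G ` N = (\<Union>n. G ` (N \<inter> cball 0 (real n)))" by blast
    then have "hausdorff_pre CARD('m) \<delta> (G ` N) \<le> (\<Sum>n. hausdorff_pre CARD('m) \<delta> (G ` (N \<inter> cball 0 (real n))))"
      by (metis hausdorff_pre_UN)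
    also have "\<dots> = (\<Sum>n::nat. 0)"
    proof (rule suminf_cong)
      fix n :: nat
      show "hausdorff_pre CARD('m) \<delta> (G ` (N \<inter> cball 0 (real n))) = 0"
        by (rule hausdorff_pre_lipschitz_image_bounded_null[OF lip _ _ that])
          (auto intro!: null_set_Int2 N bounded_Int)
    qed
    finally show ?thesis by simp
  qed
  then have "hausdorff_outer CARD('m) (G ` N) = (SUP \<delta>\<in>{0::real<..}. 0)"
    unfolding hausdorff_outer_def by (intro SUP_cong) auto
  then show ?thesis by simp
qed

section \<open>Upper directional derivatives\<close>

text \<open>The limes superior of the difference quotients as \<open>t\<close> decreases to \<open>0\<close>, written with real infima
and suprema; it is meant for Lipschitz functions, whose quotients are bounded. The lower
derivative is \<open>- upper_dderiv (\<lambda>x. - g x)\<close>. One-sided derivatives suffice throughout, since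
linearity in the direction recovers the two-sided ones.\<close>

definition upper_dderiv :: "('a::real_normed_vector \<Rightarrow> real) \<Rightarrow> 'a \<Rightarrow> 'a \<Rightarrow> real" where
  "upper_dderiv g v z = (INF n. SUP t\<in>{0<..<1 / real (Suc n)}. (g (z + t *\<^sub>R v) - g z) / t)"

lemma lipschitz_quotient_bound:
  fixes g :: "'a::real_normed_vector \<Rightarrow> real"
  assumes "L-lipschitz_on UNIV g" "0 < t"
  shows "\<bar>(g (z + t *\<^sub>R v) - g z) / t\<bar> \<le> L * norm v"
proof -
  have "\<bar>g (z + t *\<^sub>R v) - g z\<bar> \<le> L * norm (t *\<^sub>R v)"
    using lipschitz_on_normD[OF assms(1), of "z + t *\<^sub>R v" z] by simp
  then show ?thesis using assms(2) by (simp add: field_simps)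
qed

lemma upper_dderiv_witness:
  fixes g :: "'a::real_normed_vector \<Rightarrow> real"
  assumes lip: "L-lipschitz_on UNIV g"
  shows upper_dderiv_frequently:
      "0 < e \<Longrightarrow> 0 < d \<Longrightarrow> \<exists>t>0. t < d \<and> upper_dderiv g v z - e < (g (z + t *\<^sub>R v) - g z) / t"
    and upper_dderiv_eventually:
      "0 < e \<Longrightarrow> \<exists>d>0. \<forall>t. 0 < t \<longrightarrow> t < d \<longrightarrow> (g (z + t *\<^sub>R v) - g z) / t < upper_dderiv g v z + e"
    and abs_upper_dderiv_le: "\<bar>upper_dderiv g v z\<bar> \<le> L * norm v"
proof -
  define q where "q t = (g (z + t *\<^sub>R v) - g z) / t" for t
  define S where "S n = (SUP t\<in>{0<..<1 / real (Suc n)}. q t)" for n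
  have q: "\<bar>q t\<bar> \<le> L * norm v" if "0 < t" for t
    using lipschitz_quotient_bound[OF lip that] by (simp add: q_def)
  have bdd: "bdd_above (q ` {0<..<1 / real (Suc n)})" for n
    using q by (intro bdd_aboveI2[where M = "L * norm v"]) (auto simp: abs_le_iff)
  have ne: "{0<..<1 / real (Suc n)} \<noteq> {}" for n by simp
  have qS: "q t \<le> S n" if "0 < t" "t < 1 / real (Suc n)" for t n
    unfolding S_def using that by (intro cSUP_upper bdd) auto
  have S_le: "S n \<le> L * norm v" for n
    unfolding S_def using q by (intro cSUP_least ne) (auto simp: abs_le_iff)
  have S_ge: "- (L * norm v) \<le> S n" for n
  proof -
    have t: "0 < 1 / (2 * real (Suc n))" "1 / (2 * real (Suc n)) < 1 / real (Suc n)"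
      by (simp_all add: field_simps)
    then show ?thesis using qS[OF t] q[OF t(1)] by (simp add: abs_le_iff)
  qed
  have U: "upper_dderiv g v z = (INF n. S n)" by (simp add: upper_dderiv_def S_def q_def)
  have bddS: "bdd_below (range S)" using S_ge by (intro bdd_belowI2)
  have U_le: "(INF n. S n) \<le> S n" for n by (rule cINF_lower[OF bddS]) simp
  show "\<bar>upper_dderiv g v z\<bar> \<le> L * norm v"
    using U_le[of 0] S_le[of 0] cINF_greatest[of UNIV "- (L * norm v)" S] S_ge
    by (simp add: U abs_le_iff)
  show "\<exists>t>0. t < d \<and> upper_dderiv g v z - e < (g (z + t *\<^sub>R v) - g z) / t" if "0 < e" "0 < d"
  proof -
    obtain n where "1 / real (Suc n) < d"
      using reals_Archimedean[OF \<open>0 < d\<close>] by (auto simp: inverse_eq_divide)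
    moreover have "upper_dderiv g v z - e < S n" using U U_le[of n] that by simp
    then obtain t where "t \<in> {0<..<1 / real (Suc n)}" "upper_dderiv g v z - e < q t"
      unfolding S_def less_cSUP_iff[OF ne bdd] by blast
    ultimately show ?thesis by (auto simp: q_def intro!: exI[of _ t])
  qed
  show "\<exists>d>0. \<forall>t. 0 < t \<longrightarrow> t < d \<longrightarrow> (g (z + t *\<^sub>R v) - g z) / t < upper_dderiv g v z + e" if "0 < e"
  proof -
    have "(INF n. S n) < upper_dderiv g v z + e" using that U by simp
    then obtain n where n: "S n < upper_dderiv g v z + e"
      using cINF_less_iff[OF _ bddS] by auto
    show ?thesis
      using qS n by (intro exI[of _ "1 / real (Suc n)"]) (auto simp: q_def intro: le_less_trans)
  qed
qed

text \<open>The inner supremum ranges over uncountably many \<open>t\<close>, but a supremum of continuous functions is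
lower semicontinuous.\<close>

lemma borel_measurable_upper_dderiv:
  fixes g :: "'a::euclidean_space \<Rightarrow> real"
  assumes lip: "L-lipschitz_on UNIV g"
  shows "upper_dderiv g v \<in> borel_measurable borel"
proof -
  define S where "S n z = (SUP t\<in>{0<..<1 / real (Suc n)}. (g (z + t *\<^sub>R v) - g z) / t)" for n z
  have q: "\<bar>(g (z + t *\<^sub>R v) - g z) / t\<bar> \<le> L * norm v" if "0 < t" for t z
    by (rule lipschitz_quotient_bound[OF lip that])
  have bdd: "bdd_above ((\<lambda>t. (g (z + t *\<^sub>R v) - g z) / t) ` {0<..<1 / real (Suc n)})" for n z
  proof (intro bdd_aboveI2)
    fix t assume "t \<in> {0<..<1 / real (Suc n)}"
    then show "(g (z + t *\<^sub>R v) - g z) / t \<le> L * norm v" using abs_le_D1[OF q[of t z]] by simp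
  qed
  have ne: "{0<..<1 / real (Suc n)} \<noteq> {}" for n by simp
  have cont: "continuous_on UNIV g" by (rule lipschitz_on_continuous_on[OF lip])
  have S: "S n \<in> borel_measurable borel" for n
    unfolding borel_measurable_iff_greater
  proof
    fix a
    have "{z. a < S n z} = (\<Union>t\<in>{0<..<1 / real (Suc n)}. {z. a < (g (z + t *\<^sub>R v) - g z) / t})"
      unfolding S_def less_cSUP_iff[OF ne bdd] by blast
    moreover have "open {z. a < (g (z + t *\<^sub>R v) - g z) / t}" if "t \<in> {0<..<1 / real (Suc n)}" for t
      using that by (intro open_Collect_less continuous_intros continuous_on_compose2[OF cont]) auto
    ultimately have "open {z. a < S n z}" by auto
    then show "{w \<in> space borel. a < S n w} \<in> sets borel" by simp
  qed
  have "(\<lambda>z. INF n. S n z) \<in> borel_measurable borel"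
    by (rule borel_measurable_cINF_real) (use S in auto)
  then show ?thesis by (simp add: upper_dderiv_def[abs_def] S_def)
qed

text \<open>The lower derivative is at most the upper derivative.\<close>

lemma upper_dderiv_minus_ge:
  fixes g :: "'a::real_normed_vector \<Rightarrow> real"
  assumes lip: "L-lipschitz_on UNIV g"
  shows "0 \<le> upper_dderiv g v z + upper_dderiv (\<lambda>x. - g x) v z"
proof (rule ccontr)
  assume neg: "\<not> ?thesis"
  have lip': "L-lipschitz_on UNIV (\<lambda>x. - g x)" using lip by simp
  define e where "e = - (upper_dderiv g v z + upper_dderiv (\<lambda>x. - g x) v z) / 2"
  have "0 < e" using neg by (simp add: e_def)
  obtain d where d: "0 < d" "\<And>t. 0 < t \<Longrightarrow> t < d \<Longrightarrow> (g (z + t *\<^sub>R v) - g z) / t < upper_dderiv g v z + e"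
    using upper_dderiv_eventually[OF lip \<open>0 < e\<close>, of z v] by blast
  obtain d' where d': "0 < d'" "\<And>t. 0 < t \<Longrightarrow> t < d' \<Longrightarrow>
      (- g (z + t *\<^sub>R v) - - g z) / t < upper_dderiv (\<lambda>x. - g x) v z + e"
    using upper_dderiv_eventually[OF lip' \<open>0 < e\<close>, of z v] by blast
  define t where "t = min d d' / 2"
  have t: "0 < t" "t < d" "t < d'" using d(1) d'(1) by (auto simp: t_def)
  define r where "r = (g (z + t *\<^sub>R v) - g z) / t"
  have "(- g (z + t *\<^sub>R v) - - g z) / t = - r"
    unfolding r_def by (simp add: minus_divide_left)
  then have "- r < upper_dderiv (\<lambda>x. - g x) v z + e" using d'(2)[OF t(1,3)] by (simp only:)
  moreover have "r < upper_dderiv g v z + e" using d(2)[OF t(1,2)] by (simp only: r_def)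
  moreover have "upper_dderiv g v z + upper_dderiv (\<lambda>x. - g x) v z = - (2 * e)" by (simp add: e_def field_simps)
  ultimately show False by linarith
qed

lemma tendsto_upper_dderiv:
  fixes g :: "'a::real_normed_vector \<Rightarrow> real"
  assumes lip: "L-lipschitz_on UNIV g"
    and eq: "upper_dderiv g v z + upper_dderiv (\<lambda>x. - g x) v z = 0"
  shows "((\<lambda>t. (g (z + t *\<^sub>R v) - g z) / t) \<longlongrightarrow> upper_dderiv g v z) (at_right 0)"
proof (rule tendstoI)
  fix e :: real assume "0 < e"
  have lip': "L-lipschitz_on UNIV (\<lambda>x. - g x)" using lip by simp
  obtain d where d: "0 < d" "\<And>t. 0 < t \<Longrightarrow> t < d \<Longrightarrow> (g (z + t *\<^sub>R v) - g z) / t < upper_dderiv g v z + e"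
    using upper_dderiv_eventually[OF lip \<open>0 < e\<close>, of z v] by blast
  obtain d' where d': "0 < d'" "\<And>t. 0 < t \<Longrightarrow> t < d' \<Longrightarrow>
      (- g (z + t *\<^sub>R v) - - g z) / t < upper_dderiv (\<lambda>x. - g x) v z + e"
    using upper_dderiv_eventually[OF lip' \<open>0 < e\<close>, of z v] by blast
  show "\<forall>\<^sub>F t in at_right 0. dist ((g (z + t *\<^sub>R v) - g z) / t) (upper_dderiv g v z) < e"
    unfolding eventually_at_right_field
  proof (intro exI[of _ "min d d'"] conjI allI impI)
    fix t assume t: "0 < t" "t < min d d'"
    have "(- g (z + t *\<^sub>R v) - - g z) / t = - ((g (z + t *\<^sub>R v) - g z) / t)"
      by (simp add: minus_divide_left)
    then show "dist ((g (z + t *\<^sub>R v) - g z) / t) (upper_dderiv g v z) < e"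
      using d(2)[of t] d'(2)[of t] t eq by (simp add: dist_real_def abs_less_iff)
  qed (use d d' in simp)
qed

lemma upper_dderiv_eqI:
  fixes g :: "'a::real_normed_vector \<Rightarrow> real"
  assumes lip: "L-lipschitz_on UNIV g"
    and lim: "((\<lambda>t. (g (z + t *\<^sub>R v) - g z) / t) \<longlongrightarrow> l) (at_right 0)"
  shows "upper_dderiv g v z = l"
proof (rule ccontr)
  assume ne: "upper_dderiv g v z \<noteq> l"
  define e where "e = \<bar>upper_dderiv g v z - l\<bar> / 2"
  have "0 < e" using ne by (simp add: e_def)
  then have "\<forall>\<^sub>F t in at_right 0. dist ((g (z + t *\<^sub>R v) - g z) / t) l < e"
    by (rule tendstoD[OF lim])
  then obtain d where d: "0 < d" "\<And>t. 0 < t \<Longrightarrow> t < d \<Longrightarrow> \<bar>(g (z + t *\<^sub>R v) - g z) / t - l\<bar> < e"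
    unfolding eventually_at_right_field dist_real_def by blast
  obtain d' where d': "0 < d'" "\<And>t. 0 < t \<Longrightarrow> t < d' \<Longrightarrow> (g (z + t *\<^sub>R v) - g z) / t < upper_dderiv g v z + e"
    using upper_dderiv_eventually[OF lip \<open>0 < e\<close>, of z v] by blast
  obtain t where t: "0 < t" "t < min d d'" "upper_dderiv g v z - e < (g (z + t *\<^sub>R v) - g z) / t"
    using upper_dderiv_frequently[OF lip \<open>0 < e\<close>, of "min d d'" v z] d(1) d'(1) by auto
  define r where "r = (g (z + t *\<^sub>R v) - g z) / t"
  have "\<bar>r - l\<bar> < e" "r < upper_dderiv g v z + e" "upper_dderiv g v z - e < r"
    using d(2)[of t] d'(2)[of t] t by (simp_all only: r_def min_less_iff_conj)
  then have "\<bar>upper_dderiv g v z - r\<bar> + \<bar>r - l\<bar> < 2 * e" by linarith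
  moreover have "\<bar>upper_dderiv g v z - l\<bar> \<le> \<bar>upper_dderiv g v z - r\<bar> + \<bar>r - l\<bar>" by linarith
  moreover have "\<bar>upper_dderiv g v z - l\<bar> = 2 * e" by (simp add: e_def)
  ultimately show False by linarith
qed

section \<open>Differentiability of Lipschitz functions of one variable\<close>

text \<open>The last point at which \<open>\<Phi>\<close> is at least \<open>\<Phi> a\<close> exists by compactness, and it can only be \<open>b\<close>.\<close>

lemma continuous_locally_increasing_imp_le:
  fixes \<Phi> :: "real \<Rightarrow> real"
  assumes "a \<le> b" and cont: "continuous_on {a..b} \<Phi>"
    and step: "\<And>x. a \<le> x \<Longrightarrow> x < b \<Longrightarrow> \<exists>y>x. y \<le> b \<and> \<Phi> x \<le> \<Phi> y"
  shows "\<Phi> a \<le> \<Phi> b"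
proof -
  define S where "S = {x \<in> {a..b}. \<Phi> a \<le> \<Phi> x}"
  have "compact S"
    unfolding S_def compact_eq_bounded_closed
  proof (intro conjI)
    show "bounded {x \<in> {a..b}. \<Phi> a \<le> \<Phi> x}"
      by (rule bounded_subset[of "{a..b}"]) auto
    show "closed {x \<in> {a..b}. \<Phi> a \<le> \<Phi> x}"
      by (rule continuous_on_closed_Collect_le[OF continuous_on_const cont closed_atLeastAtMost])
  qed
  moreover have "S \<noteq> {}" using \<open>a \<le> b\<close> by (auto simp: S_def)
  ultimately obtain s where s: "s \<in> S" "\<And>x. x \<in> S \<Longrightarrow> x \<le> s"
    using compact_attains_sup[of S] by blast
  have "s = b"
  proof (rule ccontr)
    assume "s \<noteq> b"
    then obtain y where "s < y" "y \<le> b" "\<Phi> s \<le> \<Phi> y"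
      using step[of s] s(1) by (auto simp: S_def)
    then have "y \<in> S" using s(1) by (auto simp: S_def)
    then show False using s(2)[of y] \<open>s < y\<close> by simp
  qed
  then show ?thesis using s(1) by (simp add: S_def)
qed

text \<open>The number of thresholds \<open>e, 2 * e, \<dots>, M * e\<close> below \<open>w\<close> is \<open>w / e\<close> rounded down.\<close>

lemma layer_sum_bounds:
  fixes w e :: real
  assumes "0 < e" "0 \<le> w" "w \<le> real M * e"
  shows "e * real (card {i \<in> {1..M}. real i * e \<le> w}) \<le> w"
    and "w \<le> e + e * real (card {i \<in> {1..M}. real i * e \<le> w})"
proof -
  define k where "k = nat \<lfloor>w / e\<rfloor>"
  have k: "real k \<le> w / e" "w / e < real k + 1"
    using assms by (simp_all add: k_def floor_less_iff[symmetric])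
  have "{i \<in> {1..M}. real i * e \<le> w} = {1..k}"
  proof (intro equalityI subsetI)
    fix i assume "i \<in> {i \<in> {1..M}. real i * e \<le> w}"
    then have "1 \<le> i" "real i \<le> w / e" using \<open>0 < e\<close> by (auto simp: field_simps)
    then show "i \<in> {1..k}" using k(2) by auto
  next
    fix i assume i: "i \<in> {1..k}"
    then have "real i \<le> real k" by simp
    then have "real i \<le> w / e" using k(1) by linarith
    moreover have "w / e \<le> real M" using assms by (simp add: field_simps)
    ultimately have "real i \<le> real M" by linarith
    then have "i \<le> M" by simp
    moreover have "real i * e \<le> w" using \<open>real i \<le> w / e\<close> \<open>0 < e\<close> by (simp add: pos_le_divide_eq)
    ultimately show "i \<in> {i \<in> {1..M}. real i * e \<le> w}" using i by simp
  qed
  then have c: "card {i \<in> {1..M}. real i * e \<le> w} = k" by simp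
  show "e * real (card {i \<in> {1..M}. real i * e \<le> w}) \<le> w"
    unfolding c using k(1) \<open>0 < e\<close> by (simp add: field_simps)
  show "w \<le> e + e * real (card {i \<in> {1..M}. real i * e \<le> w})"
    unfolding c using k(2) \<open>0 < e\<close> by (simp add: field_simps)
qed

lemma measure_Int_Icc_step:
  fixes K :: "real set"
  assumes K: "K \<in> sets lborel" and xy: "a \<le> x" "x \<le> y"
  shows "measure lborel (K \<inter> {a..y}) - measure lborel (K \<inter> {a..x}) = measure lborel (K \<inter> {x<..y})"
    and "measure lborel (K \<inter> {x<..y}) \<le> y - x"
proof -
  have fin: "emeasure lborel (K \<inter> {p..q}) < \<infinity>" for p q
    using emeasure_mono[of "K \<inter> {p..q}" "{p..q}" lborel] emeasure_lborel_Icc_eq[of p q]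
    by (auto simp: less_top[symmetric] top_unique split: if_splits)
  have fm: "K \<inter> {p..q} \<in> fmeasurable lborel" for p q
    using K fin by (auto intro!: fmeasurableI)
  have fm': "K \<inter> {x<..y} \<in> fmeasurable lborel"
    by (rule fmeasurableI2[OF fm[of x y]]) (use K in auto)
  have "K \<inter> {a..y} = (K \<inter> {a..x}) \<union> (K \<inter> {x<..y})" using xy by auto
  then have "measure lborel (K \<inter> {a..y}) = measure lborel (K \<inter> {a..x}) + measure lborel (K \<inter> {x<..y})"
    using fm[of a x] fm' measure_Union[of lborel "K \<inter> {a..x}" "K \<inter> {x<..y}"]
    by (simp add: fmeasurable_def disjoint_iff less_top[symmetric])
  then show "measure lborel (K \<inter> {a..y}) - measure lborel (K \<inter> {a..x}) = measure lborel (K \<inter> {x<..y})"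
    by simp
  have "measure lborel (K \<inter> {x<..y}) \<le> measure lborel {x..y}"
    by (rule measure_mono_fmeasurable) (use K xy in \<open>auto simp: fmeasurable_def\<close>)
  then show "measure lborel (K \<inter> {x<..y}) \<le> y - x" using xy by simp
qed

text \<open>This inequality is what makes Lipschitz functions differentiable almost everywhere. Were the upper
derivative \<open>U\<close> upper semicontinuous, then at every \<open>x\<close> there would be arbitrarily small steps \<open>t\<close> over
which \<open>f\<close> grows at least as fast as the integral of \<open>U\<close>, up to an error \<open>e * t\<close>; by
\<open>continuous_locally_increasing_imp_le\<close> these steps can be chained from \<open>a\<close> to \<open>b\<close>. In general \<open>U\<close> is
replaced by a smaller upper semicontinuous function: \<open>U + L\<close> is, up to \<open>e\<close>, the sum of \<open>e\<close> times the
indicators of the sets \<open>E i\<close> where it is at least \<open>i * e\<close>, and each \<open>E i\<close> is approximated from within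
by a closed set \<open>K i\<close>, whose indicator is upper semicontinuous. The primitive of the resulting
function is \<open>\<Psi>\<close>.\<close>

lemma integral_upper_dderiv_le:
  fixes f :: "real \<Rightarrow> real"
  assumes lip: "L-lipschitz_on UNIV f" and "a \<le> b"
  shows "(LINT x:{a..b}|lborel. upper_dderiv f 1 x) \<le> f b - f a"
proof -
  define U where "U = upper_dderiv f (1::real)"
  have U_meas[measurable]: "U \<in> borel_measurable borel"
    unfolding U_def by (rule borel_measurable_upper_dderiv[OF lip])
  have U_bd: "\<bar>U x\<bar> \<le> L" for x
    using abs_upper_dderiv_le[OF lip, of 1 x] by (simp add: U_def)
  have "0 \<le> L" using lip by (rule lipschitz_on_nonneg)
  have U_int: "set_integrable lborel {a..b} U"
    unfolding set_integrable_def
    by (rule integrableI_bounded_set_indicator[where B = L])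
      (use U_bd in \<open>auto simp: emeasure_lborel_Icc_eq less_top[symmetric]\<close>)
  have main: "(LINT x:{a..b}|lborel. U x) \<le> f b - f a + 3 * e * (b - a) + e" if "0 < e" for e
  proof -
    define M where "M = nat \<lceil>2 * L / e\<rceil>"
    have "2 * L / e \<le> real M" unfolding M_def by linarith
    then have M: "U x + L \<le> real M * e" for x
      using U_bd[of x] \<open>0 < e\<close> by (simp add: field_simps abs_le_iff)
    have UL: "0 \<le> U x + L" for x using U_bd[of x] by (simp add: abs_le_iff)
    define E where "E i = {x \<in> {a..b}. real i * e \<le> U x + L}" for i :: nat
    have E[measurable]: "E i \<in> sets lborel" for i unfolding E_def by measurable
    have E_fin: "emeasure lborel (E i) < \<infinity>" for i
    proof -
      have "emeasure lborel (E i) \<le> emeasure lborel {a..b}" by (rule emeasure_mono) (auto simp: E_def)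
      then show ?thesis by (auto simp: emeasure_lborel_Icc_eq less_top[symmetric] top_unique split: if_splits)
    qed
    have E_fm: "E i \<in> fmeasurable lborel" for i using E E_fin by (rule fmeasurableI)
    \<comment> \<open>With this choice the \<open>M\<close> approximations lose a total measure of less than \<open>1\<close>.\<close>
    define \<eta> where "\<eta> = 1 / real (M + 1)"
    have "0 < \<eta>" by (simp add: \<eta>_def)
    have "\<exists>K. closed K \<and> K \<subseteq> E i \<and> measure lborel (E i) \<le> measure lborel K + \<eta>" for i
    proof -
      obtain K where K: "closed K" "K \<subseteq> E i" "emeasure lebesgue (E i - K) < ennreal \<eta>"
        using sets_lebesgue_inner_closed[of "E i" \<eta>] E \<open>0 < \<eta>\<close> by (metis sets_completionI_sets)
      have Kb: "K \<in> sets lborel" using K(1) by simp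
      have "emeasure lborel (E i - K) < ennreal \<eta>"
        using K(3) Kb E[of i] by simp
      then have "measure lborel (E i - K) \<le> \<eta>"
        using \<open>0 < \<eta>\<close> by (simp add: measure_def enn2real_leI less_imp_le)
      moreover have "measure lborel (E i - K) = measure lborel (E i) - measure lborel K"
        using K(2) Kb E_fin[of i] E[of i] by (intro measure_Diff) auto
      ultimately show ?thesis using K(1,2) by (intro exI[of _ K]) simp
    qed
    then obtain K where K: "\<And>i. closed (K i)" "\<And>i. K i \<subseteq> E i"
        "\<And>i. measure lborel (E i) \<le> measure lborel (K i) + \<eta>"
      by metis
    have Kb: "K i \<in> sets lborel" for i using K(1) by simp
    define \<Psi> where "\<Psi> x = - L * (x - a) + e * (\<Sum>i = 1..M. measure lborel (K i \<inter> {a..x}))" for x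
    \<comment> \<open>One \<open>e\<close> of the slope makes up for the witness of the limes superior; the other makes the step strict.\<close>
    define \<Phi> where "\<Phi> x = f x - \<Psi> x + 2 * e * x" for x
    have step: "\<Psi> y - \<Psi> x = - L * (y - x) + e * (\<Sum>i = 1..M. measure lborel (K i \<inter> {x<..y}))"
      if "a \<le> x" "x \<le> y" for x y
    proof -
      have *: "(\<Sum>i = 1..M. measure lborel (K i \<inter> {a..y})) - (\<Sum>i = 1..M. measure lborel (K i \<inter> {a..x}))
          = (\<Sum>i = 1..M. measure lborel (K i \<inter> {x<..y}))"
        unfolding sum_subtractf[symmetric] by (intro sum.cong refl measure_Int_Icc_step(1) Kb that)
      have "\<Psi> y - \<Psi> x = - L * (y - x) + e * ((\<Sum>i = 1..M. measure lborel (K i \<inter> {a..y})) -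
          (\<Sum>i = 1..M. measure lborel (K i \<inter> {a..x})))"
        unfolding \<Psi>_def by (simp add: algebra_simps)
      then show ?thesis unfolding * .
    qed
    have "continuous_on {a..b} (\<lambda>x. measure lborel (K i \<inter> {a..x}))" for i
    proof (rule lipschitz_on_continuous_on)
      show "1-lipschitz_on {a..b} (\<lambda>x. measure lborel (K i \<inter> {a..x}))"
      proof (rule lipschitz_onI)
        have *: "\<bar>measure lborel (K i \<inter> {a..y}) - measure lborel (K i \<inter> {a..x})\<bar> \<le> y - x"
          if "a \<le> x" "x \<le> y" for x y
          using measure_Int_Icc_step[OF Kb that] by (simp add: measure_nonneg)
        fix x y assume "x \<in> {a..b}" "y \<in> {a..b}"
        then show "dist (measure lborel (K i \<inter> {a..x})) (measure lborel (K i \<inter> {a..y})) \<le> 1 * dist x y"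
          using *[of x y] *[of y x] by (cases "x \<le> y") (auto simp: dist_real_def abs_minus_commute)
      qed simp
    qed
    then have \<Phi>_cont: "continuous_on {a..b} \<Phi>"
      unfolding \<Phi>_def \<Psi>_def
      by (intro continuous_intros continuous_on_subset[OF lipschitz_on_continuous_on[OF lip]]) auto
    have "\<Phi> a \<le> \<Phi> b"
    proof (rule continuous_locally_increasing_imp_le[OF \<open>a \<le> b\<close> \<Phi>_cont])
      fix x assume x: "a \<le> x" "x < b"
      \<comment> \<open>Semicontinuity: near \<open>x\<close> only those \<open>K i\<close> contribute to \<open>\<Psi>\<close> that contain \<open>x\<close>.\<close>
      have "\<exists>d>0. \<forall>i\<in>{1..M}. x \<notin> K i \<longrightarrow> K i \<inter> ball x d = {}"
      proof -
        let ?F = "\<Union>i\<in>{i \<in> {1..M}. x \<notin> K i}. K i"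
        have "closed ?F" using K(1) by (intro closed_UN) auto
        then have "open (- ?F)" by (rule open_Compl)
        moreover have "x \<in> - ?F" by auto
        ultimately obtain d where "0 < d" "ball x d \<subseteq> - ?F" by (rule openE)
        then show ?thesis by (intro exI[of _ d]) auto
      qed
      then obtain d where d: "0 < d" "\<And>i. i \<in> {1..M} \<Longrightarrow> x \<notin> K i \<Longrightarrow> K i \<inter> ball x d = {}" by blast
      obtain t where t: "0 < t" "t < min d (b - x)" "U x - e < (f (x + t) - f x) / t"
        using upper_dderiv_frequently[OF lip \<open>0 < e\<close>, of "min d (b - x)" 1 x] d(1) x
        by (auto simp: U_def)
      have "measure lborel (K i \<inter> {x<..x + t}) \<le> (if real i * e \<le> U x + L then t else 0)"
        if i: "i \<in> {1..M}" for i
      proof (cases "x \<in> K i")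
        case True
        then have "real i * e \<le> U x + L" using K(2)[of i] by (auto simp: E_def)
        then show ?thesis using measure_Int_Icc_step(2)[OF Kb[of i] x(1), of "x + t"] t(1) by simp
      next
        case False
        have "K i \<inter> {x<..x + t} = {}"
          using d(2)[OF i False] t(2) by (auto simp: ball_def dist_real_def)
        then show ?thesis using t(1) by simp
      qed
      then have "(\<Sum>i = 1..M. measure lborel (K i \<inter> {x<..x + t})) \<le>
          (\<Sum>i = 1..M. if real i * e \<le> U x + L then t else 0)"
        by (rule sum_mono)
      also have "\<dots> = real (card {i \<in> {1..M}. real i * e \<le> U x + L}) * t"
        by (subst sum.inter_filter[symmetric]) simp_all
      finally have "e * (\<Sum>i = 1..M. measure lborel (K i \<inter> {x<..x + t})) \<le>
          e * (real (card {i \<in> {1..M}. real i * e \<le> U x + L}) * t)"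
        using \<open>0 < e\<close> by (intro mult_left_mono) auto
      also have "\<dots> = (e * real (card {i \<in> {1..M}. real i * e \<le> U x + L})) * t" by simp
      also have "\<dots> \<le> (U x + L) * t"
        using layer_sum_bounds(1)[OF \<open>0 < e\<close> UL M] t(1) by (intro mult_right_mono) auto
      finally have "\<Psi> (x + t) - \<Psi> x \<le> U x * t"
        using step[OF x(1), of "x + t"] t(1) by (simp add: algebra_simps)
      moreover have "(U x - e) * t < f (x + t) - f x"
        using t(1,3) by (simp add: pos_less_divide_eq)
      moreover have "0 < e * t" using \<open>0 < e\<close> t(1) by simp
      ultimately have "\<Phi> x \<le> \<Phi> (x + t)" unfolding \<Phi>_def by (simp add: algebra_simps)
      then show "\<exists>y>x. y \<le> b \<and> \<Phi> x \<le> \<Phi> y" using t by (intro exI[of _ "x + t"]) auto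
    qed
    moreover have "\<Psi> a = 0"
    proof -
      have "measure lborel (K i \<inter> {a..a}) = 0" for i
        using measure_mono_fmeasurable[of "K i \<inter> {a..a}" "{a}" lborel] Kb[of i]
        by (simp add: fmeasurable_def measure_le_0_iff)
      then show ?thesis by (simp add: \<Psi>_def)
    qed
    ultimately have \<Psi>b: "\<Psi> b \<le> f b - f a + 2 * e * (b - a)"
      unfolding \<Phi>_def by (simp add: algebra_simps)
    have "(LINT x:{a..b}|lborel. U x) \<le>
        (LINT x:{a..b}|lborel. (e - L) + e * (\<Sum>i = 1..M. indicator (E i) x))"
    proof (rule set_integral_mono[OF U_int])
      show "set_integrable lborel {a..b} (\<lambda>x. (e - L) + e * (\<Sum>i = 1..M. indicator (E i) x))"
        unfolding set_integrable_def
      proof (rule integrableI_bounded_set_indicator[where B = "\<bar>e - L\<bar> + \<bar>e\<bar> * real M"])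
        show "AE x in lborel. x \<in> {a..b} \<longrightarrow>
            norm ((e - L) + e * (\<Sum>i = 1..M. indicator (E i) x)) \<le> \<bar>e - L\<bar> + \<bar>e\<bar> * real M"
        proof (intro AE_I2 impI)
          fix x
          have "\<bar>\<Sum>i = 1..M. indicator (E i) x :: real\<bar> \<le> (\<Sum>i = 1..M. 1)"
            by (rule order_trans[OF sum_abs]) (intro sum_mono, simp add: indicator_def)
          then have "\<bar>e\<bar> * \<bar>\<Sum>i = 1..M. indicator (E i) x\<bar> \<le> \<bar>e\<bar> * real M"
            by (intro mult_left_mono) auto
          then show "norm ((e - L) + e * (\<Sum>i = 1..M. indicator (E i) x)) \<le> \<bar>e - L\<bar> + \<bar>e\<bar> * real M"
            using abs_triangle_ineq[of "e - L" "e * (\<Sum>i = 1..M. indicator (E i) x)"]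
            by (simp add: abs_mult)
        qed
      qed (auto simp: emeasure_lborel_Icc_eq less_top[symmetric])
    next
      fix x assume x: "x \<in> {a..b}"
      have "(\<Sum>i = 1..M. indicator (E i) x) = (\<Sum>i = 1..M. if real i * e \<le> U x + L then 1 else 0 :: real)"
        using x by (intro sum.cong) (auto simp: E_def)
      also have "\<dots> = real (card {i \<in> {1..M}. real i * e \<le> U x + L})"
        by (subst sum.inter_filter[symmetric]) simp_all
      finally show "U x \<le> (e - L) + e * (\<Sum>i = 1..M. indicator (E i) x)"
        using layer_sum_bounds(2)[OF \<open>0 < e\<close> UL M, of x] by simp
    qed
    also have "\<dots> = (e - L) * (b - a) + e * (\<Sum>i = 1..M. measure lborel (E i))"
    proof -
      have ind: "integrable lborel (\<lambda>x. indicator (E i) x :: real)" for i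
        using E_fin[of i] E by (intro integrable_real_indicator) auto
      have "(LINT x:{a..b}|lborel. (e - L) + e * (\<Sum>i = 1..M. indicator (E i) x)) =
          (LINT x|lborel. (e - L) * indicator {a..b} x + e * (\<Sum>i = 1..M. indicator (E i) x))"
        unfolding set_lebesgue_integral_def
      proof (rule Bochner_Integration.integral_cong[OF refl])
        fix x
        show "indicator {a..b} x *\<^sub>R ((e - L) + e * (\<Sum>i = 1..M. indicator (E i) x)) =
            (e - L) * indicator {a..b} x + e * (\<Sum>i = 1..M. indicator (E i) x)"
          by (cases "x \<in> {a..b}") (auto simp: E_def indicator_def intro!: sum.neutral)
      qed
      also have "\<dots> = (e - L) * measure lborel {a..b} + e * (\<Sum>i = 1..M. measure lborel (E i))"
        using ind E by (subst Bochner_Integration.integral_add)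
          (auto simp: Bochner_Integration.integral_sum emeasure_lborel_Icc_eq
            intro!: integrable_mult_right integrable_sum)
      finally show ?thesis using \<open>a \<le> b\<close> by simp
    qed
    also have "\<dots> \<le> (e - L) * (b - a) + e * ((\<Sum>i = 1..M. measure lborel (K i)) + 1)"
    proof -
      have "(\<Sum>i = 1..M. measure lborel (E i)) \<le> (\<Sum>i = 1..M. measure lborel (K i) + \<eta>)"
        by (intro sum_mono K(3))
      also have "\<dots> = (\<Sum>i = 1..M. measure lborel (K i)) + real M * \<eta>"
        by (simp add: sum.distrib)
      also have "real M * \<eta> \<le> 1" by (simp add: \<eta>_def)
      finally show ?thesis using \<open>0 < e\<close> by simp
    qed
    also have "\<dots> = \<Psi> b + e * (b - a) + e"
    proof -
      have "K i \<inter> {a..b} = K i" for i using K(2)[of i] by (auto simp: E_def)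
      then show ?thesis by (simp add: \<Psi>_def algebra_simps)
    qed
    finally show ?thesis using \<Psi>b by (simp add: algebra_simps)
  qed
  show ?thesis
  proof (rule field_le_epsilon)
    fix \<epsilon> :: real assume "0 < \<epsilon>"
    define e where "e = \<epsilon> / (3 * (b - a) + 1)"
    have "0 < e" using \<open>0 < \<epsilon>\<close> \<open>a \<le> b\<close> by (simp add: e_def)
    have "3 * e * (b - a) + e = e * (3 * (b - a) + 1)" by (simp add: algebra_simps)
    also have "\<dots> = \<epsilon>" using \<open>a \<le> b\<close> by (simp add: e_def)
    finally show "(LINT x:{a..b}|lborel. upper_dderiv f 1 x) \<le> f b - f a + \<epsilon>"
      using main[OF \<open>0 < e\<close>] by (simp add: U_def)
  qed
qed

text \<open>The upper derivatives of \<open>f\<close> and \<open>- f\<close> have a nonnegative sum, whose integral over any interval is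
at most the sum of the increments of \<open>f\<close> and \<open>- f\<close>, which is zero.\<close>

lemma AE_upper_dderiv_real:
  fixes f :: "real \<Rightarrow> real"
  assumes lip: "L-lipschitz_on UNIV f"
  shows "AE x in lborel. upper_dderiv f 1 x + upper_dderiv (\<lambda>x. - f x) 1 x = 0"
proof -
  have lip': "L-lipschitz_on UNIV (\<lambda>x. - f x)" using lip by simp
  define h where "h x = upper_dderiv f 1 x + upper_dderiv (\<lambda>x. - f x) 1 x" for x
  have [measurable]: "upper_dderiv f 1 \<in> borel_measurable borel" "upper_dderiv (\<lambda>x. - f x) 1 \<in> borel_measurable borel"
    by (rule borel_measurable_upper_dderiv[OF lip], rule borel_measurable_upper_dderiv[OF lip'])
  have h_nonneg: "0 \<le> h x" for x unfolding h_def by (rule upper_dderiv_minus_ge[OF lip])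
  have "AE x in lborel. x \<in> {- real n..real n} \<longrightarrow> h x = 0" for n
  proof -
    let ?I = "{- real n..real n}"
    have int: "set_integrable lborel ?I (upper_dderiv g 1)" if "L-lipschitz_on UNIV g" for g :: "real \<Rightarrow> real"
      unfolding set_integrable_def
      by (rule integrableI_bounded_set_indicator[where B = L])
        (use abs_upper_dderiv_le[OF that, of 1] borel_measurable_upper_dderiv[OF that, of 1] in
          \<open>auto simp: emeasure_lborel_Icc_eq less_top[symmetric]\<close>)
    have "(LINT x:?I|lborel. h x) = (LINT x:?I|lborel. upper_dderiv f 1 x) + (LINT x:?I|lborel. upper_dderiv (\<lambda>x. - f x) 1 x)"
      unfolding h_def by (rule set_integral_add(2)[OF int[OF lip] int[OF lip']])
    also have "\<dots> \<le> (f (real n) - f (- real n)) + (- f (real n) - - f (- real n))"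
      by (intro add_mono integral_upper_dderiv_le[OF lip] integral_upper_dderiv_le[OF lip']) auto
    finally have le: "(LINT x:?I|lborel. h x) \<le> 0" by simp
    have inth: "integrable lborel (\<lambda>x. indicator ?I x *\<^sub>R h x)"
      using set_integral_add(1)[OF int[OF lip] int[OF lip']] unfolding h_def set_integrable_def .
    have "(LINT x|lborel. indicator ?I x *\<^sub>R h x) = 0"
    proof (rule antisym)
      show "(LINT x|lborel. indicator ?I x *\<^sub>R h x) \<le> 0" using le by (simp add: set_lebesgue_integral_def)
      show "0 \<le> (LINT x|lborel. indicator ?I x *\<^sub>R h x)"
        using h_nonneg by (intro integral_nonneg_AE AE_I2) (auto simp: indicator_def)
    qed
    then have "AE x in lborel. indicator ?I x *\<^sub>R h x = 0"
      using integral_nonneg_eq_0_iff_AE[OF inth] h_nonneg by (auto simp: indicator_def)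
    then show ?thesis by eventually_elim (auto simp: indicator_def)
  qed
  then have "AE x in lborel. \<forall>n. x \<in> {- real n..real n} \<longrightarrow> h x = 0"
    unfolding AE_all_countable by blast
  then show ?thesis
  proof eventually_elim
    case (elim x)
    obtain n :: nat where "\<bar>x\<bar> \<le> real n" using real_arch_simple by blast
    then have "x \<in> {- real n..real n}" by (simp add: abs_le_iff)
    then show ?case using elim unfolding h_def by blast
  qed
qed

section \<open>Directional derivatives along lines and translation of box integrals\<close>

lemma nn_integral_lborel_translate:
  fixes c :: "'a::euclidean_space"
  assumes [measurable]: "F \<in> borel_measurable borel"
  shows "(\<integral>\<^sup>+z. F (c + z) \<partial>lborel) = (\<integral>\<^sup>+z. F z \<partial>lborel)"
proof -
  have "(\<integral>\<^sup>+z. F z \<partial>lborel) = (\<integral>\<^sup>+z. F z \<partial>distr lborel borel ((+) c))"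
    by (simp only: lborel_distr_plus)
  also have "\<dots> = (\<integral>\<^sup>+z. F (c + z) \<partial>lborel)"
    by (rule nn_integral_distr) auto
  finally show ?thesis by simp
qed

lemma integral_lborel_translate:
  fixes c :: "'a::euclidean_space" and F :: "'a \<Rightarrow> real"
  assumes [measurable]: "F \<in> borel_measurable borel"
  shows "(LINT z|lborel. F (c + z)) = (LINT z|lborel. F z)"
proof -
  have "(LINT z|lborel. F z) = (LINT z|distr lborel borel ((+) c). F z)"
    by (simp only: lborel_distr_plus)
  also have "\<dots> = (LINT z|lborel. F (c + z))"
    by (rule integral_distr) auto
  finally show ?thesis by simp
qed

text \<open>Integrate the indicator of \<open>N\<close> at \<open>z + s *\<^sub>R v\<close> over all \<open>z\<close> and all real \<open>s\<close>. Integrating over \<open>s\<close>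
first gives \<open>0\<close>, integrating over \<open>z\<close> first gives the measure of \<open>N\<close>, by translation invariance,
times the infinite length of the line. This form of Fubini's theorem needs no coordinates adapted
to \<open>v\<close>.\<close>

lemma null_set_lborel_if_null_on_lines:
  fixes v :: "'a::euclidean_space"
  assumes [measurable]: "N \<in> sets borel" and lines: "\<And>z. AE s in lborel. z + s *\<^sub>R v \<notin> N"
  shows "N \<in> null_sets lborel"
proof -
  have "(\<integral>\<^sup>+s. \<integral>\<^sup>+z. indicator N (z + s *\<^sub>R v) \<partial>lborel \<partial>lborel) =
      (\<integral>\<^sup>+z. \<integral>\<^sup>+s. indicator N (z + s *\<^sub>R v) \<partial>lborel \<partial>lborel)"
    using lborel_pair.Fubini'[of "\<lambda>z s. indicator N (z + s *\<^sub>R v) :: ennreal"] by simp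
  also have "\<dots> = (\<integral>\<^sup>+z. 0 \<partial>(lborel :: 'a measure))"
  proof (rule nn_integral_cong)
    fix z :: 'a
    have "AE s in lborel. indicator N (z + s *\<^sub>R v) = (0 :: ennreal)"
      using lines[of z] by eventually_elim simp
    then show "(\<integral>\<^sup>+s. indicator N (z + s *\<^sub>R v) \<partial>lborel) = 0"
      by (subst nn_integral_0_iff_AE) auto
  qed
  finally have "(\<integral>\<^sup>+s. \<integral>\<^sup>+z. indicator N (z + s *\<^sub>R v) \<partial>lborel \<partial>lborel) = 0" by simp
  moreover have "(\<integral>\<^sup>+z. indicator N (z + s *\<^sub>R v) \<partial>lborel) = emeasure lborel N" for s
    using nn_integral_lborel_translate[of "indicator N" "s *\<^sub>R v"] by (simp add: add.commute)
  ultimately have "emeasure lborel N * emeasure lborel (UNIV :: real set) = 0" by simp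
  then have "emeasure lborel N = 0" by simp
  then show ?thesis by auto
qed

lemma AE_upper_dderiv_minus:
  fixes g :: "'a::euclidean_space \<Rightarrow> real"
  assumes lip: "L-lipschitz_on UNIV g"
  shows "AE z in lborel. upper_dderiv g v z + upper_dderiv (\<lambda>x. - g x) v z = 0"
proof -
  have lip': "L-lipschitz_on UNIV (\<lambda>x. - g x)" using lip by simp
  note [measurable] = borel_measurable_upper_dderiv[OF lip, of v] borel_measurable_upper_dderiv[OF lip', of v]
  define N where "N = {z. upper_dderiv g v z + upper_dderiv (\<lambda>x. - g x) v z \<noteq> 0}"
  have "N \<in> null_sets lborel"
  proof (rule null_set_lborel_if_null_on_lines)
    show "N \<in> sets borel" unfolding N_def by measurable
    fix z
    define f where "f s = g (z + s *\<^sub>R v)" for s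
    have "(L * norm v)-lipschitz_on UNIV f"
    proof (rule lipschitz_onI)
      fix s t :: real
      have "dist (f s) (f t) \<le> L * dist (z + s *\<^sub>R v) (z + t *\<^sub>R v)"
        unfolding f_def by (rule lipschitz_onD[OF lip]) auto
      also have "dist (z + s *\<^sub>R v) (z + t *\<^sub>R v) = norm v * dist s t"
        by (simp add: dist_norm dist_real_def flip: scaleR_left_diff_distrib)
      finally show "dist (f s) (f t) \<le> L * norm v * dist s t" by (simp add: mult.assoc)
    qed (use lipschitz_on_nonneg[OF lip] in simp)
    then have "AE s in lborel. upper_dderiv f 1 s + upper_dderiv (\<lambda>x. - f x) 1 s = 0"
      by (rule AE_upper_dderiv_real)
    moreover have "upper_dderiv f 1 s = upper_dderiv g v (z + s *\<^sub>R v)" for s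
      by (simp add: upper_dderiv_def f_def algebra_simps)
    moreover have "upper_dderiv (\<lambda>x. - f x) 1 s = upper_dderiv (\<lambda>x. - g x) v (z + s *\<^sub>R v)" for s
      by (simp add: upper_dderiv_def f_def algebra_simps)
    ultimately show "AE s in lborel. z + s *\<^sub>R v \<notin> N" by (simp add: N_def)
  qed
  then show ?thesis by (rule AE_I') (auto simp: N_def)
qed

lemma AE_tendsto_upper_dderiv:
  fixes g :: "'a::euclidean_space \<Rightarrow> real"
  assumes lip: "L-lipschitz_on UNIV g"
  shows "AE z in lborel.
    ((\<lambda>t. (g (z + t *\<^sub>R v) - g z) / t) \<longlongrightarrow> upper_dderiv g v z) (at_right 0)"
  using AE_upper_dderiv_minus[OF lip, of v] by eventually_elim (rule tendsto_upper_dderiv[OF lip])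

text \<open>Adding \<open>M\<close> makes \<open>h\<close> nonnegative. Then \<open>h + M\<close> and the constant \<open>M\<close> are densities of measures that
agree on boxes, hence everywhere, and densities are unique almost everywhere. The restriction to a
fixed large box keeps the measures finite.\<close>

lemma AE_zero_if_box_integrals_zero:
  fixes h :: "'a::euclidean_space \<Rightarrow> real"
  assumes h[measurable]: "h \<in> borel_measurable borel" and bd: "\<And>z. \<bar>h z\<bar> \<le> M"
    and zero: "\<And>a b. (LINT z:box a b|lborel. h z) = 0"
  shows "AE z in lborel. h z = 0"
proof -
  let ?B = "\<lambda>n::nat. box (- (real n *\<^sub>R One)) (real n *\<^sub>R One) :: 'a set"
  have box_fin: "emeasure lborel (box a b) < \<infinity>" for a b :: 'a
    by (rule emeasure_bounded_finite[OF bounded_box])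
  have "AE z in lborel. z \<in> ?B n \<longrightarrow> h z = 0" for n
  proof -
    define f1 where "f1 z = ennreal (h z + M) * indicator (?B n) z" for z
    define f2 where "f2 z = ennreal M * indicator (?B n) z" for z
    have [measurable]: "f1 \<in> borel_measurable borel" "f2 \<in> borel_measurable borel"
      unfolding f1_def f2_def by measurable
    have f1_le: "f1 z \<le> ennreal (2 * M) * indicator (?B n) z" for z
      unfolding f1_def using bd[of z] by (auto simp: indicator_def intro!: ennreal_leI)
    have "density lborel f1 = density lborel f2"
    proof (rule measure_eqI_generator_eq)
      let ?E = "range (\<lambda>(a, b). box a b::'a set)"
      show "Int_stable ?E" by (auto simp: Int_stable_def box_Int_box)
      show "?E \<subseteq> Pow UNIV" "sets (density lborel f1) = sigma_sets UNIV ?E"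
          "sets (density lborel f2) = sigma_sets UNIV ?E"
        by (simp_all add: borel_eq_box)
      show "range ?B \<subseteq> ?E" "(\<Union>i. ?B i) = UNIV" unfolding UN_box_eq_UNIV by auto
      have em: "emeasure (density lborel (\<lambda>z. ennreal (p z) * indicator (?B n) z)) (box a b) =
          ennreal (LINT z:?B n \<inter> box a b|lborel. p z)"
        if [measurable]: "p \<in> borel_measurable borel" and p: "\<And>z. 0 \<le> p z" "\<And>z. p z \<le> 2 * M" for p a b
      proof -
        have int: "integrable lborel (\<lambda>z. indicator (?B n \<inter> box a b) z *\<^sub>R p z)"
          by (rule integrableI_bounded_set_indicator[where B = "2 * M"])
            (use p box_fin in \<open>auto simp: box_Int_box\<close>)
        have "emeasure (density lborel (\<lambda>z. ennreal (p z) * indicator (?B n) z)) (box a b) =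
            (\<integral>\<^sup>+z. ennreal (p z) * indicator (?B n) z * indicator (box a b) z \<partial>lborel)"
          by (rule emeasure_density) auto
        also have "\<dots> = (\<integral>\<^sup>+z. ennreal (indicator (?B n \<inter> box a b) z *\<^sub>R p z) \<partial>lborel)"
          by (rule nn_integral_cong) (auto simp: indicator_def)
        also have "\<dots> = ennreal (LINT z|lborel. indicator (?B n \<inter> box a b) z *\<^sub>R p z)"
          using p by (intro nn_integral_eq_integral int) auto
        finally show ?thesis by (simp add: set_lebesgue_integral_def)
      qed
      have hM: "0 \<le> h z + M" "h z + M \<le> 2 * M" "0 \<le> M" for z
        using bd[of z] by (simp_all add: abs_le_iff)
      show "emeasure (density lborel f1) X = emeasure (density lborel f2) X" if "X \<in> ?E" for X
      proof -
        obtain a b where X: "X = box a b" using \<open>X \<in> ?E\<close> by auto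
        obtain c d where cd: "?B n \<inter> box a b = box c d" by (simp add: box_Int_box)
        have hi: "set_integrable lborel (box c d) h"
          unfolding set_integrable_def
          by (rule integrableI_bounded_set_indicator[where B = M]) (use bd box_fin in auto)
        have Mi: "set_integrable lborel (box c d) (\<lambda>_. M)"
          unfolding set_integrable_def
          by (rule integrableI_bounded_set_indicator[where B = M]) (use hM box_fin in auto)
        have "emeasure (density lborel f1) X = ennreal (LINT z:box c d|lborel. h z + M)"
          unfolding f1_def X using em[of "\<lambda>z. h z + M" a b] hM cd by simp
        also have "(LINT z:box c d|lborel. h z + M) = (LINT z:box c d|lborel. M)"
          using set_integral_add(2)[OF hi Mi] zero by simp
        also have "ennreal \<dots> = emeasure (density lborel f2) X"
          unfolding f2_def X using em[of "\<lambda>z. M" a b] hM cd by simp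
        finally show ?thesis .
      qed
      show "emeasure (density lborel f1) (?B i) \<noteq> \<infinity>" for i
        unfolding f1_def using em[of "\<lambda>z. h z + M"] hM by simp
    qed
    moreover have "integral\<^sup>N lborel f1 \<noteq> \<infinity>"
    proof -
      have "integral\<^sup>N lborel f1 \<le> (\<integral>\<^sup>+z. ennreal (2 * M) * indicator (?B n) z \<partial>lborel)"
        by (intro nn_integral_mono f1_le)
      also have "\<dots> = ennreal (2 * M) * emeasure lborel (?B n)"
        by (rule nn_integral_cmult_indicator) simp
      also have "\<dots> < \<infinity>" using box_fin by (simp add: ennreal_mult_less_top)
      finally show ?thesis by simp
    qed
    ultimately have "AE z in lborel. f1 z = f2 z"
      using finite_density_unique[of f1 lborel f2] by simp
    then show ?thesis
    proof eventually_elim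
      case (elim z)
      have "h z + M = M" if "z \<in> ?B n"
        using elim that bd[of z] by (simp add: f1_def f2_def abs_le_iff)
      then show ?case by simp
    qed
  qed
  then have "AE z in lborel. \<forall>n. z \<in> ?B n \<longrightarrow> h z = 0" unfolding AE_all_countable by blast
  then show ?thesis
  proof eventually_elim
    case (elim z)
    have "z \<in> (\<Union>n. ?B n)" unfolding UN_box_eq_UNIV by simp
    then show ?case using elim by blast
  qed
qed

text \<open>Translating the integrand amounts to translating the box, which changes it only by a set of small
measure; this bounds the difference uniformly in the integrands because they are bounded by the same
\<open>M\<close>.\<close>

lemma box_integral_translate_tendsto:
  fixes p :: "nat \<Rightarrow> 'a::euclidean_space \<Rightarrow> real"
  assumes p[measurable]: "\<And>n. p n \<in> borel_measurable borel" and bd: "\<And>n z. \<bar>p n z\<bar> \<le> M"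
    and w: "w \<longlonglongrightarrow> 0"
  shows "(\<lambda>n. (LINT z:box a b|lborel. p n (z + w n)) - (LINT z:box a b|lborel. p n z)) \<longlonglongrightarrow> 0"
proof -
  let ?B = "box a b"
  have "0 \<le> M" using bd[of 0 0] by linarith
  obtain W where W: "0 < W" "\<And>n. norm (w n) \<le> W"
    using convergent_imp_Bseq[OF convergentI[OF w]] by (auto simp: Bseq_def)
  obtain R where R: "\<And>z. z \<in> ?B \<Longrightarrow> norm z \<le> R"
    using bounded_box[of a b] unfolding bounded_iff by blast
  let ?C = "cball (0::'a) (R + W)"
  define d where "d n z = \<bar>indicator ?B (z - w n) - indicator ?B z :: real\<bar>" for n and z :: 'a
  have d_meas[measurable]: "d n \<in> borel_measurable borel" for n unfolding d_def by measurable
  have d_le: "d n z \<le> indicator ?C z" for n z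
  proof (cases "z \<in> ?C")
    case True
    then show ?thesis by (simp add: d_def indicator_def)
  next
    case False
    have "z \<notin> ?B" using False R[of z] W(1) by auto
    moreover have "z - w n \<notin> ?B"
    proof
      assume "z - w n \<in> ?B"
      then have "norm z \<le> R + W" using R[of "z - w n"] W(2)[of n] norm_triangle_ineq[of "z - w n" "w n"] by simp
      then show False using False by simp
    qed
    ultimately show ?thesis by (simp add: d_def)
  qed
  have C_int: "integrable lborel (\<lambda>z. indicator ?C z :: real)"
    using emeasure_bounded_finite[of ?C] by (intro integrable_real_indicator) auto
  have d_int: "integrable lborel (d n)" for n
    by (rule Bochner_Integration.integrable_bound[OF C_int]) (use d_le in \<open>auto simp: d_def\<close>)
  have "(\<lambda>n. LINT z|lborel. d n z) \<longlonglongrightarrow> (LINT z|(lborel :: 'a measure). 0 :: real)"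
  proof (rule integral_dominated_convergence[where w = "indicator ?C"])
    have "cbox a b - box a b \<in> null_sets lborel"
      using negligible_frontier_interval[of a b]
      by (simp add: negligible_iff_null_sets null_sets_completion_iff)
    then have "AE z in lborel. z \<notin> cbox a b - box a b" by (rule AE_not_in)
    then show "AE z in lborel. (\<lambda>n. d n z) \<longlonglongrightarrow> 0"
    proof eventually_elim
      case (elim z)
      have lim: "(\<lambda>n. z - w n) \<longlonglongrightarrow> z - 0" by (intro tendsto_intros w)
      have "\<forall>\<^sub>F n in sequentially. d n z = 0"
      proof (cases "z \<in> box a b")
        case True
        then have "\<forall>\<^sub>F n in sequentially. z - w n \<in> box a b"
          using topological_tendstoD[OF lim, of "box a b"] by (simp add: open_box)
        then show ?thesis by eventually_elim (use True in \<open>simp add: d_def\<close>)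
      next
        case False
        then have "z \<in> - cbox a b" using elim by simp
        then have "\<forall>\<^sub>F n in sequentially. z - w n \<in> - cbox a b"
          using topological_tendstoD[OF lim, of "- cbox a b"] by (simp add: open_Compl closed_cbox)
        then show ?thesis
          by eventually_elim (use False in \<open>auto simp: d_def indicator_def dest: subsetD[OF box_subset_cbox]\<close>)
      qed
      then show ?case by (rule tendsto_eventually)
    qed
    show "AE z in lborel. norm (d n z) \<le> indicator ?C z" for n
      using d_le[of n] by (intro AE_I2) (simp add: d_def)
  qed (use C_int in auto)
  then have lim0: "(\<lambda>n. M * (LINT z|lborel. d n z)) \<longlonglongrightarrow> 0"
    using tendsto_mult_left[of "\<lambda>n. LINT z|lborel. d n z" 0 sequentially M] by simp
  show ?thesis
  proof (rule Lim_null_comparison[OF _ lim0], rule always_eventually, rule allI)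
    fix n
    have meas: "(\<lambda>z. indicator ?B (z - w n) * p n z) \<in> borel_measurable borel" by measurable
    have "(LINT z:?B|lborel. p n (z + w n)) = (LINT z|lborel. indicator ?B (w n + z - w n) * p n (w n + z))"
      by (simp add: set_lebesgue_integral_def add.commute)
    also have "\<dots> = (LINT z|lborel. indicator ?B (z - w n) * p n z)"
      by (rule integral_lborel_translate[OF meas])
    finally have eq: "(LINT z:?B|lborel. p n (z + w n)) = (LINT z|lborel. indicator ?B (z - w n) * p n z)" .
    have CM: "integrable lborel (\<lambda>z. M * indicator ?C z)" by (intro integrable_mult_right C_int)
    have i1: "integrable lborel (\<lambda>z. indicator ?B (z - w n) * p n z)"
    proof (rule Bochner_Integration.integrable_bound[OF CM], measurable, intro AE_I2)
      fix z
      have "indicator ?B (z - w n) \<le> (indicator ?C z :: real)"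
        using R[of "z - w n"] W(2)[of n] norm_triangle_ineq[of "z - w n" "w n"]
        by (auto simp: indicator_def)
      then show "norm (indicator ?B (z - w n) * p n z) \<le> norm (M * indicator ?C z)"
        using bd[of n z] \<open>0 \<le> M\<close> by (auto simp: indicator_def abs_mult)
    qed
    have i2: "integrable lborel (\<lambda>z. indicator ?B z * p n z)"
    proof (rule Bochner_Integration.integrable_bound[OF CM], measurable, intro AE_I2)
      fix z
      show "norm (indicator ?B z * p n z) \<le> norm (M * indicator ?C z)"
        using bd[of n z] \<open>0 \<le> M\<close> R[of z] W(1) by (auto simp: indicator_def abs_mult)
    qed
    have "(LINT z:?B|lborel. p n (z + w n)) - (LINT z:?B|lborel. p n z) =
        (LINT z|lborel. indicator ?B (z - w n) * p n z - indicator ?B z * p n z)"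
      unfolding eq using i1 i2 by (simp add: set_lebesgue_integral_def)
    also have "norm \<dots> \<le> (LINT z|lborel. M * d n z)"
    proof (rule Bochner_Integration.integral_norm_bound_integral)
      show "integrable lborel (\<lambda>z. indicator ?B (z - w n) * p n z - indicator ?B z * p n z)"
        by (rule Bochner_Integration.integrable_diff[OF i1 i2])
      show "integrable lborel (\<lambda>z. M * d n z)" by (intro integrable_mult_right d_int)
      show "norm (indicator ?B (z - w n) * p n z - indicator ?B z * p n z) \<le> M * d n z" for z
        using bd[of n z] by (auto simp: d_def indicator_def)
    qed
    finally show "norm ((LINT z:?B|lborel. p n (z + w n)) - (LINT z:?B|lborel. p n z))
        \<le> M * (LINT z|lborel. d n z)" by simp
  qed
qed

section \<open>Linearity of the directional derivative\<close>

text \<open>For difference quotients with step \<open>s\<close>, the quotient for \<open>u + v\<close> at \<open>z\<close> is the quotient for \<open>u\<close> at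
\<open>z\<close> plus the quotient for \<open>v\<close> at \<open>z + s *\<^sub>R u\<close>. Integrated over a box, the translation by
\<open>s *\<^sub>R u\<close> has no effect in the limit, so the integral of the defect of additivity over every box is
zero.\<close>

lemma AE_upper_dderiv_add:
  fixes g :: "'a::euclidean_space \<Rightarrow> real"
  assumes lip: "L-lipschitz_on UNIV g"
  shows "AE z in lborel. upper_dderiv g (u + v) z = upper_dderiv g u z + upper_dderiv g v z"
proof -
  have "0 \<le> L" using lip by (rule lipschitz_on_nonneg)
  have g_cont: "continuous_on UNIV g" by (rule lipschitz_on_continuous_on[OF lip])
  define s where "s n = 1 / real (Suc n)" for n
  have s_pos: "0 < s n" for n by (simp add: s_def)
  have s_lim: "s \<longlonglongrightarrow> 0"
    using LIMSEQ_inverse_real_of_nat by (simp add: s_def[abs_def] inverse_eq_divide)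
  then have s_filter: "filterlim s (at_right 0) sequentially"
    using s_pos by (intro tendsto_imp_filterlim_at_right) auto
  define q where "q w n z = (g (z + s n *\<^sub>R w) - g z) / s n" for w n z
  have q_meas[measurable]: "q w n \<in> borel_measurable borel" for w n
    unfolding q_def
    by (intro borel_measurable_continuous_onI continuous_intros continuous_on_compose2[OF g_cont])
      (use s_pos[of n] in auto)
  have q_bd: "\<bar>q w n z\<bar> \<le> L * norm w" for w n z
    unfolding q_def by (rule lipschitz_quotient_bound[OF lip s_pos])
  have U_meas[measurable]: "upper_dderiv g w \<in> borel_measurable borel" for w
    by (rule borel_measurable_upper_dderiv[OF lip])
  have U_bd: "\<bar>upper_dderiv g w z\<bar> \<le> L * norm w" for w z
    by (rule abs_upper_dderiv_le[OF lip])
  have int: "set_integrable lborel (box a b) F"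
    if "F \<in> borel_measurable borel" "\<And>z. \<bar>F z\<bar> \<le> C" for F :: "'a \<Rightarrow> real" and C a b
    unfolding set_integrable_def
    by (rule integrableI_bounded_set_indicator[where B = C])
      (use that emeasure_bounded_finite[OF bounded_box, of a b] in auto)
  have q_lim: "(\<lambda>n. LINT z:box a b|lborel. q w n z) \<longlonglongrightarrow> (LINT z:box a b|lborel. upper_dderiv g w z)"
    for w a b
    unfolding set_lebesgue_integral_def
  proof (rule integral_dominated_convergence[where w = "\<lambda>z. indicator (box a b) z *\<^sub>R (L * norm w)"])
    show "integrable lborel (\<lambda>z. indicator (box a b) z *\<^sub>R (L * norm w))"
      using int[of "\<lambda>_. L * norm w" "L * norm w" a b] \<open>0 \<le> L\<close> by (simp add: set_integrable_def)
    show "AE z in lborel. (\<lambda>n. indicator (box a b) z *\<^sub>R q w n z) \<longlonglongrightarrow> indicator (box a b) z *\<^sub>R upper_dderiv g w z"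
      using AE_tendsto_upper_dderiv[OF lip, of w]
    proof eventually_elim
      case (elim z)
      then have "(\<lambda>n. q w n z) \<longlonglongrightarrow> upper_dderiv g w z"
        unfolding q_def by (rule filterlim_compose[OF _ s_filter])
      then show ?case by (intro tendsto_intros)
    qed
    show "AE z in lborel. norm (indicator (box a b) z *\<^sub>R q w n z) \<le> indicator (box a b) z *\<^sub>R (L * norm w)" for n
      using q_bd[of w n] by (intro AE_I2) (simp add: indicator_def)
  qed measurable
  define h where "h z = upper_dderiv g (u + v) z - upper_dderiv g u z - upper_dderiv g v z" for z
  have "AE z in lborel. h z = 0"
  proof (rule AE_zero_if_box_integrals_zero)
    show "h \<in> borel_measurable borel" unfolding h_def by measurable
    show "\<bar>h z\<bar> \<le> L * norm (u + v) + L * norm u + L * norm v" for z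
      unfolding h_def using U_bd[of "u + v" z] U_bd[of u z] U_bd[of v z] by linarith
    fix a b :: 'a
    let ?I = "\<lambda>F. LINT z:box a b|lborel. F z"
    have "(\<lambda>n. ?I (q (u + v) n) - ?I (q u n) - ?I (q v n)) \<longlonglongrightarrow>
        ?I (upper_dderiv g (u + v)) - ?I (upper_dderiv g u) - ?I (upper_dderiv g v)"
      by (intro tendsto_intros q_lim)
    moreover have "(\<lambda>n. ?I (q (u + v) n) - ?I (q u n) - ?I (q v n)) \<longlonglongrightarrow> 0"
    proof -
      have "?I (q (u + v) n) = ?I (q u n) + (LINT z:box a b|lborel. q v n (z + s n *\<^sub>R u))" for n
      proof -
        have "q (u + v) n z = q u n z + q v n (z + s n *\<^sub>R u)" for z
          by (simp add: q_def add_divide_distrib[symmetric] scaleR_right_distrib add.assoc)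
        then show ?thesis
          using set_integral_add(2)[OF int[OF q_meas q_bd] int[of "\<lambda>z. q v n (z + s n *\<^sub>R u)", OF _ q_bd], of a b u n]
          by simp
      qed
      then show ?thesis
        using box_integral_translate_tendsto[of "q v" "L * norm v" "\<lambda>n. s n *\<^sub>R u" a b] q_bd
          tendsto_scaleR[OF s_lim tendsto_const, of u] by simp
    qed
    ultimately have "?I (upper_dderiv g (u + v)) - ?I (upper_dderiv g u) - ?I (upper_dderiv g v) = 0"
      by (rule LIMSEQ_unique)
    moreover have "?I h = ?I (upper_dderiv g (u + v)) - ?I (upper_dderiv g u) - ?I (upper_dderiv g v)"
    proof -
      note i = int[OF U_meas U_bd, of a b]
      show ?thesis unfolding h_def
        by (subst set_integral_diff(2)[OF set_integral_diff(1)[OF i i] i], subst set_integral_diff(2)[OF i i]) simp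
    qed
    ultimately show "?I h = 0" by simp
  qed
  then show ?thesis by eventually_elim (simp add: h_def)
qed

text \<open>For positive \<open>c\<close> this is a substitution in the limit. For negative \<open>c\<close> it follows from
additivity, as \<open>c *\<^sub>R v\<close> and \<open>(- c) *\<^sub>R v\<close> add up to \<open>0\<close>.\<close>

lemma AE_upper_dderiv_scaleR:
  fixes g :: "'a::euclidean_space \<Rightarrow> real"
  assumes lip: "L-lipschitz_on UNIV g"
  shows "AE z in lborel. upper_dderiv g (c *\<^sub>R v) z = c * upper_dderiv g v z"
proof -
  have pos: "AE z in lborel. upper_dderiv g (c *\<^sub>R v) z = c * upper_dderiv g v z" if "0 < c" for c
    using AE_tendsto_upper_dderiv[OF lip, of v]
  proof eventually_elim
    case (elim z)
    have "((\<lambda>t. c * t) \<longlongrightarrow> c * 0) (at_right 0)" by (intro tendsto_intros)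
    then have "filterlim (\<lambda>t. c * t) (at_right 0) (at_right 0)"
      using \<open>0 < c\<close> by (intro tendsto_imp_filterlim_at_right) (auto simp: eventually_at_right_field intro: exI[of _ 1])
    then have "((\<lambda>t. (g (z + (c * t) *\<^sub>R v) - g z) / (c * t)) \<longlongrightarrow> upper_dderiv g v z) (at_right 0)"
      by (rule filterlim_compose[OF elim])
    then have "((\<lambda>t. c * ((g (z + (c * t) *\<^sub>R v) - g z) / (c * t))) \<longlongrightarrow> c * upper_dderiv g v z) (at_right 0)"
      by (rule tendsto_mult_left)
    moreover have "c * ((g (z + (c * t) *\<^sub>R v) - g z) / (c * t)) = (g (z + t *\<^sub>R c *\<^sub>R v) - g z) / t" for t
      using \<open>0 < c\<close> by (simp add: mult.commute)
    ultimately show ?case by (intro upper_dderiv_eqI[OF lip]) simp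
  qed
  have zero: "upper_dderiv g 0 z = 0" for z
    by (rule upper_dderiv_eqI[OF lip]) simp
  consider "0 < c" | "c = 0" | "c < 0" by linarith
  then show ?thesis
  proof cases
    case 3
    then have "0 < - c" by simp
    from pos[OF this] AE_upper_dderiv_add[OF lip, of "c *\<^sub>R v" "(- c) *\<^sub>R v"] show ?thesis
      by eventually_elim (simp add: zero)
  qed (use pos zero in auto)
qed

lemma AE_upper_dderiv_sum:
  fixes g :: "'a::euclidean_space \<Rightarrow> real"
  assumes lip: "L-lipschitz_on UNIV g" and "finite S"
  shows "AE z in lborel. upper_dderiv g (\<Sum>i\<in>S. c i *\<^sub>R v i) z = (\<Sum>i\<in>S. c i * upper_dderiv g (v i) z)"
  using \<open>finite S\<close>
proof (induction S)
  case empty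
  have "upper_dderiv g 0 z = 0" for z by (rule upper_dderiv_eqI[OF lip]) simp
  then show ?case by simp
next
  case (insert j S)
  from insert.IH AE_upper_dderiv_scaleR[OF lip, of "c j" "v j"]
    AE_upper_dderiv_add[OF lip, of "c j *\<^sub>R v j" "\<Sum>i\<in>S. c i *\<^sub>R v i"]
  show ?case by eventually_elim (use insert.hyps in simp)
qed

text \<open>Rademacher's theorem for directional derivatives. For a single direction, the derivative exists and
is the given linear expression outside a null set that depends on the direction. A countable dense
set of directions needs only one null set, and all other directions follow by approximation, as the
difference quotients are Lipschitz in the direction uniformly in \<open>t\<close>.\<close>

lemma AE_directional_derivatives_linear:
  fixes g :: "'a::euclidean_space \<Rightarrow> real"
  assumes lip: "L-lipschitz_on UNIV g"
  shows "AE z in lborel. \<forall>w. ((\<lambda>t. (g (z + t *\<^sub>R w) - g z) / t) \<longlongrightarrow>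
    (\<Sum>i\<in>Basis. (w \<bullet> i) * upper_dderiv g i z)) (at_right 0)"
proof -
  have "0 \<le> L" using lip by (rule lipschitz_on_nonneg)
  define l where "l z w = (\<Sum>i\<in>Basis. (w \<bullet> i) * upper_dderiv g i z)" for z w
  obtain Q :: "'a set" where Q: "countable Q" "\<And>X. open X \<Longrightarrow> X \<noteq> {} \<Longrightarrow> \<exists>d\<in>Q. d \<in> X"
    using countable_dense_exists[where 'a='a] by blast
  have "AE z in lborel. ((\<lambda>t. (g (z + t *\<^sub>R v) - g z) / t) \<longlongrightarrow> l z v) (at_right 0)" for v
  proof -
    have "AE z in lborel. upper_dderiv g v z = l z v"
      using AE_upper_dderiv_sum[OF lip, of Basis "\<lambda>i. v \<bullet> i" "\<lambda>i. i"]
      by (simp add: euclidean_representation l_def)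
    with AE_tendsto_upper_dderiv[OF lip, of v] show ?thesis by eventually_elim simp
  qed
  then have "AE z in lborel. \<forall>v\<in>Q. ((\<lambda>t. (g (z + t *\<^sub>R v) - g z) / t) \<longlongrightarrow> l z v) (at_right 0)"
    using Q(1) by (simp add: AE_ball_countable)
  then show ?thesis
  proof eventually_elim
    case (elim z)
    define K where "K = (\<Sum>i\<in>Basis. \<bar>upper_dderiv g i z\<bar>)"
    have "0 \<le> K" unfolding K_def by (rule sum_nonneg) simp
    have l_diff: "\<bar>l z v - l z w\<bar> \<le> K * norm (v - w)" for v w
    proof -
      have "l z v - l z w = (\<Sum>i\<in>Basis. ((v - w) \<bullet> i) * upper_dderiv g i z)"
        by (simp add: l_def inner_diff_left left_diff_distrib sum_subtractf)
      also have "\<bar>\<dots>\<bar> \<le> (\<Sum>i\<in>Basis. norm (v - w) * \<bar>upper_dderiv g i z\<bar>)"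
        by (rule order_trans[OF sum_abs]) (intro sum_mono, simp add: abs_mult mult_right_mono Basis_le_norm)
      also have "\<dots> = K * norm (v - w)"
        by (simp add: K_def sum_distrib_left[symmetric] mult.commute)
      finally show ?thesis .
    qed
    show ?case
    proof (rule allI, rule tendstoI)
      fix w and e :: real assume "0 < e"
      \<comment> \<open>\<open>L\<close> and \<open>K\<close> are Lipschitz constants, in the direction, of the quotients and of the limit.\<close>
      define C where "C = L + K + 1"
      have "0 < C" using \<open>0 \<le> L\<close> \<open>0 \<le> K\<close> by (simp add: C_def)
      define d where "d = e / (2 * C)"
      have d: "0 < d" using \<open>0 < e\<close> \<open>0 < C\<close> by (simp add: d_def)
      have d_le: "(L + K) * d < e / 2"
      proof -
        have "C * d = e / 2" using \<open>0 < C\<close> by (simp add: d_def)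
        then show ?thesis using d by (simp add: C_def distrib_right)
      qed
      obtain v where v: "v \<in> Q" "norm (v - w) < d"
        using Q(2)[of "ball w d"] d by (auto simp: dist_norm norm_minus_commute)
      have "\<forall>\<^sub>F t in at_right 0. dist ((g (z + t *\<^sub>R v) - g z) / t) (l z v) < e / 2"
        using elim v(1) \<open>0 < e\<close> by (intro tendstoD) auto
      moreover have "\<forall>\<^sub>F t in at_right (0::real). 0 < t" by (rule eventually_at_right_less)
      ultimately show "\<forall>\<^sub>F t in at_right 0.
          dist ((g (z + t *\<^sub>R w) - g z) / t) (\<Sum>i\<in>Basis. w \<bullet> i * upper_dderiv g i z) < e"
      proof eventually_elim
        case (elim t)
        have "(z + t *\<^sub>R w) - (z + t *\<^sub>R v) = t *\<^sub>R (w - v)" by (simp add: scaleR_diff_right)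
        then have "norm ((z + t *\<^sub>R w) - (z + t *\<^sub>R v)) = t * norm (v - w)"
          using elim(2) by (simp only: norm_scaleR norm_minus_commute[of w v])
        then have "\<bar>g (z + t *\<^sub>R w) - g (z + t *\<^sub>R v)\<bar> \<le> L * (t * norm (v - w))"
          using lipschitz_on_normD[OF lip, of "z + t *\<^sub>R w" "z + t *\<^sub>R v"] by simp
        then have "\<bar>g (z + t *\<^sub>R w) - g (z + t *\<^sub>R v)\<bar> / t \<le> L * norm (v - w)"
          using elim(2) by (simp add: pos_divide_le_eq mult_ac)
        then have "\<bar>(g (z + t *\<^sub>R w) - g z) / t - (g (z + t *\<^sub>R v) - g z) / t\<bar> \<le> L * norm (v - w)"
          using elim(2) by (simp add: diff_divide_distrib[symmetric] abs_divide)
        moreover have "\<bar>(g (z + t *\<^sub>R v) - g z) / t - l z v\<bar> < e / 2"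
          using elim(1) by (simp add: dist_real_def)
        moreover have "(L + K) * norm (v - w) \<le> (L + K) * d"
          using v(2) \<open>0 \<le> L\<close> \<open>0 \<le> K\<close> by (intro mult_left_mono) auto
        then have "L * norm (v - w) + K * norm (v - w) < e / 2"
          using d_le by (simp add: distrib_right)
        moreover note l_diff[of v w]
        ultimately have "\<bar>(g (z + t *\<^sub>R w) - g z) / t - l z w\<bar> < e" by linarith
        then show ?case by (simp add: l_def dist_real_def)
      qed
    qed
  qed
qed

section \<open>Measurable bases of the tangent spaces\<close>

text \<open>The height \<open>F\<close> over the graph is continuous and increases with slope one in the direction \<open>e\<close>, so
that points of height zero are limits of points of positive height, whereas points of
negative height have a neighbourhood that avoids \<open>\<Omega>\<close>.\<close>

lemma frontier_chart:
  fixes \<Omega> :: "'a::euclidean_space set"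
  assumes "open \<Omega>" and e: "norm e = 1" and cont: "continuous_on {z. e \<bullet> z = 0} \<gamma>"
    and chart: "\<Omega> \<inter> ball x0 r = {y \<in> ball x0 r. \<gamma> (y - (e \<bullet> y) *\<^sub>R e) < e \<bullet> y}"
  shows "frontier \<Omega> \<inter> ball x0 r = {y \<in> ball x0 r. \<gamma> (y - (e \<bullet> y) *\<^sub>R e) = e \<bullet> y}"
proof -
  define F where "F y = e \<bullet> y - \<gamma> (y - (e \<bullet> y) *\<^sub>R e)" for y
  have ee: "e \<bullet> e = 1" using e by (simp add: dot_square_norm)
  have in_H: "(\<lambda>y. y - (e \<bullet> y) *\<^sub>R e) ` UNIV \<subseteq> {z. e \<bullet> z = 0}"
  proof (rule image_subsetI)
    fix y
    show "y - (e \<bullet> y) *\<^sub>R e \<in> {z. e \<bullet> z = 0}"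
      by (simp add: inner_diff_right ee)
  qed
  have proj_cont: "continuous_on UNIV (\<lambda>y. y - (e \<bullet> y) *\<^sub>R e)"
    by (intro continuous_on_diff continuous_on_scaleR continuous_on_inner continuous_on_const continuous_on_id)
  have F_cont: "continuous_on UNIV F"
    unfolding F_def
    by (rule continuous_on_diff[OF _ continuous_on_compose2[OF cont proj_cont in_H]])
      (rule continuous_on_inner[OF continuous_on_const continuous_on_id])
  have \<Omega>: "y \<in> \<Omega> \<longleftrightarrow> 0 < F y" if "y \<in> ball x0 r" for y
  proof -
    have "y \<in> \<Omega> \<inter> ball x0 r \<longleftrightarrow> y \<in> {y \<in> ball x0 r. \<gamma> (y - (e \<bullet> y) *\<^sub>R e) < e \<bullet> y}"
      by (simp only: chart)
    then show ?thesis using that by (simp add: F_def)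
  qed
  have "y \<in> frontier \<Omega> \<longleftrightarrow> F y = 0" if y: "y \<in> ball x0 r" for y
  proof
    assume "y \<in> frontier \<Omega>"
    then have "y \<in> closure \<Omega>" "y \<notin> \<Omega>"
      using \<open>open \<Omega>\<close> by (simp_all add: frontier_def interior_open)
    have "\<not> F y < 0"
    proof
      assume "F y < 0"
      have O: "open ({y. F y < 0} \<inter> ball x0 r)"
        using open_Collect_less[OF F_cont continuous_on_const] by (intro open_Int) auto
      have "({y. F y < 0} \<inter> ball x0 r) \<inter> \<Omega> = {}" using \<Omega> by (simp add: disjoint_iff)
      then have "({y. F y < 0} \<inter> ball x0 r) \<inter> closure \<Omega> = {}"
        unfolding open_Int_closure_eq_empty[OF O] .
      moreover have "y \<in> ({y. F y < 0} \<inter> ball x0 r) \<inter> closure \<Omega>"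
        using \<open>F y < 0\<close> y \<open>y \<in> closure \<Omega>\<close> by simp
      ultimately show False by simp
    qed
    then show "F y = 0" using \<Omega>[OF y] \<open>y \<notin> \<Omega>\<close> by simp
  next
    assume F0: "F y = 0"
    then have "y \<notin> \<Omega>" using \<Omega>[OF y] by simp
    moreover have "y \<in> closure \<Omega>"
      unfolding closure_approachable
    proof (intro allI impI)
      fix \<epsilon> :: real assume "0 < \<epsilon>"
      obtain \<rho> where \<rho>: "0 < \<rho>" "ball y \<rho> \<subseteq> ball x0 r" by (rule openE[OF open_ball y])
      define s where "s = min \<epsilon> \<rho> / 2"
      have s: "0 < s" "s < \<epsilon>" "s < \<rho>" using \<open>0 < \<epsilon>\<close> \<rho>(1) by (auto simp: s_def)
      have dist: "dist (y + s *\<^sub>R e) y = s" using s e by (simp add: dist_norm)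
      have "y + s *\<^sub>R e \<in> ball y \<rho>" using dist s by (simp add: dist_commute)
      then have b: "y + s *\<^sub>R e \<in> ball x0 r" using \<rho>(2) by blast
      have "F (y + s *\<^sub>R e) = F y + s"
        by (simp add: F_def inner_add_right ee algebra_simps)
      then have "y + s *\<^sub>R e \<in> \<Omega>" using \<Omega>[OF b] F0 s by simp
      then show "\<exists>x\<in>\<Omega>. dist x y < \<epsilon>" using dist s by (intro bexI[of _ "y + s *\<^sub>R e"]) auto
    qed
    ultimately show "y \<in> frontier \<Omega>" using \<open>open \<Omega>\<close> by (simp add: frontier_def interior_open)
  qed
  then show ?thesis by (auto simp: F_def)
qed

text \<open>Isometric coordinates \<open>T\<close> on the hyperplane orthogonal to \<open>e\<close>, together with the orthogonal
projection to the hyperplane, expressed in these coordinates as \<open>P\<close>.\<close>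

lemma hyperplane_coordinates:
  fixes e :: "'a::euclidean_space"
  assumes e: "norm e = 1" and dim: "DIM('b::euclidean_space) = DIM('a) - 1"
  obtains T :: "'b::euclidean_space \<Rightarrow> 'a" and P :: "'a \<Rightarrow> 'b" where
    "linear T" "linear P" "\<And>w. norm (T w) = norm w" "\<And>w. e \<bullet> T w = 0"
    "\<And>w. P (T w) = w" "P e = 0" "\<And>y. T (P y) = y - (e \<bullet> y) *\<^sub>R e"
proof -
  let ?H = "{z. e \<bullet> z = 0}"
  have ee: "e \<bullet> e = 1" using e by (simp add: dot_square_norm)
  have "e \<noteq> 0" using e by auto
  have "dim (UNIV :: 'b set) = dim ?H"
    using dim dim_hyperplane[OF \<open>e \<noteq> 0\<close>] by simp
  then obtain T :: "'b \<Rightarrow> 'a" and S where T: "linear T" "linear S" "T ` UNIV = ?H" "S ` ?H = UNIV"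
      "\<And>x. x \<in> UNIV \<Longrightarrow> norm (T x) = norm x" "\<And>x. x \<in> ?H \<Longrightarrow> norm (S x) = norm x"
      "\<And>x. x \<in> UNIV \<Longrightarrow> S (T x) = x" "\<And>x. x \<in> ?H \<Longrightarrow> T (S x) = x"
    by (rule isometries_subspaces[OF subspace_UNIV subspace_hyperplane]) (rule that)
  define P where "P y = S (y - (e \<bullet> y) *\<^sub>R e)" for y
  have eT: "e \<bullet> T w = 0" for w using T(3) by blast
  show thesis
  proof
    show "linear P"
      unfolding P_def by (rule linearI)
        (simp_all add: inner_add_right scaleR_left_distrib linear_diff[OF T(2)] linear_add[OF T(2)]
          linear_cmul[OF T(2)] algebra_simps)
    show "P (T w) = w" for w by (simp add: P_def eT T(7))
    show "P e = 0" by (simp add: P_def ee linear_0[OF T(2)])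
    show "T (P y) = y - (e \<bullet> y) *\<^sub>R e" for y
      unfolding P_def by (rule T(8)) (simp add: inner_diff_right ee)
  qed (use T eT in auto)
qed

text \<open>If \<open>y n\<close> on the graph tends to \<open>x\<close> such that the rescaled differences converge to \<open>v\<close>, then the
rescaled differences of \<open>P (y n)\<close> form directions \<open>w n\<close> that converge to \<open>P v\<close> without being
constant. Since \<open>h\<close> is Lipschitz, the difference quotient along \<open>w n\<close> differs from the one along \<open>P v\<close>
by at most \<open>L * norm (w n - P v)\<close>; this is why derivatives along fixed directions are enough.
Conversely, lifting the ray from \<open>P x\<close> in the direction \<open>w\<close> to the graph realizes every vector of
the right-hand side.\<close>

lemma tangent_cone_graph:
  fixes T :: "'b::euclidean_space \<Rightarrow> 'a::euclidean_space" and h :: "'b \<Rightarrow> real"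
  assumes T: "linear T" and P: "linear P" and e: "norm e = 1"
    and coords: "\<And>w. e \<bullet> T w = 0" "\<And>w. P (T w) = w" "P e = 0" "\<And>y. T (P y) = y - (e \<bullet> y) *\<^sub>R e"
    and lip: "L-lipschitz_on UNIV h"
    and S: "S \<inter> ball x0 r = {y \<in> ball x0 r. h (P y) = e \<bullet> y}" and x: "x \<in> S" "x \<in> ball x0 r"
    and deriv: "\<And>w. ((\<lambda>t. (h (P x + t *\<^sub>R w) - h (P x)) / t) \<longlongrightarrow> l w) (at_right 0)"
  shows "tangent_cone S x = range (\<lambda>w. T w + l w *\<^sub>R e)"
proof (intro equalityI subsetI)
  have ee: "e \<bullet> e = 1" using e by (simp add: dot_square_norm)
  have S_iff: "z \<in> S \<longleftrightarrow> h (P z) = e \<bullet> z" if "z \<in> ball x0 r" for z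
  proof -
    have "z \<in> S \<inter> ball x0 r \<longleftrightarrow> z \<in> {y \<in> ball x0 r. h (P y) = e \<bullet> y}" by (simp only: S)
    then show ?thesis using that by simp
  qed
  have hx: "h (P x) = e \<bullet> x" using S_iff x by simp
  have bT: "bounded_linear T" and bP: "bounded_linear P" using T P by (simp_all add: linear_linear)
  {
    fix v assume "v \<in> tangent_cone S x"
    then obtain y t where y: "\<And>n. y n \<in> S" and t: "\<And>n. 0 < t n" "t \<longlonglongrightarrow> 0"
      and lim: "(\<lambda>n. (y n - x) /\<^sub>R t n) \<longlonglongrightarrow> v"
      unfolding tangent_cone_def by blast
    have "(\<lambda>n. x + t n *\<^sub>R ((y n - x) /\<^sub>R t n)) \<longlonglongrightarrow> x + 0 *\<^sub>R v"
      by (intro tendsto_intros t lim)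
    moreover have "x + t n *\<^sub>R ((y n - x) /\<^sub>R t n) = y n" for n
      using t(1)[of n] by simp
    ultimately have "y \<longlonglongrightarrow> x" by simp
    then have "\<forall>\<^sub>F n in sequentially. y n \<in> ball x0 r"
      by (rule topological_tendstoD[OF _ open_ball x(2)])
    then have hy: "\<forall>\<^sub>F n in sequentially. h (P (y n)) = e \<bullet> y n"
    proof eventually_elim
      case (elim n)
      then show ?case using S_iff[of "y n"] y[of n] by simp
    qed
    define w where "w n = P ((y n - x) /\<^sub>R t n)" for n
    have w_lim: "w \<longlonglongrightarrow> P v"
      unfolding w_def by (rule bounded_linear.tendsto[OF bP lim])
    have tf: "filterlim t (at_right 0) sequentially"
      using t by (intro tendsto_imp_filterlim_at_right) auto
    have lim1: "(\<lambda>n. (h (P x + t n *\<^sub>R P v) - h (P x)) / t n) \<longlonglongrightarrow> l (P v)"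
      by (rule filterlim_compose[OF deriv tf])
    have "(\<lambda>n. (h (P x + t n *\<^sub>R w n) - h (P x)) / t n - (h (P x + t n *\<^sub>R P v) - h (P x)) / t n) \<longlonglongrightarrow> 0"
    proof (rule Lim_null_comparison)
      have "(\<lambda>n. L * norm (w n - P v)) \<longlonglongrightarrow> L * norm (P v - P v)"
        by (intro tendsto_intros w_lim)
      then show "(\<lambda>n. L * norm (w n - P v)) \<longlonglongrightarrow> 0" by simp
      show "\<forall>\<^sub>F n in sequentially. norm ((h (P x + t n *\<^sub>R w n) - h (P x)) / t n -
          (h (P x + t n *\<^sub>R P v) - h (P x)) / t n) \<le> L * norm (w n - P v)"
      proof (intro always_eventually allI)
        fix n
        have "\<bar>h (P x + t n *\<^sub>R P v + t n *\<^sub>R (w n - P v)) - h (P x + t n *\<^sub>R P v)\<bar> / t n \<le> L * norm (w n - P v)"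
          using lipschitz_on_normD[OF lip, of "P x + t n *\<^sub>R P v + t n *\<^sub>R (w n - P v)" "P x + t n *\<^sub>R P v"] t(1)[of n]
          by (simp add: pos_divide_le_eq mult_ac)
        then show "norm ((h (P x + t n *\<^sub>R w n) - h (P x)) / t n -
          (h (P x + t n *\<^sub>R P v) - h (P x)) / t n) \<le> L * norm (w n - P v)"
          using t(1)[of n] by (simp add: scaleR_diff_right diff_divide_distrib[symmetric] abs_divide)
      qed
    qed
    from tendsto_add[OF this lim1]
    have lim2: "(\<lambda>n. (h (P x + t n *\<^sub>R w n) - h (P x)) / t n) \<longlonglongrightarrow> l (P v)" by simp
    have "\<forall>\<^sub>F n in sequentially. (h (P x + t n *\<^sub>R w n) - h (P x)) / t n = e \<bullet> ((y n - x) /\<^sub>R t n)"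
      using hy
    proof eventually_elim
      case (elim n)
      have "P x + t n *\<^sub>R w n = P (y n)"
        using t(1)[of n] by (simp add: w_def linear_diff[OF P] linear_cmul[OF P])
      then show ?case using elim hx by (simp add: inner_diff_right divide_inverse mult.commute)
    qed
    with lim2 have "(\<lambda>n. e \<bullet> ((y n - x) /\<^sub>R t n)) \<longlonglongrightarrow> l (P v)"
      by (rule Lim_transform_eventually)
    moreover have "(\<lambda>n. e \<bullet> ((y n - x) /\<^sub>R t n)) \<longlonglongrightarrow> e \<bullet> v" by (intro tendsto_intros lim)
    ultimately have "e \<bullet> v = l (P v)" by (rule LIMSEQ_unique[rotated])
    then have "v = T (P v) + l (P v) *\<^sub>R e" by (simp add: coords(4))
    then show "v \<in> range (\<lambda>w. T w + l w *\<^sub>R e)" by blast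
  next
    fix v assume "v \<in> range (\<lambda>w. T w + l w *\<^sub>R e)"
    then obtain w where v: "v = T w + l w *\<^sub>R e" by blast
    define t where "t n = 1 / real (Suc n)" for n
    have t: "0 < t n" for n by (simp add: t_def)
    have t0: "t \<longlonglongrightarrow> 0"
      using LIMSEQ_inverse_real_of_nat by (simp add: t_def[abs_def] inverse_eq_divide)
    have tf: "filterlim t (at_right 0) sequentially"
      using t t0 by (intro tendsto_imp_filterlim_at_right) auto
    define y where "y n = T (P x + t n *\<^sub>R w) + h (P x + t n *\<^sub>R w) *\<^sub>R e" for n
    have yx: "(y n - x) /\<^sub>R t n = T w + ((h (P x + t n *\<^sub>R w) - h (P x)) / t n) *\<^sub>R e" for n
    proof -
      have "y n - x = t n *\<^sub>R T w + (h (P x + t n *\<^sub>R w) - h (P x)) *\<^sub>R e"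
        by (simp add: y_def linear_add[OF T] linear_cmul[OF T] coords(4) hx algebra_simps)
      then show ?thesis using t[of n] by (simp add: scaleR_right_distrib divide_inverse mult.commute)
    qed
    have lim: "(\<lambda>n. (y n - x) /\<^sub>R t n) \<longlonglongrightarrow> v"
      unfolding yx v by (intro tendsto_intros filterlim_compose[OF deriv tf])
    have "(\<lambda>n. x + t n *\<^sub>R ((y n - x) /\<^sub>R t n)) \<longlonglongrightarrow> x + 0 *\<^sub>R v"
      by (intro tendsto_intros t0 lim)
    moreover have "x + t n *\<^sub>R ((y n - x) /\<^sub>R t n) = y n" for n
      using t[of n] by simp
    ultimately have "y \<longlonglongrightarrow> x" by simp
    then have "\<forall>\<^sub>F n in sequentially. y n \<in> ball x0 r"
      by (rule topological_tendstoD[OF _ open_ball x(2)])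
    then obtain N where N: "\<And>n. N \<le> n \<Longrightarrow> y n \<in> ball x0 r"
      by (auto simp: eventually_sequentially)
    have "y n \<in> S" if "N \<le> n" for n
    proof -
      have "h (P (y n)) = e \<bullet> y n"
        by (simp add: y_def linear_add[OF P] linear_cmul[OF P] coords inner_add_right ee)
      then show ?thesis using S_iff[OF N[OF that]] by simp
    qed
    then have "\<forall>n. y (n + N) \<in> S \<and> 0 < t (n + N)" using t by simp
    moreover have "(\<lambda>n. t (n + N)) \<longlonglongrightarrow> 0" by (rule LIMSEQ_ignore_initial_segment[OF t0])
    moreover have "(\<lambda>n. (y (n + N) - x) /\<^sub>R t (n + N)) \<longlonglongrightarrow> v" by (rule LIMSEQ_ignore_initial_segment[OF lim])
    ultimately show "v \<in> tangent_cone S x"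
      unfolding tangent_cone_def
      by (intro CollectI exI[of _ "\<lambda>n. y (n + N)"] exI[of _ "\<lambda>n. t (n + N)"] conjI)
  }
qed

lemma is_basis_linear_injective_image:
  fixes R :: "real^'m \<Rightarrow> 'a::euclidean_space"
  assumes "linear R" "inj R"
  shows "is_basis (\<lambda>j. R (axis j 1)) (range R)"
  unfolding is_basis_def
proof (intro conjI)
  have r: "range (\<lambda>j. R (axis j 1)) = R ` Basis"
    by (auto simp: Basis_vec_def)
  show "inj (\<lambda>j. R (axis j 1))"
  proof (rule injI)
    fix i j :: 'm assume "R (axis i 1) = R (axis j 1)"
    then have "axis i (1::real) = axis j 1" by (rule injD[OF assms(2)])
    then show "i = j" by (simp add: axis_eq_axis)
  qed
  show "independent (range (\<lambda>j. R (axis j 1)))"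
    unfolding r by (rule linear_independent_injective_image[OF assms(1) independent_Basis inj_on_subset[OF assms(2) subset_UNIV]])
  show "span (range (\<lambda>j. R (axis j 1))) = range R"
    unfolding r by (simp add: linear_span_image[OF assms(1)])
qed

text \<open>In a chart, the basis consists of the lifts of the standard basis vectors to the tangent plane. It
is Borel measurable everywhere, since its coefficients are upper derivatives, and it spans the tangent
space at each point whose projection lies outside the null set \<open>N0\<close>.\<close>

lemma local_measurable_tangent_basis:
  fixes \<Omega> :: "(real^'d) set"
  assumes card: "CARD('m::finite) = CARD('d) - 1" and "open \<Omega>" and lb: "lipschitz_boundary \<Omega>"
    and x0: "x0 \<in> frontier \<Omega>"
  shows "\<exists>r>0. \<exists>(v :: 'm \<Rightarrow> real^'d \<Rightarrow> real^'d) N. (\<forall>j. v j \<in> borel_measurable borel) \<and>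
    hausdorff_outer (CARD('d) - 1) N = 0 \<and>
    (\<forall>x \<in> frontier \<Omega> \<inter> ball x0 r - N. is_basis (\<lambda>j. v j x) (tangent_space \<Omega> x))"
proof -
  obtain r e L and \<gamma> :: "real^'d \<Rightarrow> real" where r: "0 < r" and e: "norm e = 1"
    and lip: "L-lipschitz_on {z. e \<bullet> z = 0} \<gamma>"
    and chart: "\<Omega> \<inter> ball x0 r = {y \<in> ball x0 r. \<gamma> (y - (e \<bullet> y) *\<^sub>R e) < e \<bullet> y}"
    using lb x0 unfolding lipschitz_boundary_def by blast
  have "DIM(real^'m) = DIM(real^'d) - 1" using card by simp
  then obtain T :: "real^'m \<Rightarrow> real^'d" and P :: "real^'d \<Rightarrow> real^'m" where
    T: "linear T" and P: "linear P" and normT: "\<And>w. norm (T w) = norm w"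
    and coords: "\<And>w. e \<bullet> T w = 0" "\<And>w. P (T w) = w" "P e = 0" "\<And>y. T (P y) = y - (e \<bullet> y) *\<^sub>R e"
    by (rule hyperplane_coordinates[OF e]) (rule that)
  define h where "h w = \<gamma> (T w)" for w
  have "0 \<le> L" using lip by (rule lipschitz_on_nonneg)
  have h_lip: "L-lipschitz_on UNIV h"
  proof (rule lipschitz_onI)
    fix z w :: "real^'m"
    show "dist (h z) (h w) \<le> L * dist z w"
      unfolding h_def using lipschitz_onD[OF lip, of "T z" "T w"] coords(1) normT[of "z - w"]
      by (simp add: dist_norm linear_diff[OF T])
  qed fact
  have front: "frontier \<Omega> \<inter> ball x0 r = {y \<in> ball x0 r. h (P y) = e \<bullet> y}"
    using frontier_chart[OF \<open>open \<Omega>\<close> e lipschitz_on_continuous_on[OF lip] chart]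
    by (simp add: h_def coords(4))
  define l where "l z w = (\<Sum>i\<in>Basis. (w \<bullet> i) * upper_dderiv h i z)" for z w :: "real^'m"
  have "AE z in lborel. \<forall>w. ((\<lambda>t. (h (z + t *\<^sub>R w) - h z) / t) \<longlongrightarrow> l z w) (at_right 0)"
    unfolding l_def by (rule AE_directional_derivatives_linear[OF h_lip])
  then obtain N0 where N0': "\<And>z. z \<in> space lborel - N0 \<Longrightarrow>
      \<forall>w. ((\<lambda>t. (h (z + t *\<^sub>R w) - h z) / t) \<longlongrightarrow> l z w) (at_right 0)"
      and N0: "N0 \<in> null_sets lborel"
    by (rule AE_E3) (rule that)
  have deriv: "((\<lambda>t. (h (z + t *\<^sub>R w) - h z) / t) \<longlongrightarrow> l z w) (at_right 0)" if "z \<notin> N0" for z w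
    using N0'[of z] that by simp
  define G where "G z = T z + h z *\<^sub>R e" for z
  have G_lip: "(1 + L)-lipschitz_on UNIV G"
  proof (rule lipschitz_onI)
    fix z w :: "real^'m"
    have "G z - G w = T (z - w) + (h z - h w) *\<^sub>R e"
      by (simp add: G_def linear_diff[OF T] scaleR_left_diff_distrib)
    then have "norm (G z - G w) \<le> norm (T (z - w)) + norm ((h z - h w) *\<^sub>R e)"
      by (simp only: norm_triangle_ineq)
    also have "\<dots> \<le> norm (z - w) + L * norm (z - w)"
      using lipschitz_on_normD[OF h_lip, of z w] by (simp add: normT e)
    finally show "dist (G z) (G w) \<le> (1 + L) * dist z w" by (simp add: dist_norm distrib_right)
  qed (use \<open>0 \<le> L\<close> in simp)
  define v where "v j x = T (axis j 1) + upper_dderiv h (axis j 1) (P x) *\<^sub>R e" for j x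
  have "hausdorff_outer (CARD('d) - 1) (G ` N0) = 0"
    using hausdorff_outer_lipschitz_image_null[OF G_lip N0] card by simp
  moreover have "v j \<in> borel_measurable borel" for j
  proof -
    have "P \<in> borel_measurable borel"
      using P by (intro borel_measurable_continuous_onI) (simp add: linear_continuous_on linear_linear)
    then have "(\<lambda>x. upper_dderiv h (axis j 1) (P x)) \<in> borel_measurable borel"
      by (rule measurable_compose[OF _ borel_measurable_upper_dderiv[OF h_lip]])
    then show ?thesis unfolding v_def by measurable
  qed
  moreover have "is_basis (\<lambda>j. v j x) (tangent_space \<Omega> x)"
    if x: "x \<in> frontier \<Omega> \<inter> ball x0 r - G ` N0" for x
  proof -
    have "x = G (P x)" using x front by (auto simp: G_def coords(4))
    then have Px: "P x \<notin> N0" using x by blast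
    let ?R = "\<lambda>w. T w + l (P x) w *\<^sub>R e"
    have "tangent_space \<Omega> x = range ?R"
      unfolding tangent_space_def
      using x by (intro tangent_cone_graph[OF T P e coords h_lip front] deriv Px) auto
    moreover have "linear ?R"
      by (rule linearI) (simp_all add: l_def linear_add[OF T] linear_cmul[OF T] inner_add_left
          distrib_right sum.distrib scaleR_left_distrib scaleR_right_distrib sum_distrib_left mult.assoc)
    moreover have "inj ?R"
    proof (rule injI)
      fix a b assume "?R a = ?R b"
      then have "P (?R a) = P (?R b)" by simp
      then show "a = b" by (simp add: linear_add[OF P] linear_cmul[OF P] coords)
    qed
    moreover have "l (P x) (axis j 1) = upper_dderiv h (axis j 1) (P x)" for j
    proof -
      have "axis j 1 \<in> (Basis :: (real^'m) set)" by (simp add: axis_in_Basis_iff)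
      then have "l (P x) (axis j 1) = (\<Sum>i\<in>Basis. if i = axis j 1 then upper_dderiv h i (P x) else 0)"
        unfolding l_def by (intro sum.cong) (auto simp: inner_Basis)
      then show ?thesis using \<open>axis j 1 \<in> Basis\<close> by simp
    qed
    ultimately show ?thesis
      using is_basis_linear_injective_image[of ?R] by (simp add: v_def)
  qed
  ultimately show ?thesis using r by blast
qed

text \<open>The bases of finitely many charts that cover the boundary are glued by using, at each point, the
first chart that contains it.\<close>

lemma exists_measurable_tangent_basis:
  fixes \<Omega> :: "(real^'d) set"
  assumes card: "CARD('m::finite) = CARD('d) - 1" and "bounded \<Omega>" "open \<Omega>" "lipschitz_boundary \<Omega>"
  shows "\<exists>v :: 'm \<Rightarrow> real^'d \<Rightarrow> real^'d. measurable_tangent_basis \<Omega> v"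
proof -
  define ok where "ok x0 r v N \<longleftrightarrow> 0 < r \<and> (\<forall>j. v j \<in> borel_measurable borel) \<and>
    hausdorff_outer (CARD('d) - 1) N = 0 \<and>
    (\<forall>x \<in> frontier \<Omega> \<inter> ball x0 r - N. is_basis (\<lambda>j. v j x) (tangent_space \<Omega> x))"
    for x0 r and v :: "'m \<Rightarrow> real^'d \<Rightarrow> real^'d" and N
  have "\<forall>x0\<in>frontier \<Omega>. \<exists>q. ok x0 (fst q) (fst (snd q)) (snd (snd q))"
  proof
    fix x0 assume "x0 \<in> frontier \<Omega>"
    from local_measurable_tangent_basis[OF card assms(3,4) this]
    obtain \<rho> u M where "ok x0 \<rho> u M" unfolding ok_def by auto
    then show "\<exists>q. ok x0 (fst q) (fst (snd q)) (snd (snd q))"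
      by (intro exI[of _ "(\<rho>, u, M)"]) simp
  qed
  from bchoice[OF this] obtain q where q: "\<forall>x0\<in>frontier \<Omega>. ok x0 (fst (q x0)) (fst (snd (q x0))) (snd (snd (q x0)))"
    by (rule exE)
  define r v N where "r x0 = fst (q x0)" and "v x0 = fst (snd (q x0))" and "N x0 = snd (snd (q x0))" for x0
  have *: "ok x0 (r x0) (v x0) (N x0)" if "x0 \<in> frontier \<Omega>" for x0
    using bspec[OF q that] by (simp only: r_def v_def N_def)
  have r: "\<And>x0. x0 \<in> frontier \<Omega> \<Longrightarrow> 0 < r x0"
    and v: "\<And>x0 j. x0 \<in> frontier \<Omega> \<Longrightarrow> v x0 j \<in> borel_measurable borel"
    and N: "\<And>x0. x0 \<in> frontier \<Omega> \<Longrightarrow> hausdorff_outer (CARD('d) - 1) (N x0) = 0"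
    and basis: "\<And>x0 x. x0 \<in> frontier \<Omega> \<Longrightarrow> x \<in> frontier \<Omega> \<Longrightarrow> x \<in> ball x0 (r x0) \<Longrightarrow> x \<notin> N x0 \<Longrightarrow>
      is_basis (\<lambda>j. v x0 j x) (tangent_space \<Omega> x)"
    using * unfolding ok_def by simp_all
  show ?thesis
  proof (cases "frontier \<Omega> = {}")
    case True
    then show ?thesis by (intro exI[of _ "\<lambda>_ _. 0"]) (simp add: measurable_tangent_basis_def)
  next
    case False
    have "compact (frontier \<Omega>)" using \<open>bounded \<Omega>\<close> by (rule compact_frontier_bounded)
    moreover have "frontier \<Omega> \<subseteq> (\<Union>c\<in>frontier \<Omega>. ball c (r c))"
      using r by (meson UN_I centre_in_ball subsetI)
    ultimately obtain D where D: "D \<subseteq> frontier \<Omega>" "finite D" "frontier \<Omega> \<subseteq> (\<Union>c\<in>D. ball c (r c))"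
      by (rule compactE_image[OF _ open_ball])
    have "D \<noteq> {}" using D(3) False by auto
    define p where "p = from_nat_into D"
    have p: "p n \<in> frontier \<Omega>" for n
      unfolding p_def by (rule subsetD[OF D(1) from_nat_into[OF \<open>D \<noteq> {}\<close>]])
    have p_cover: "\<exists>n. x \<in> ball (p n) (r (p n))" if xf: "x \<in> frontier \<Omega>" for x
    proof -
      have "x \<in> (\<Union>c\<in>D. ball c (r c))" by (rule subsetD[OF D(3) xf])
      then obtain c where "c \<in> D" "x \<in> ball c (r c)" by (rule UN_E)
      moreover obtain n where "p n = c"
        unfolding p_def using from_nat_into_surj[OF countable_finite[OF D(2)] \<open>c \<in> D\<close>] by (rule exE)
      ultimately show ?thesis by (intro exI[of _ n]) simp
    qed
    define i where "i x = (LEAST n. x \<in> ball (p n) (r (p n)))" for x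
    have i_meas: "i \<in> measurable borel (count_space UNIV)"
      unfolding i_def
    proof (rule measurable_Least)
      fix n
      have "{x \<in> space borel. x \<in> ball (p n) (r (p n))} = ball (p n) (r (p n))" by auto
      then show "Measurable.pred borel (\<lambda>x. x \<in> ball (p n) (r (p n)))"
        by (simp only: pred_def borel_open[OF open_ball])
    qed
    define b where "b j x = v (p (i x)) j x" for j x
    have b_meas: "b j \<in> borel_measurable borel" for j
      unfolding b_def by (rule measurable_compose_countable[OF v[OF p] i_meas])
    have "measurable_tangent_basis \<Omega> b"
      unfolding measurable_tangent_basis_def
    proof (intro conjI allI)
      show "b j \<in> borel_measurable (restrict_space surface_measure (frontier \<Omega>))" for j
        by (rule measurable_restrict_space1[OF borel_measurable_hausdorff[OF b_meas]])
      show "AE x\<in>frontier \<Omega> in surface_measure. is_basis (\<lambda>j. b j x) (tangent_space \<Omega> x)"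
      proof (rule hausdorff_null_AE)
        have "hausdorff_outer (CARD('d) - 1) (\<Union>n. N (p n)) \<le> (\<Sum>n. hausdorff_outer (CARD('d) - 1) (N (p n)))"
          by (rule hausdorff_outer_UN)
        then show "hausdorff_outer (CARD('d) - 1) (\<Union>n. N (p n)) = 0" using N[OF p] by simp
        fix x assume x: "x \<notin> (\<Union>n. N (p n))"
        show "x \<in> frontier \<Omega> \<longrightarrow> is_basis (\<lambda>j. b j x) (tangent_space \<Omega> x)"
        proof
          assume xf: "x \<in> frontier \<Omega>"
          have "x \<in> ball (p (i x)) (r (p (i x)))"
            unfolding i_def by (rule LeastI_ex[OF p_cover[OF xf]])
          then show "is_basis (\<lambda>j. b j x) (tangent_space \<Omega> x)"
            unfolding b_def using x by (intro basis p xf) auto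
        qed
      qed
    qed
    then show ?thesis by blast
  qed
qed

section \<open>Polyconvexity and tangential polyconvexity\<close>

lemma restr_lin_props:
  fixes A :: "'a::euclidean_space \<Rightarrow>\<^sub>L 'b::real_normed_vector"
  assumes "subspace V"
  shows restr_lin_in: "restr_lin V A \<in> lin_maps V"
    and restr_lin_apply: "v \<in> V \<Longrightarrow> blinfun_apply (restr_lin V A) v = blinfun_apply A v"
  using theI'[OF ex1_restr_lin[OF assms, of A]] unfolding restr_lin_def by simp_all

lemma restr_lin_id:
  fixes F :: "'a::euclidean_space \<Rightarrow>\<^sub>L 'b::real_normed_vector"
  assumes "subspace V" "F \<in> lin_maps V"
  shows "restr_lin V F = F"
  unfolding restr_lin_def
  by (rule the1_equality[OF ex1_restr_lin[OF assms(1)]]) (use assms(2) in simp)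

lemma lin_maps_UNIV: "lin_maps UNIV = UNIV"
proof -
  have "w = 0" if "w \<in> orthogonal_comp UNIV" for w :: "'a::euclidean_space"
    using that by (simp add: orthogonal_comp_def orthogonal_self[symmetric])
  then show ?thesis by (auto simp: lin_maps_def blinfun.zero_right)
qed

lemma is_basis_subspace: "is_basis v V \<Longrightarrow> subspace V"
  unfolding is_basis_def by auto

lemma is_basis_axis: "is_basis (\<lambda>i. axis i (1 :: real)) (UNIV :: (real^'d) set)"
  using is_basis_linear_injective_image[of "\<lambda>x :: real^'d. x"] by (simp add: linear_iff)

lemma minors_change_of_basis:
  fixes v :: "'m::{finite,linorder} \<Rightarrow> 'a::euclidean_space" and b :: "'k::{finite,linorder} \<Rightarrow> 'a"
  assumes "\<And>j. P (b j) \<in> span (range v)"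
  shows "\<exists>\<Lambda>. linear \<Lambda> \<and> (\<forall>F :: 'a \<Rightarrow>\<^sub>L (real^'d::{finite,linorder}).
    (\<forall>j. blinfun_apply F (b j) = blinfun_apply F (P (b j))) \<longrightarrow>
    minors (matrix_wrt b F) = \<Lambda> (minors (matrix_wrt v F)))"
proof -
  from matrix_wrt_change_of_basis[of P b v, OF assms]
  obtain C :: "real^'k::{finite,linorder}^'m::{finite,linorder}" where
    C: "\<forall>F :: 'a \<Rightarrow>\<^sub>L (real^'d::{finite,linorder}).
      (\<forall>j. blinfun_apply F (b j) = blinfun_apply F (P (b j))) \<longrightarrow> matrix_wrt b F = matrix_wrt v F ** C"
    by (rule exE)
  from minors_matrix_mult_linear[of C]
  obtain \<Lambda> where \<Lambda>: "linear \<Lambda>" "\<forall>A :: real^'m::{finite,linorder}^'d::{finite,linorder}. minors (A ** C) = \<Lambda> (minors A)"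
    by (elim exE conjE) (rule that)
  show ?thesis
    using C \<Lambda> by (intro exI[of _ \<Lambda>]) simp
qed

text \<open>The basis \<open>b\<close> that witnesses polyconvexity on the whole space may depend on the point \<open>x\<close> in an
uncontrolled way, but \<open>V\<close> may be given any basis \<open>v\<close>: the vectors of \<open>b\<close> act on maps in
\<open>lin_maps V\<close> through their orthogonal projections to \<open>V\<close>, which are combinations of the vectors
of \<open>v\<close>.\<close>

lemma polyconvex_on_subspace:
  fixes W :: "'d::{finite,linorder} endo \<Rightarrow> real" and v :: "'m::{finite,linorder} \<Rightarrow> real^'d::{finite,linorder}"
  assumes pc: "polyconvex TYPE('d) UNIV W" and v: "is_basis v V"
  shows "\<exists>\<Phi>. convex_on UNIV \<Phi> \<and> (\<forall>F \<in> lin_maps V. W F = \<Phi> (minors (matrix_wrt v F)))"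
proof -
  obtain b :: "'d \<Rightarrow> real^'d::{finite,linorder}" and \<Phi> where \<Phi>: "convex_on UNIV \<Phi>"
    "\<And>F. W F = \<Phi> (minors (matrix_wrt b F))"
    using pc unfolding polyconvex_def lin_maps_UNIV by auto
  have V: "subspace V" "span (range v) = V" using v by (simp_all add: is_basis_subspace) (simp add: is_basis_def)
  have "\<exists>u. u \<in> V \<and> y - u \<in> orthogonal_comp V" for y
  proof -
    have sV: "span V = V" using V(1) by (simp add: span_eq_iff)
    obtain u z where "u \<in> V" "\<And>w. w \<in> V \<Longrightarrow> orthogonal z w" "y = u + z"
      using orthogonal_subspace_decomp_exists[of V y, unfolded sV] by metis
    then show ?thesis by (intro exI[of _ u]) (simp add: orthogonal_comp_def orthogonal_commute)
  qed
  then obtain P where P: "\<And>y. P y \<in> V" "\<And>y. y - P y \<in> orthogonal_comp V" by metis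
  have FP: "blinfun_apply F y = blinfun_apply F (P y)" if "F \<in> lin_maps V" for F :: "'d endo" and y
  proof -
    have "blinfun_apply F (y - P y) = 0" using that P(2) by (simp add: lin_maps_def)
    then show ?thesis by (simp add: blinfun.diff_right)
  qed
  obtain \<Lambda> where \<Lambda>: "linear \<Lambda>" "\<And>F :: 'd endo. (\<And>j. blinfun_apply F (b j) = blinfun_apply F (P (b j))) \<Longrightarrow>
      minors (matrix_wrt b F) = \<Lambda> (minors (matrix_wrt v F))"
    using minors_change_of_basis[of P b v] P(1) V(2) by auto
  show ?thesis
  proof (intro exI[of _ "\<lambda>x. \<Phi> (\<Lambda> x)"] conjI ballI)
    show "convex_on UNIV (\<lambda>x. \<Phi> (\<Lambda> x))" by (rule convex_on_linear_compose[OF \<Phi>(1) \<Lambda>(1)])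
    show "W F = \<Phi> (\<Lambda> (minors (matrix_wrt v F)))" if "F \<in> lin_maps V" for F
      using \<Phi>(2)[of F] \<Lambda>(2)[of F] FP[OF that] by simp
  qed
qed

text \<open>A map and its restriction to \<open>V\<close> have the same matrix with respect to a basis of \<open>V\<close>, and the minors
of this matrix are linear functions of the minors with respect to the standard basis.\<close>

lemma polyconvex_restr_lin:
  fixes W :: "'d::{finite,linorder} endo \<Rightarrow> real" and v :: "'m::{finite,linorder} \<Rightarrow> real^'d::{finite,linorder}"
  assumes v: "is_basis v V" and \<Phi>: "convex_on UNIV \<Phi>"
    and W: "\<And>F. F \<in> lin_maps V \<Longrightarrow> W F = \<Phi> (minors (matrix_wrt v F))"
  shows "polyconvex TYPE('d) UNIV (\<lambda>A. W (restr_lin V A))"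
proof -
  have V: "subspace V" using v by (rule is_basis_subspace)
  have vV: "v j \<in> V" for j
    using v span_superset[of "range v"] unfolding is_basis_def by auto
  let ?b = "\<lambda>i::'d. axis i (1::real)"
  have "span (range ?b) = UNIV" using is_basis_axis unfolding is_basis_def by blast
  then obtain \<Lambda> where \<Lambda>: "linear \<Lambda>" "\<And>A :: 'd endo. minors (matrix_wrt v A) = \<Lambda> (minors (matrix_wrt ?b A))"
    using minors_change_of_basis[of "\<lambda>x. x" v ?b] by auto
  have "W (restr_lin V A) = \<Phi> (\<Lambda> (minors (matrix_wrt ?b A)))" for A
  proof -
    have "matrix_wrt v (restr_lin V A) = matrix_wrt v A"
      by (simp add: matrix_wrt_def restr_lin_apply[OF V vV])
    then show ?thesis by (simp only: W[OF restr_lin_in[OF V]] \<Lambda>(2))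
  qed
  then show ?thesis
    unfolding polyconvex_def
    using is_basis_axis convex_on_linear_compose[OF \<Phi> \<Lambda>(1)]
    by (intro exI[of _ ?b] exI[of _ "\<lambda>x. \<Phi> (\<Lambda> x)"]) simp
qed

text \<open>The common part of both implications towards tangential polyconvexity. The function \<open>W\<close> is the
polyconvex extension of \<open>U (x, -)\<close> from the tangent space; the two implications use different
extensions.\<close>

lemma tangentially_polyconvexI:
  fixes \<Omega> :: "(real^'d::{finite,linorder}) set"
  assumes card: "CARD('m::{finite,linorder}) = CARD('d) - 1"
    and \<Omega>: "bounded \<Omega>" "open \<Omega>" "lipschitz_boundary \<Omega>"
    and pc: "AE x\<in>frontier \<Omega> in surface_measure. subspace (tangent_space \<Omega> x) \<longrightarrow>
      (\<exists>W. polyconvex TYPE('d) UNIV W \<and> (\<forall>F \<in> lin_maps (tangent_space \<Omega> x). U (x, F) = W F))"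
  shows "tangentially_polyconvex TYPE('m) \<Omega> (restrict U (tangent_bundle_pow \<Omega>))"
proof -
  obtain v :: "'m \<Rightarrow> real^'d::{finite,linorder} \<Rightarrow> real^'d::{finite,linorder}" where v: "measurable_tangent_basis \<Omega> v"
    using exists_measurable_tangent_basis[OF card \<Omega>] by (rule exE)
  define good where "good x \<phi> \<longleftrightarrow> convex_on UNIV \<phi> \<and>
    (\<forall>F \<in> lin_maps (tangent_space \<Omega> x). restrict U (tangent_bundle_pow \<Omega>) (x, F) = \<phi> (minors (matrix_wrt (\<lambda>j. v j x) F)))"
    for x and \<phi> :: "real^('d, 'm) minor_index \<Rightarrow> real"
  define \<Phi>0 where "\<Phi>0 x = (SOME \<phi>. good x \<phi>)" for x
  have "AE x\<in>frontier \<Omega> in surface_measure. is_basis (\<lambda>j. v j x) (tangent_space \<Omega> x)"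
    using v unfolding measurable_tangent_basis_def by simp
  with pc have "AE x in surface_measure. x \<in> frontier \<Omega> \<longrightarrow> good x (\<Phi>0 x)"
  proof eventually_elim
    case (elim x)
    show ?case
    proof
      assume x: "x \<in> frontier \<Omega>"
      then have b: "is_basis (\<lambda>j. v j x) (tangent_space \<Omega> x)" using elim(2) by simp
      then have s: "subspace (tangent_space \<Omega> x)" by (rule is_basis_subspace)
      then obtain W where W: "polyconvex TYPE('d) UNIV W" "\<forall>F \<in> lin_maps (tangent_space \<Omega> x). U (x, F) = W F"
        using elim(1) x by auto
      from polyconvex_on_subspace[OF W(1) b]
      obtain \<Phi> where "convex_on UNIV \<Phi>" "\<forall>F \<in> lin_maps (tangent_space \<Omega> x). W F = \<Phi> (minors (matrix_wrt (\<lambda>j. v j x) F))"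
        by (elim exE conjE) simp
      then have "good x \<Phi>"
        using W(2) x s by (simp add: good_def tangent_bundle_pow_def has_tangent_space_def)
      then show "good x (\<Phi>0 x)" unfolding \<Phi>0_def by (rule someI[of "good x"])
    qed
  qed
  then show ?thesis
    unfolding tangentially_polyconvex_def good_def
    using v by (intro exI[of _ v] exI[of _ \<Phi>0] conjI)
qed

theorem proposition7p5:
  fixes \<Omega> :: "(real^'d::{finite,linorder}) set"
  assumes "CARD('d) \<ge> 2"
    and "CARD('m::{finite,linorder}) = CARD('d) - 1"
    and "bounded \<Omega>" and "open \<Omega>" and "lipschitz_boundary \<Omega>"
  shows
    "(\<forall>Ut :: (real^'d::{finite,linorder}) \<times> 'd endo \<Rightarrow> real.
        (AE x\<in>frontier \<Omega> in surface_measure.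
           polyconvex TYPE('d) UNIV (\<lambda>A. Ut (x, restr_lin (tangent_space \<Omega> x) A)))
        \<longleftrightarrow> tangentially_polyconvex TYPE('m) \<Omega> (restrict Ut (tangent_bundle_pow \<Omega>))) \<and>
     (\<forall>U :: (real^'d::{finite,linorder}) \<times> 'd endo \<Rightarrow> real.
        (AE x\<in>frontier \<Omega> in surface_measure. polyconvex TYPE('d) UNIV (\<lambda>A. U (x, A)))
        \<longrightarrow> tangentially_polyconvex TYPE('m) \<Omega> (restrict U (tangent_bundle_pow \<Omega>)))"
proof (intro conjI allI iffI impI)
  fix Ut :: "(real^'d::{finite,linorder}) \<times> 'd endo \<Rightarrow> real"
  assume pc: "AE x\<in>frontier \<Omega> in surface_measure.
    polyconvex TYPE('d) UNIV (\<lambda>A. Ut (x, restr_lin (tangent_space \<Omega> x) A))"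
  show "tangentially_polyconvex TYPE('m) \<Omega> (restrict Ut (tangent_bundle_pow \<Omega>))"
  proof (rule tangentially_polyconvexI[OF assms(2-5)])
    from pc show "AE x\<in>frontier \<Omega> in surface_measure. subspace (tangent_space \<Omega> x) \<longrightarrow>
      (\<exists>W. polyconvex TYPE('d) UNIV W \<and> (\<forall>F \<in> lin_maps (tangent_space \<Omega> x). Ut (x, F) = W F))"
    proof eventually_elim
      case (elim x)
      show ?case
      proof (intro impI)
        assume "x \<in> frontier \<Omega>" "subspace (tangent_space \<Omega> x)"
        then show "\<exists>W. polyconvex TYPE('d) UNIV W \<and> (\<forall>F \<in> lin_maps (tangent_space \<Omega> x). Ut (x, F) = W F)"
          using elim by (intro exI[of _ "\<lambda>A. Ut (x, restr_lin (tangent_space \<Omega> x) A)"])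
            (simp add: restr_lin_id)
      qed
    qed
  qed
next
  fix Ut :: "(real^'d::{finite,linorder}) \<times> 'd endo \<Rightarrow> real"
  assume "tangentially_polyconvex TYPE('m) \<Omega> (restrict Ut (tangent_bundle_pow \<Omega>))"
  then obtain v :: "'m \<Rightarrow> real^'d::{finite,linorder} \<Rightarrow> real^'d::{finite,linorder}" and \<Phi> where
    v: "measurable_tangent_basis \<Omega> v" and
    \<Phi>: "AE x\<in>frontier \<Omega> in surface_measure. convex_on UNIV (\<Phi> x) \<and>
      (\<forall>F \<in> lin_maps (tangent_space \<Omega> x).
        restrict Ut (tangent_bundle_pow \<Omega>) (x, F) = \<Phi> x (minors (matrix_wrt (\<lambda>j. v j x) F)))"
    unfolding tangentially_polyconvex_def by (elim exE conjE) simp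
  have "AE x\<in>frontier \<Omega> in surface_measure. is_basis (\<lambda>j. v j x) (tangent_space \<Omega> x)"
    using v unfolding measurable_tangent_basis_def by simp
  with \<Phi> show "AE x\<in>frontier \<Omega> in surface_measure.
    polyconvex TYPE('d) UNIV (\<lambda>A. Ut (x, restr_lin (tangent_space \<Omega> x) A))"
  proof eventually_elim
    case (elim x)
    show ?case
    proof
      assume x: "x \<in> frontier \<Omega>"
      then have b: "is_basis (\<lambda>j. v j x) (tangent_space \<Omega> x)" using elim(2) by simp
      then have s: "subspace (tangent_space \<Omega> x)" by (rule is_basis_subspace)
      show "polyconvex TYPE('d) UNIV (\<lambda>A. Ut (x, restr_lin (tangent_space \<Omega> x) A))"
      proof (rule polyconvex_restr_lin[OF b, where W = "\<lambda>A. Ut (x, A)"])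
        show "convex_on UNIV (\<Phi> x)" using elim(1) x by simp
        show "Ut (x, F) = \<Phi> x (minors (matrix_wrt (\<lambda>j. v j x) F))"
          if "F \<in> lin_maps (tangent_space \<Omega> x)" for F
          using elim(1) x s that by (simp add: tangent_bundle_pow_def has_tangent_space_def)
      qed
    qed
  qed
next
  fix U :: "(real^'d::{finite,linorder}) \<times> 'd endo \<Rightarrow> real"
  assume pc: "AE x\<in>frontier \<Omega> in surface_measure. polyconvex TYPE('d) UNIV (\<lambda>A. U (x, A))"
  show "tangentially_polyconvex TYPE('m) \<Omega> (restrict U (tangent_bundle_pow \<Omega>))"
  proof (rule tangentially_polyconvexI[OF assms(2-5)])
    from pc show "AE x\<in>frontier \<Omega> in surface_measure. subspace (tangent_space \<Omega> x) \<longrightarrow>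
      (\<exists>W. polyconvex TYPE('d) UNIV W \<and> (\<forall>F \<in> lin_maps (tangent_space \<Omega> x). U (x, F) = W F))"
    proof eventually_elim
      case (elim x)
      then show ?case by (intro impI exI[of _ "\<lambda>A. U (x, A)"]) simp
    qed
  qed
qed

end
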